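(* Let $n \in \{5,6,7,8\}$, let $B_n' = [B_n,B_n]$ be the commutator subgroup of the braid group $B_n$, and let $H$ be a non-trivial quotient of $B_n'$. Then $H \cong A_n$ or $|H| > n!/2$.
   Context: $B_n$ is the braid group on $n$ strands, with standard generators $\sigma_1,\dots,\sigma_{n-1}$ and relations $\sigma_i\sigma_j=\sigma_j\sigma_i$ for $|i-j|\ge 2$ and $\sigma_i\sigma_{i+1}\sigma_i=\sigma_{i+1}\sigma_i\sigma_{i+1}$. A non-trivial quotient of $B_n'$ is a group $H \neq 1$ for which there is a surjective homomorphism $B_n' \to H$. $A_n$ is the alternating group on $n$ letters. If $H$ is infinite, the inequality $|H|>n!/2$ is understood to hold. *)

theory Defs
  imports "HOL-Algebra.Algebra"
begin

text \<open>
  The letter \<open>(i, True)\<close> stands for the generator \<open>\<sigma>\<^sub>i\<close> and \<open>(i, False)\<close> for its formal inverse.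
\<close>

type_synonym braid_word = "(nat \<times> bool) list"

definition braid_words :: "nat \<Rightarrow> braid_word set" where
  "braid_words n = lists ({1..<n} \<times> UNIV)"

inductive_set braid_rel :: "nat \<Rightarrow> (braid_word \<times> braid_word) set" for n :: nat where
  refl: "w \<in> braid_words n \<Longrightarrow> (w, w) \<in> braid_rel n"
| sym: "(u, v) \<in> braid_rel n \<Longrightarrow> (v, u) \<in> braid_rel n"
| trans: "(u, v) \<in> braid_rel n \<Longrightarrow> (v, w) \<in> braid_rel n \<Longrightarrow> (u, w) \<in> braid_rel n"
| append: "(u, u') \<in> braid_rel n \<Longrightarrow> (v, v') \<in> braid_rel n \<Longrightarrow> (u @ v, u' @ v') \<in> braid_rel n"
| cancel: "i \<in> {1..<n} \<Longrightarrow> ([(i, b), (i, \<not> b)], []) \<in> braid_rel n"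
| commute: "i \<in> {1..<n} \<Longrightarrow> j \<in> {1..<n} \<Longrightarrow> i + 2 \<le> j \<Longrightarrow>
    ([(i, True), (j, True)], [(j, True), (i, True)]) \<in> braid_rel n"
| braid: "i \<in> {1..<n} \<Longrightarrow> Suc i \<in> {1..<n} \<Longrightarrow>
    ([(i, True), (Suc i, True), (i, True)], [(Suc i, True), (i, True), (Suc i, True)]) \<in> braid_rel n"

definition braid_group :: "nat \<Rightarrow> braid_word set monoid" where
  "braid_group n = \<lparr>carrier = braid_words n // braid_rel n,
     monoid.mult = (\<lambda>U V. \<Union>u\<in>U. \<Union>v\<in>V. braid_rel n `` {u @ v}),
     one = braid_rel n `` {[]}\<rparr>"

definition braid_commutator_group :: "nat \<Rightarrow> braid_word set monoid" where
  "braid_commutator_group n =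
     (braid_group n)\<lparr>carrier := derived (braid_group n) (carrier (braid_group n))\<rparr>"

lemma braid_rel_in_words: "(u, v) \<in> braid_rel n \<Longrightarrow> u \<in> braid_words n \<and> v \<in> braid_words n"
  by (induction rule: braid_rel.induct) (auto simp: braid_words_def)

lemma equiv_braid_rel: "equiv (braid_words n) (braid_rel n)"
proof (rule equivI)
  show "braid_rel n \<subseteq> braid_words n \<times> braid_words n"
    using braid_rel_in_words by auto
  show "refl_on (braid_words n) (braid_rel n)"
    by (auto simp: refl_on_def intro: braid_rel.refl)
  show "sym (braid_rel n)"
    by (rule symI) (rule braid_rel.sym)
  show "trans (braid_rel n)"
    by (rule transI) (rule braid_rel.trans)
qed

lemma braid_mult_class:
  assumes "u \<in> braid_words n" "v \<in> braid_words n"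
  shows "braid_rel n `` {u} \<otimes>\<^bsub>braid_group n\<^esub> braid_rel n `` {v} = braid_rel n `` {u @ v}"
proof -
  have eq: "braid_rel n `` {u' @ v'} = braid_rel n `` {u @ v}"
    if "u' \<in> braid_rel n `` {u}" "v' \<in> braid_rel n `` {v}" for u' v'
    using equiv_class_eq[OF equiv_braid_rel braid_rel.append, of u u' n v v'] that by simp
  have "braid_rel n `` {u} \<noteq> {}" "braid_rel n `` {v} \<noteq> {}"
    using assms by (auto intro: braid_rel.refl)
  then have "(\<Union>u'\<in>braid_rel n `` {u}. \<Union>v'\<in>braid_rel n `` {v}. braid_rel n `` {u' @ v'})
    = braid_rel n `` {u @ v}"
    using eq by blast
  then show ?thesis
    by (simp only: braid_group_def monoid.simps)
qed

definition braid_word_inv :: "braid_word \<Rightarrow> braid_word" where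
  "braid_word_inv w = rev (map (\<lambda>(i, b). (i, \<not> b)) w)"

lemma braid_word_inv_in_words: "w \<in> braid_words n \<Longrightarrow> braid_word_inv w \<in> braid_words n"
  by (fastforce simp: braid_words_def braid_word_inv_def in_lists_conv_set)

lemma braid_word_inv_cancel:
  "w \<in> braid_words n \<Longrightarrow> (braid_word_inv w @ w, []) \<in> braid_rel n"
proof (induction w)
  case Nil
  then show ?case by (auto simp: braid_word_inv_def intro: braid_rel.refl)
next
  case (Cons a w)
  obtain i b where a: "a = (i, b)" by force
  have i: "i \<in> {1..<n}" and w: "w \<in> braid_words n"
    using Cons.prems by (auto simp: a braid_words_def)
  have "([(i, \<not> b), (i, b)], []) \<in> braid_rel n"
    using braid_rel.cancel[OF i, of "\<not> b"] by simp
  then have "([(i, \<not> b), (i, b)] @ w, [] @ w) \<in> braid_rel n"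
    using w by (intro braid_rel.append braid_rel.refl)
  then have "(braid_word_inv w @ ([(i, \<not> b), (i, b)] @ w), braid_word_inv w @ ([] @ w)) \<in> braid_rel n"
    using w by (intro braid_rel.append[of "braid_word_inv w"] braid_rel.refl braid_word_inv_in_words)
  then have "(braid_word_inv (a # w) @ a # w, braid_word_inv w @ w) \<in> braid_rel n"
    by (simp add: a braid_word_inv_def)
  then show ?case
    using Cons.IH[OF w] by (rule braid_rel.trans)
qed

lemma group_braid_group: "group (braid_group n)"
proof (rule groupI)
  have nil: "[] \<in> braid_words n" by (simp add: braid_words_def)
  have app: "u @ v \<in> braid_words n" if "u \<in> braid_words n" "v \<in> braid_words n" for u v
    using that by (auto simp: braid_words_def)
  have carr: "carrier (braid_group n) = braid_words n // braid_rel n"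
    and one: "\<one>\<^bsub>braid_group n\<^esub> = braid_rel n `` {[]}"
    by (simp_all add: braid_group_def)
  show "\<one>\<^bsub>braid_group n\<^esub> \<in> carrier (braid_group n)"
    unfolding carr one using nil by (rule quotientI)
  fix x assume "x \<in> carrier (braid_group n)"
  then obtain u where u: "u \<in> braid_words n" and x: "x = braid_rel n `` {u}"
    unfolding carr by (rule quotientE)
  show "\<one>\<^bsub>braid_group n\<^esub> \<otimes>\<^bsub>braid_group n\<^esub> x = x"
    unfolding x one using u nil by (simp add: braid_mult_class)
  have "braid_rel n `` {braid_word_inv u @ u} = braid_rel n `` {[]}"
    using equiv_class_eq[OF equiv_braid_rel braid_word_inv_cancel[OF u]] .
  then have "braid_rel n `` {braid_word_inv u} \<otimes>\<^bsub>braid_group n\<^esub> x = \<one>\<^bsub>braid_group n\<^esub>"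
    unfolding x one using u braid_word_inv_in_words by (simp add: braid_mult_class)
  moreover have "braid_rel n `` {braid_word_inv u} \<in> carrier (braid_group n)"
    unfolding carr using u by (intro quotientI braid_word_inv_in_words)
  ultimately show "\<exists>y\<in>carrier (braid_group n). y \<otimes>\<^bsub>braid_group n\<^esub> x = \<one>\<^bsub>braid_group n\<^esub>"
    by blast
  fix y assume "y \<in> carrier (braid_group n)"
  then obtain v where v: "v \<in> braid_words n" and y: "y = braid_rel n `` {v}"
    unfolding carr by (rule quotientE)
  show "x \<otimes>\<^bsub>braid_group n\<^esub> y \<in> carrier (braid_group n)"
    unfolding x y carr using u v app by (simp add: braid_mult_class quotientI)
  fix z assume "z \<in> carrier (braid_group n)"
  then obtain w where w: "w \<in> braid_words n" and z: "z = braid_rel n `` {w}"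
    unfolding carr by (rule quotientE)
  show "x \<otimes>\<^bsub>braid_group n\<^esub> y \<otimes>\<^bsub>braid_group n\<^esub> z = x \<otimes>\<^bsub>braid_group n\<^esub> (y \<otimes>\<^bsub>braid_group n\<^esub> z)"
    unfolding x y z using u v w app by (simp add: braid_mult_class)
qed

end

theory Submission
  imports Defs
begin

text \<open>
  Suppose that $H$ is finite and $|H| \<le> n!/2$. A maximal normal subgroup $N$ of $H$ gives a simple
  quotient $H/N$. If this is $A_n$ then counting forces $N$ to be trivial, so it is enough to
  show that a finite simple quotient $B_n'/K$ is $A_n$ or has more than $n!/2$ elements
  (\<open>maximal_quotient\<close>).

  The braid group acts on the right cosets of $K$ in $B_n$. Let $s_i$ be the permutation by which
  $\<sigma>_i$ acts. Since $B_n$ is generated by $B_n'$ together with any single $\<sigma>_i$, an element of $K$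
  whose action commutes with one $s_i$ acts trivially (\<open>coset_perm_detects\<close>). This makes
  $B_n' \<rightarrow> B_n'/K$ nearly injective on everything that centralises a generator, and it is the tool by
  which relations in the quotient are lifted to relations between the $s_i$. The argument splits
  according to whether $s_1^2 = s_2^2$.

  If $s_1^2 = s_2^2$ then all $s_i^2$ coincide and are central. The pure braids which act as the power
  of $s_1$ given by their exponent sum then form a normal subgroup $L$ of $B_n$ that
  contains the squares of the generators. The quotient $B_n/L$ is generated by involutions that satisfy the
  braid relations, hence has at most $n!$ elements (\<open>coxeter_card\<close>), while it maps onto $S_n$. So
  $L$ is the whole pure braid group, every pure braid in $B_n'$ lies in $K$, and $B_n'/K$ is a
  nontrivial quotient of $A_n$. As $A_n$ is simple (\<open>alt_group_normal_subgroup\<close>), it is $A_n$.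

  If $s_1^2 \<noteq> s_2^2$ then $B_n'/K$ is too large. Let $M$ be the image in $B_n'/K$ of the products, of exponent
  sum zero, of a braid on strands $1,2,3$ and a braid on strands $4,\<dots>,n$. A proper subgroup of index $k$ in a simple group bounds
  the order by $k!$ (\<open>order_le_fact_index\<close>), so a lower bound $b \<le> |M|$ leaves only
  those $k$ with $kb \<le> n!/2$ and $kb \<le> k!$. The bound comes from counting
  conjugates of one generator, which are half twists along arcs, times abelian groups
  (\<open>card_block_product\<close>, \<open>arc_products\<close>, \<open>small_torus\<close>, \<open>large_torus\<close>); it is $64$, $384$, $2560$ for
  $n = 6, 7, 8$, and no $k$ is left. For $n \<ge> 6$ the subgroup $M$ is proper because the image of
  $\<sigma>_4\<sigma>_5^{-1}$ commutes with the first block. For $n = 5$ the bound $16$ excludes a proper $M$; if $M$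
  is everything, then full twists become powers of a generator, which excludes all small coincidences
  $s_1^k = s_2^k$ and raises the bound to $64 > 60$ (\<open>order_large_5\<close>).
\<close>

section \<open>Coset actions and simple groups\<close>

text \<open>
  Right multiplication by the inverse makes this a left action. Being the identity off the cosets
  turns it into a permutation of the whole type, so that it can be composed freely.
\<close>

definition coset_action :: "('a, 'm) monoid_scheme \<Rightarrow> 'a set \<Rightarrow> 'a \<Rightarrow> 'a set \<Rightarrow> 'a set" where
  "coset_action G K g C = (if C \<in> rcosets\<^bsub>G\<^esub> K then C #>\<^bsub>G\<^esub> inv\<^bsub>G\<^esub> g else C)"

context group begin

lemma rcosets_translate:
  assumes "subgroup K G" "C \<in> rcosets K" "g \<in> carrier G"
  shows "C #> g \<in> rcosets K"
proof -
  obtain x where x: "x \<in> carrier G" "C = K #> x"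
    using assms(2) by (auto simp: RCOSETS_def)
  have "C #> g = K #> (x \<otimes> g)"
    using coset_mult_assoc[OF subgroup.subset[OF assms(1)] x(1) assms(3)] x(2) by simp
  then show ?thesis
    using x assms(3) subgroup.subset[OF assms(1)] rcosetsI by auto
qed

lemma coset_action_mult:
  assumes "subgroup K G" "g \<in> carrier G" "h \<in> carrier G"
  shows "coset_action G K (g \<otimes> h) = coset_action G K g \<circ> coset_action G K h"
proof
  fix C
  show "coset_action G K (g \<otimes> h) C = (coset_action G K g \<circ> coset_action G K h) C"
  proof (cases "C \<in> rcosets K")
    case True
    then have "C \<subseteq> carrier G"
      using rcosets_part_G[OF assms(1)] by blast
    then show ?thesis
      using True assms rcosets_translate[OF assms(1) True, of "inv h"]
      by (simp add: coset_action_def coset_mult_assoc inv_mult_group)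
  qed (simp add: coset_action_def)
qed

lemma coset_action_one:
  assumes "subgroup K G" shows "coset_action G K \<one> = id"
proof
  fix C
  show "coset_action G K \<one> C = id C"
  proof (cases "C \<in> rcosets K")
    case True
    then have "C \<subseteq> carrier G"
      using rcosets_part_G[OF assms(1)] by blast
    then show ?thesis by (simp add: coset_action_def)
  qed (simp add: coset_action_def)
qed

lemma coset_action_inverse:
  assumes "subgroup K G" "g \<in> carrier G"
  shows "coset_action G K g \<circ> coset_action G K (inv g) = id" "coset_action G K (inv g) \<circ> coset_action G K g = id"
  using assms by (simp_all add: coset_action_one flip: coset_action_mult)

lemma coset_action_permutes:
  assumes "subgroup K G" "g \<in> carrier G"
  shows "coset_action G K g permutes (rcosets K)"
proof -
  have "bij (coset_action G K g)"
    using coset_action_inverse[OF assms] by (rule o_bij[rotated])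
  then show ?thesis
    by (simp add: permutes_bij coset_action_def permutes_def bij_iff)
qed

text \<open>
  The kernel of the action on the cosets of $K$ is the core of $K$: an element fixing the coset $Kx$
  lies in the conjugate $x^{-1}Kx$.
\<close>

lemma coset_action_eq_id:
  assumes "subgroup K G" "g \<in> carrier G" "coset_action G K g = id" "x \<in> carrier G"
  shows "x \<otimes> g \<otimes> inv x \<in> K"
proof -
  have K: "K \<subseteq> carrier G" using assms(1) by (rule subgroup.subset)
  have "K #> x \<in> rcosets K" using K assms(4) by (rule rcosetsI)
  then have "(K #> x) #> inv g = K #> x"
    using fun_cong[OF assms(3), of "K #> x"] unfolding coset_action_def by simp
  then have "((K #> x) #> inv g) #> inv x = (K #> x) #> inv x"
    by (rule arg_cong)
  then have "K #> (x \<otimes> inv g \<otimes> inv x) = K #> (x \<otimes> inv x)"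
    using coset_mult_assoc[OF K] assms(2,4) by simp
  then have "K #> (x \<otimes> inv g \<otimes> inv x) = K"
    using K assms(4) by simp
  then have "x \<otimes> inv g \<otimes> inv x \<in> K"
    using assms(1,2,4) by (intro coset_join1[of K]) auto
  then have "inv (x \<otimes> inv g \<otimes> inv x) \<in> K"
    by (rule subgroup.m_inv_closed[OF assms(1)])
  moreover have "inv (x \<otimes> inv g \<otimes> inv x) = x \<otimes> g \<otimes> inv x"
    using assms(2,4) by (simp add: inv_mult_group m_assoc)
  ultimately show ?thesis by simp
qed

lemma coset_action_id:
  assumes "subgroup K G" "g \<in> carrier G" "\<And>x. x \<in> carrier G \<Longrightarrow> x \<otimes> g \<otimes> inv x \<in> K"
  shows "coset_action G K g = id"
proof
  fix C
  show "coset_action G K g C = id C"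
  proof (cases "C \<in> rcosets K")
    case True
    then obtain x where x: "x \<in> carrier G" "C = K #> x" by (auto simp: RCOSETS_def)
    have K: "K \<subseteq> carrier G" using assms(1) subgroup.subset by blast
    have "inv (x \<otimes> g \<otimes> inv x) \<in> K" by (rule subgroup.m_inv_closed[OF assms(1) assms(3)[OF x(1)]])
    then have "x \<otimes> inv g \<otimes> inv x \<in> K" using x assms(2) by (simp add: inv_mult_group m_assoc)
    then have "K #> (x \<otimes> inv g \<otimes> inv x) = K"
      using assms(1) x(1) assms(2) by (intro coset_join2) auto
    then have "K #> (x \<otimes> inv g \<otimes> inv x) #> x = K #> x" by (rule arg_cong)
    then have "K #> (x \<otimes> inv g) = K #> x"
      using coset_mult_assoc[OF K] x(1) assms(2) by (simp add: m_assoc)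
    then have "C #> inv g = C"
      using coset_mult_assoc[OF K] x assms(2) by simp
    then show ?thesis using True by (simp add: coset_action_def)
  qed (simp add: coset_action_def)
qed

end

context simple_group begin

text \<open>
  The action on the cosets of $M$ is nontrivial, so by simplicity it is faithful and embeds the
  group into the symmetric group of degree $k$.
\<close>

lemma order_le_fact_index:
  assumes "finite (carrier G)" "subgroup M G" "M \<noteq> carrier G" and k: "card M * k = order G"
  shows "order G \<le> fact k"
proof -
  have fin: "finite (rcosets M)" using assms(1) cosets_finite rcosets_subset_PowG[OF assms(2)] by (meson finite_Pow_iff finite_subset)
  have blocks: "card M > 0"
    using assms(1,2) subgroup.subset[OF assms(2)] subgroup.one_closed[OF assms(2)]
    by (auto simp: card_gt_0_iff intro: finite_subset)
  have "card (rcosets M) * card M = order G" by (rule lagrange[OF assms(2)])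
  then have "card (rcosets M) * card M = k * card M" using k by (simp only: mult.commute)
  then have ck: "card (rcosets M) = k" using blocks by simp
  let ?N = "{g \<in> carrier G. coset_action G M g = id}"
  have "?N \<lhd> G"
  proof (rule normal_invI)
    show "subgroup ?N G"
      by (rule subgroupI)
        (auto simp: coset_action_one[OF assms(2)] coset_action_mult[OF assms(2)]
         dest: coset_action_inverse[OF assms(2)] intro!: exI[of _ "\<one>"])
    show "x \<otimes> h \<otimes> inv x \<in> ?N" if "x \<in> carrier G" "h \<in> ?N" for x h
      using that coset_action_inverse(1)[OF assms(2), of x] by (simp add: coset_action_mult[OF assms(2)])
  qed
  moreover have "?N \<noteq> carrier G"
  proof
    assume N: "?N = carrier G"
    have "carrier G \<subseteq> M"
    proof
      fix g assume g: "g \<in> carrier G"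
      then have "coset_action G M g = id" using N by blast
      from coset_action_eq_id[OF assms(2) g this one_closed] show "g \<in> M" using g by simp
    qed
    then show False using assms(3) subgroup.subset[OF assms(2)] by blast
  qed
  ultimately have N: "?N = {\<one>}"
    using no_real_normal_subgroup by blast
  have "inj_on (coset_action G M) (carrier G)"
  proof (rule inj_onI)
    fix x y assume *: "x \<in> carrier G" "y \<in> carrier G" "coset_action G M x = coset_action G M y"
    then have "coset_action G M (x \<otimes> inv y) = id"
      using coset_action_inverse(1)[OF assms(2), of y] by (simp add: coset_action_mult[OF assms(2)])
    then have "x \<otimes> inv y \<in> ?N" using * by simp
    then have "x \<otimes> inv y = \<one>" unfolding N by simp
    then show "x = y" using * inv_equality[of x "inv y"] by simp
  qed
  moreover have "coset_action G M ` carrier G \<subseteq> {p. p permutes (rcosets M)}"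
    using coset_action_permutes[OF assms(2)] by blast
  ultimately show "order G \<le> fact k"
    using card_inj_on_le[of "coset_action G M" "carrier G" "{p. p permutes (rcosets M)}"] fin ck
    by (simp add: order_def finite_permutations card_permutations)
qed

text \<open>
  The centraliser of a conjugation invariant set is a normal subgroup. It contains $x \<noteq> 1$,
  so it is the whole group.
\<close>

lemma centralizer_of_invariant_set:
  assumes U: "U \<subseteq> carrier G" "\<And>g u. g \<in> carrier G \<Longrightarrow> u \<in> U \<Longrightarrow> g \<otimes> u \<otimes> inv g \<in> U"
    and x: "x \<in> carrier G" "x \<noteq> \<one>" "\<And>u. u \<in> U \<Longrightarrow> x \<otimes> u = u \<otimes> x"
    and g: "g \<in> carrier G" "u \<in> U"
  shows "g \<otimes> u = u \<otimes> g"
proof -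
  let ?N = "{h \<in> carrier G. \<forall>u\<in>U. h \<otimes> u \<otimes> inv h = u}"
  have "?N \<lhd> G"
  proof (rule normal_invI)
    show "subgroup ?N G"
    proof (rule subgroupI)
      show "?N \<subseteq> carrier G" by blast
      show "?N \<noteq> {}" using U(1) by (auto intro!: exI[of _ \<one>])
      fix a assume a: "a \<in> ?N"
      have "inv a \<otimes> u \<otimes> a = u" if "u \<in> U" for u
      proof -
        have u: "u \<in> carrier G" and f: "a \<otimes> u \<otimes> inv a = u" using that U(1) a by auto
        from u have "inv a \<otimes> (a \<otimes> u \<otimes> inv a) \<otimes> a = u"
          using a by (simp add: m_assoc) (simp flip: m_assoc)
        then show ?thesis unfolding f .
      qed
      then show "inv a \<in> ?N" using a by simp
      fix b assume b: "b \<in> ?N"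
      have "a \<otimes> b \<otimes> u \<otimes> inv (a \<otimes> b) = a \<otimes> (b \<otimes> u \<otimes> inv b) \<otimes> inv a" if "u \<in> U" for u
        using a b that U(1) by (simp add: inv_mult_group m_assoc subset_iff)
      then show "a \<otimes> b \<in> ?N" using a b by simp
    qed
    fix c h assume c: "c \<in> carrier G" and h: "h \<in> ?N"
    have "c \<otimes> h \<otimes> inv c \<otimes> u \<otimes> inv (c \<otimes> h \<otimes> inv c) = u" if u: "u \<in> U" for u
    proof -
      have uc: "u \<in> carrier G" using U(1) u by blast
      have "inv c \<otimes> u \<otimes> c \<in> U" using U(2)[of "inv c" u] c u by simp
      then have "h \<otimes> (inv c \<otimes> u \<otimes> c) \<otimes> inv h = inv c \<otimes> u \<otimes> c" using h by blast
      then have "c \<otimes> (h \<otimes> (inv c \<otimes> u \<otimes> c) \<otimes> inv h) \<otimes> inv c = u"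
        using c uc by (simp add: m_assoc) (simp flip: m_assoc)
      then show ?thesis using c h uc by (simp add: m_assoc inv_mult_group)
    qed
    then show "c \<otimes> h \<otimes> inv c \<in> ?N" using c h by simp
  qed
  moreover have "x \<in> ?N"
    using x U(1) by (auto simp: m_assoc)
  ultimately have "?N = carrier G"
    using x(2) no_real_normal_subgroup[of ?N] by blast
  then have "g \<otimes> u \<otimes> inv g = u" using g by blast
  then have "(g \<otimes> u \<otimes> inv g) \<otimes> g = u \<otimes> g" by simp
  then show ?thesis using g U(1) by (simp add: m_assoc subset_iff)
qed

end

section \<open>Simplicity of the alternating groups\<close>

definition three_cycle :: "'a \<Rightarrow> 'a \<Rightarrow> 'a \<Rightarrow> 'a \<Rightarrow> 'a" where
  "three_cycle a b c = (\<lambda>x. if x = a then b else if x = b then c else if x = c then a else x)"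

lemma cycle_of_list_three:
  "distinct [a, b, c] \<Longrightarrow> cycle_of_list [a, b, c] = three_cycle a b c"
  by (auto simp: three_cycle_def transpose_def fun_eq_iff)

lemma three_cycle_conj:
  assumes "bij g"
  shows "g \<circ> three_cycle a b c \<circ> inv_into UNIV g = three_cycle (g a) (g b) (g c)"
proof
  fix x
  obtain y where y: "x = g y" using assms by (metis bij_pointE)
  have "inj g" using assms by (rule bij_is_inj)
  then show "(g \<circ> three_cycle a b c \<circ> inv_into UNIV g) x = three_cycle (g a) (g b) (g c) x"
    unfolding y by (simp add: three_cycle_def inj_eq)
qed

context
  fixes n :: nat
  assumes n5: "5 \<le> n"
begin

interpretation A: group "alt_group n"
  by (rule alt_group_is_group)

lemma three_cycle_in_alt:
  assumes "distinct [a, b, c]" "{a, b, c} \<subseteq> {1..n}"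
  shows "three_cycle a b c \<in> carrier (alt_group n)"
proof -
  have "cycle_of_list [a, b, c] \<in> three_cycles n" using assms by fastforce
  then show ?thesis using three_cycles_incl cycle_of_list_three[OF assms(1)] by auto
qed

lemma exists_further_points:
  assumes "finite S" "card S \<le> 4"
  obtains e where "e \<in> {1..n}" "e \<notin> S"
proof -
  have "\<not> {1..n} \<subseteq> S"
    using card_mono[OF assms(1), of "{1..n}"] assms(2) n5 by auto
  then show thesis using that by blast
qed

text \<open>
  Some permutation takes one triple to the other; if it is odd, it is corrected by transposing two
  of the remaining points, of which there are at least two as $n \<ge> 5$.
\<close>

lemma alt_transitive_on_triples:
  assumes "distinct [a, b, c]" "{a, b, c} \<subseteq> {1..n}" "distinct [a', b', c']" "{a', b', c'} \<subseteq> {1..n}"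
  obtains p where "p \<in> carrier (alt_group n)" "p a = a'" "p b = b'" "p c = c'"
proof -
  define p1 where "p1 = transpose a a'"
  define p2 where "p2 = transpose (p1 b) b' \<circ> p1"
  define p3 where "p3 = transpose (p2 c) c' \<circ> p2"
  have p1: "p1 permutes {1..n}" unfolding p1_def using assms by (intro permutes_swap_id) auto
  have p2: "p2 permutes {1..n}" unfolding p2_def
    using assms permutes_in_image[OF p1] by (intro permutes_compose[OF p1] permutes_swap_id) auto
  have p3: "p3 permutes {1..n}" unfolding p3_def
    using assms permutes_in_image[OF p2] by (intro permutes_compose[OF p2] permutes_swap_id) auto
  have 1: "p1 a = a'" by (simp add: p1_def)
  have "p1 b \<noteq> p1 a" using inj_eq[OF permutes_inj[OF p1], of b a] assms(1) by simp
  then have "p1 b \<noteq> a'" using 1 by simp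
  then have 2: "p2 a = a'" "p2 b = b'" using 1 assms(3) by (auto simp: p2_def transpose_def)
  have "p2 c \<noteq> p2 a" "p2 c \<noteq> p2 b"
    using inj_eq[OF permutes_inj[OF p2], of c a] inj_eq[OF permutes_inj[OF p2], of c b] assms(1) by simp_all
  then have "p2 c \<noteq> a'" "p2 c \<noteq> b'" using 2 by simp_all
  then have 3: "p3 a = a'" "p3 b = b'" "p3 c = c'" using 2 assms(3) by (auto simp: p3_def transpose_def)
  show thesis
  proof (cases "evenperm p3")
    case True
    then show thesis using that[of p3] p3 3 by (simp add: alt_group_carrier)
  next
    case False
    obtain d where d: "d \<in> {1..n}" "d \<notin> {a', b', c'}"
      by (rule exists_further_points[of "{a', b', c'}"]) (auto simp: card_insert_if)
    obtain e where e: "e \<in> {1..n}" "e \<notin> {a', b', c', d}"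
      by (rule exists_further_points[of "{a', b', c', d}"]) (auto simp: card_insert_if)
    let ?q = "transpose d e \<circ> p3"
    have "?q permutes {1..n}" using d e by (intro permutes_compose[OF p3] permutes_swap_id) auto
    moreover have "evenperm ?q"
    proof -
      have "permutation p3" using p3 permutation_permutes by blast
      then show ?thesis
        using False e(2) evenperm_comp[OF permutation_swap_id[of d e], of p3] evenperm_swap[of d e] by simp
    qed
    moreover have "?q a = a'" "?q b = b'" "?q c = c'" using 3 d e by (auto simp: transpose_def)
    ultimately show thesis using that[of ?q] by (simp add: alt_group_carrier)
  qed
qed

text \<open>
  A nontrivial normal subgroup contains a $3$-cycle, and the $3$-cycles are conjugate and generate.
  To find one, take commutators of a nontrivial $g$ with $3$-cycles $c$: the product of $gcg^{-1}$
  and $c^{-1}$ collapses to a $3$-cycle whenever $g$ has a long enough orbit or a fixed point next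
  to a $2$-cycle. If $g$ has a $3$-cycle, or a $2$-cycle but no fixed point, one commutator produces
  an element of these two kinds.
\<close>

lemma alt_group_normal_subgroup:
  assumes L: "L \<lhd> alt_group n" and nontriv: "L \<noteq> {id}"
  shows "L = carrier (alt_group n)"
proof -
  interpret L: normal L "alt_group n" by (rule L)
  have bijA: "bij g" if "g \<in> carrier (alt_group n)" for g
    using that by (auto simp: alt_group_carrier intro: permutes_bij)
  have comp: "x \<circ> y \<in> L" if "x \<in> L" "y \<in> L" for x y
    using L.m_closed[OF that] by (simp add: alt_group_mult)
  have inv_alt: "inv\<^bsub>alt_group n\<^esub> g = inv_into UNIV g" if "g \<in> carrier (alt_group n)" for g
    using alt_group_inv_equality[OF that] .
  have conjL: "g \<circ> h \<circ> inv_into UNIV g \<in> L" if "g \<in> carrier (alt_group n)" "h \<in> L" for g h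
    using L.inv_op_closed2[OF that] inv_alt[OF that(1)] by (simp add: alt_group_mult)
  \<comment> \<open>Three-cycles are conjugate in the alternating group and generate it.\<close>
  have all: "L = carrier (alt_group n)"
    if abc: "distinct [a, b, c]" "{a, b, c} \<subseteq> {1..n}" and inL: "three_cycle a b c \<in> L" for a b c
  proof -
    have "three_cycles n \<subseteq> L"
    proof
      fix p assume "p \<in> three_cycles n"
      then obtain cs where cs: "p = cycle_of_list cs" "cycle cs" "length cs = 3" "set cs \<subseteq> {1..n}" by auto
      obtain a' b' c' where cs_def: "cs = [a', b', c']" using stupid_lemma[OF cs(3)] by auto
      have d': "distinct [a', b', c']" "{a', b', c'} \<subseteq> {1..n}" using cs(2,4) cs_def by auto
      obtain q where q: "q \<in> carrier (alt_group n)" "q a = a'" "q b = b'" "q c = c'"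
        by (rule alt_transitive_on_triples[OF abc d'])
      have "three_cycle a' b' c' \<in> L"
        using conjL[OF q(1) inL] three_cycle_conj[OF bijA[OF q(1)], of a b c] q by simp
      then show "p \<in> L" using cs(1) cs_def cycle_of_list_three[OF d'(1)] by simp
    qed
    then have "generate (alt_group n) (three_cycles n) \<subseteq> L"
      by (rule A.generate_subgroup_incl) (rule L.subgroup_axioms)
    then show ?thesis using alt_group_carrier_as_three_cycles L.subset by auto
  qed
  \<comment> \<open>The commutator of $g$ and a three-cycle.\<close>
  have star: "three_cycle (g x) (g y) (g z) \<circ> three_cycle x z y \<in> L"
    if g: "g \<in> L" and xyz: "distinct [x, y, z]" "{x, y, z} \<subseteq> {1..n}" for g x y z
  proof -
    have gA: "g \<in> carrier (alt_group n)" using g L.subset by blast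
    have "inv_into UNIV g \<in> L" using L.m_inv_closed[OF g] inv_alt[OF gA] by simp
    from conjL[OF three_cycle_in_alt[OF xyz] this]
    have "three_cycle x y z \<circ> inv_into UNIV g \<circ> inv_into UNIV (three_cycle x y z) \<in> L" .
    moreover have "inv_into UNIV (three_cycle x y z) = three_cycle x z y"
      by (rule inv_unique_comp) (use xyz in \<open>auto simp: three_cycle_def fun_eq_iff\<close>)
    ultimately have "g \<circ> (three_cycle x y z \<circ> inv_into UNIV g \<circ> three_cycle x z y) \<in> L"
      using comp[OF g] by simp
    then show ?thesis unfolding three_cycle_conj[OF bijA[OF gA], symmetric] by (simp only: comp_assoc)
  qed
  have perm: "g permutes {1..n}" if "g \<in> L" for g
    using subsetD[OF L.subset that] by (simp add: alt_group_carrier)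
  have injL: "g x = g y \<longleftrightarrow> x = y" if "g \<in> L" for g x y
    using inj_eq[OF permutes_inj[OF perm[OF that]]] .
  have inL: "g x \<in> {1..n}" if "g \<in> L" "x \<in> {1..n}" for g x
    using permutes_in_image[OF perm[OF that(1)], of x] that(2) by simp
  \<comment> \<open>The points $a, g(a), g^2(a)$ with $g^3(a) \<noteq> a$ make two three-cycles overlap in two points.\<close>
  have long: "L = carrier (alt_group n)"
    if g: "g \<in> L" and a: "a \<in> {1..n}" "g a \<noteq> a" "g (g a) \<noteq> a" "g (g (g a)) \<noteq> a" for g a
  proof -
    define b d e where "b = g a" "d = g b" "e = g d"
    have ne: "distinct [a, b, d]" "distinct [a, e, b]" "e \<noteq> d"
      using a injL[OF g, of "g a" a] injL[OF g, of "g (g a)" a] injL[OF g, of "g (g a)" "g a"]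
      unfolding b_d_e_def by auto
    have "three_cycle b d e \<circ> three_cycle a d b \<in> L"
      using star[OF g ne(1)] a(1) inL[OF g a(1)] inL[OF g inL[OF g a(1)]] unfolding b_d_e_def by simp
    moreover have "three_cycle b d e \<circ> three_cycle a d b = three_cycle a e b"
      using ne by (auto simp: three_cycle_def fun_eq_iff)
    ultimately show ?thesis using all[OF ne(2)] a(1) inL[OF g a(1)] inL[OF g inL[OF g inL[OF g a(1)]]] unfolding b_d_e_def by simp
  qed
  \<comment> \<open>A two-cycle and a fixed point of $g$ have the same effect.\<close>
  have swap: "L = carrier (alt_group n)"
    if g: "g \<in> L" and p: "distinct [p, q, e]" "{p, q, e} \<subseteq> {1..n}" "g p = q" "g q = p" "g e = e" for g p q e
  proof -
    have "three_cycle q p e \<circ> three_cycle p e q \<in> L" using star[OF g p(1,2)] p by simp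
    moreover have "three_cycle q p e \<circ> three_cycle p e q = three_cycle p q e"
      using p(1) by (auto simp: three_cycle_def fun_eq_iff)
    ultimately show ?thesis using all[OF p(1,2)] by simp
  qed
  obtain g where g: "g \<in> L" "g \<noteq> id"
    using nontriv L.one_closed by (auto simp: alt_group_one)
  then obtain a where ga: "g a \<noteq> a" by fastforce
  have gp: "g permutes {1..n}" using g(1) L.subset by (auto simp: alt_group_carrier)
  then have a: "a \<in> {1..n}" using ga by (auto simp: permutes_def)
  define b where "b = g a"
  have b: "b \<in> {1..n}" "b \<noteq> a" using inL[OF g(1) a] ga by (simp_all add: b_def)
  show ?thesis
  proof (cases "g b = a")
    case False
    define d where "d = g b"
    have d: "d \<in> {1..n}" "d \<noteq> a" "d \<noteq> b"
      using inL[OF g(1) b(1)] False injL[OF g(1), of b a] b by (auto simp: d_def b_def)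
    show ?thesis
    proof (cases "g d = a")
      case False
      then show ?thesis using long[OF g(1) a ga] d by (simp add: b_def d_def)
    next
      case True
      obtain z where z: "z \<in> {1..n}" "z \<notin> {a, b, d}"
        by (rule exists_further_points[of "{a, b, d}"]) (auto simp: card_insert_if)
      \<comment> \<open>Here $g$ permutes $a, b, d$ cyclically, and the three-cycle has to involve a point outside.\<close>
      define w where "w = g z"
      have w: "w \<in> {1..n}" "w \<notin> {a, b, d}"
        using inL[OF g(1) z(1)] z(2) injL[OF g(1), of z a] injL[OF g(1), of z b] injL[OF g(1), of z d] True
        by (auto simp: w_def d_def b_def)
      let ?u = "three_cycle b d w \<circ> three_cycle a z b"
      have u: "?u \<in> L"
        using star[OF g(1), of a b z] a b z by (auto simp: w_def b_def d_def)
      show ?thesis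
      proof (cases "w = z")
        case True
        obtain e where e: "e \<in> {1..n}" "e \<notin> {a, b, d, z}"
          by (rule exists_further_points[of "{a, b, d, z}"]) (auto simp: card_insert_if)
        show ?thesis
          by (rule swap[OF u, of a b e]) (use a b d z e True in \<open>auto simp: three_cycle_def\<close>)
      next
        case False
        show ?thesis
          by (rule long[OF u, of a]) (use a b d z w False in \<open>auto simp: three_cycle_def\<close>)
      qed
    qed
  next
    case True
    show ?thesis
    proof (cases "\<exists>e\<in>{1..n}. g e = e")
      case True
      then obtain e where e: "e \<in> {1..n}" "g e = e" by blast
      show ?thesis
        by (rule swap[OF g(1), of a b e]) (use a b e ga \<open>g b = a\<close> in \<open>auto simp: b_def\<close>)
    next
      case False
      obtain z where z: "z \<in> {1..n}" "z \<notin> {a, b}"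
        by (rule exists_further_points[of "{a, b}"]) (auto simp: card_insert_if)
      \<comment> \<open>Here $g$ exchanges $a$ and $b$ and has no fixed point; the commutator exchanges $a$ and $z$ and fixes a fifth point.\<close>
      define w where "w = g z"
      have w: "w \<in> {1..n}" "w \<notin> {a, b, z}"
        using inL[OF g(1) z(1)] z injL[OF g(1), of z a] injL[OF g(1), of z b] \<open>g b = a\<close> False
        by (auto simp: w_def b_def)
      let ?u = "three_cycle b a w \<circ> three_cycle a z b"
      have u: "?u \<in> L"
        using star[OF g(1), of a b z] a b z \<open>g b = a\<close> by (auto simp: w_def b_def)
      obtain e where e: "e \<in> {1..n}" "e \<notin> {a, b, z, w}"
        by (rule exists_further_points[of "{a, b, z, w}"]) (auto simp: card_insert_if)
      show ?thesis
        by (rule swap[OF u, of a z e]) (use a b z w e in \<open>auto simp: three_cycle_def\<close>)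
    qed
  qed
qed

end

section \<open>Groups as a type class, conjugation, and words with exponent sums\<close>

text \<open>
  Multiplicatively written groups as a type class: the computations with generators below are
  equational and need no carrier.
\<close>

class grp = monoid_mult + inverse +
  assumes left_inv: "inverse a * a = 1"
begin

lemma left_cancel: "inverse a * (a * b) = b"
  by (simp add: left_inv flip: mult.assoc)

lemma mult_left_eq: "a * b = a * c \<longleftrightarrow> b = c"
  by (metis left_cancel)

lemma right_inv: "a * inverse a = 1"
  by (metis left_cancel left_inv mult_1_right)

lemma right_cancel: "a * (inverse a * b) = b"
  by (simp add: right_inv flip: mult.assoc)

lemma mult_right_eq: "b * a = c * a \<longleftrightarrow> b = c"
  by (metis mult.assoc mult_1_right right_inv)

lemma inv_inv: "inverse (inverse a) = a"
  by (metis mult_left_eq left_inv right_inv)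

lemma inv_one: "inverse 1 = 1"
  by (metis left_inv mult_1_right)

lemma inv_mult: "inverse (a * b) = inverse b * inverse a"
  by (metis mult.assoc mult_1_right mult_left_eq right_inv)

lemmas grp_simps = mult.assoc left_inv right_inv left_cancel right_cancel inv_inv inv_one inv_mult
  mult_left_eq mult_right_eq

lemma inv_power: "inverse (a ^ k) = inverse a ^ k"
  by (induction k) (simp_all add: inv_one inv_mult power_commutes)

definition commutes :: "'a \<Rightarrow> 'a \<Rightarrow> bool" where
  "commutes x y \<longleftrightarrow> x * y = y * x"

lemma commutes_refl [simp]: "commutes x x"
  and commutes_one [simp]: "commutes x 1" "commutes 1 x"
  by (simp_all add: commutes_def)

lemma commutes_sym: "commutes x y \<Longrightarrow> commutes y x"
  by (simp add: commutes_def)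

lemma commutes_commute: "commutes x y \<longleftrightarrow> commutes y x"
  by (auto simp: commutes_def)

lemma commutes_mult:
  assumes "commutes x a" "commutes x b" shows "commutes x (a * b)"
  using assms unfolding commutes_def by (metis mult.assoc)

lemma commutes_inv:
  assumes "commutes x a" shows "commutes x (inverse a)"
  using assms unfolding commutes_def by (metis mult.assoc right_inv left_inv mult_1_left mult_1_right)

lemma commutes_pow: "commutes x a \<Longrightarrow> commutes x (a ^ k)"
  by (induction k) (simp_all add: commutes_mult)

lemma commutes_mult': "commutes a x \<Longrightarrow> commutes b x \<Longrightarrow> commutes (a * b) x"
  and commutes_inv': "commutes a x \<Longrightarrow> commutes (inverse a) x"
  and commutes_pow': "commutes a x \<Longrightarrow> commutes (a ^ k) x"
  by (meson commutes_sym commutes_mult commutes_inv commutes_pow)+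

lemmas commutes_closed = commutes_mult commutes_inv commutes_pow commutes_mult' commutes_inv' commutes_pow'

definition conj_by :: "'a \<Rightarrow> 'a \<Rightarrow> 'a" where
  "conj_by g x = g * x * inverse g"

lemma conj_by_mult: "conj_by g (x * y) = conj_by g x * conj_by g y"
  and conj_by_inv: "conj_by g (inverse x) = inverse (conj_by g x)"
  and conj_by_one [simp]: "conj_by g 1 = 1" "conj_by 1 x = x"
  and conj_by_conj_by: "conj_by g (conj_by h x) = conj_by (g * h) x"
  by (simp_all add: conj_by_def grp_simps)

lemma conj_by_cancel: "conj_by g (conj_by (inverse g) x) = x" "conj_by (inverse g) (conj_by g x) = x"
  by (simp_all add: conj_by_conj_by right_inv left_inv)

lemma conj_by_pow: "conj_by g (x ^ k) = conj_by g x ^ k"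
  by (induction k) (simp_all add: conj_by_mult)

lemma conj_by_inject [simp]: "conj_by g x = conj_by g y \<longleftrightarrow> x = y"
  by (simp add: conj_by_def grp_simps)

lemma commutes_conj: "commutes (conj_by g x) (conj_by g y) \<longleftrightarrow> commutes x y"
  by (simp add: commutes_def flip: conj_by_mult)

lemma conj_by_commutes: "conj_by g x = x \<longleftrightarrow> commutes g x"
  unfolding conj_by_def commutes_def by (metis mult.assoc left_inv right_inv mult_1_right)

lemma conj_by_eq: "g * x = y * g \<Longrightarrow> conj_by g x = y"
  by (simp add: conj_by_def grp_simps)

lemma conj_by_inv_eq: "conj_by g x = y \<Longrightarrow> conj_by (inverse g) y = x"
  by (auto simp: conj_by_def grp_simps)

lemma braid_shift:
  assumes "a * b * a = b * a * b"
  shows "conj_by (a * b) a = b"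
  using assms by (intro conj_by_eq) (simp add: mult.assoc)

lemma braid_conj:
  assumes "a * b * a = b * a * b"
  shows "conj_by b a = conj_by (inverse a) b" "conj_by (inverse b) a = conj_by a b"
proof -
  have "b * a = inverse a * (b * a * b)" using assms by (metis left_cancel mult.assoc)
  then show "conj_by b a = conj_by (inverse a) b"
    unfolding conj_by_def by (metis grp_simps(1,3,6) mult_1_right)
  then show "conj_by (inverse b) a = conj_by a b"
    using assms unfolding conj_by_def by (metis inv_inv mult.assoc mult_right_eq left_cancel right_inv left_inv mult_1_right)
qed

lemma commutes_conj_iff:
  assumes "commutes g x"
  shows "commutes (conj_by g y) x \<longleftrightarrow> commutes y x" "commutes x (conj_by g y) \<longleftrightarrow> commutes x y"
  by (metis assms commutes_conj conj_by_commutes)+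

text \<open>
  The factor $h_j$ can be read off the product $h_j a$ from the conjugate of $w$ that it produces,
  since $a$ commutes with $w$.
\<close>

lemma card_transversal_mult:
  assumes "finite J" "finite A"
    and inj: "inj_on (\<lambda>j. conj_by (h j) w) J"
    and A: "\<And>a. a \<in> A \<Longrightarrow> commutes a w"
  shows "card ((\<lambda>(j, a). h j * a) ` (J \<times> A)) = card J * card A"
    and "finite ((\<lambda>(j, a). h j * a) ` (J \<times> A))"
proof -
  have "inj_on (\<lambda>(j, a). h j * a) (J \<times> A)"
  proof (rule inj_onI, clarsimp)
    fix j a j' a' assume *: "j \<in> J" "a \<in> A" "j' \<in> J" "a' \<in> A" "h j * a = h j' * a'"
    have "conj_by (h j * a) w = conj_by (h j) w" "conj_by (h j' * a') w = conj_by (h j') w"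
      using A * by (metis conj_by_conj_by conj_by_commutes)+
    then have "j = j'" using inj * by (auto dest: inj_onD)
    then show "j = j' \<and> a = a'" using * by (simp add: mult_left_eq)
  qed
  then show "card ((\<lambda>(j, a). h j * a) ` (J \<times> A)) = card J * card A"
    by (simp add: card_image card_cartesian_product)
  show "finite ((\<lambda>(j, a). h j * a) ` (J \<times> A))"
    using assms by simp
qed

lemma card_power_mult:
  assumes "finite A" "\<And>a. a \<in> A \<Longrightarrow> commutes a w"
    and "\<And>k. 0 < k \<Longrightarrow> k < m \<Longrightarrow> \<not> commutes (u ^ k) w"
  shows "card ((\<lambda>(j, a). u ^ j * a) ` ({..<m} \<times> A)) = m * card A"
    and "finite ((\<lambda>(j, a). u ^ j * a) ` ({..<m} \<times> A))"
proof -
  have *: "i = j" if "i \<le> j" "j < m" "conj_by (u ^ i) w = conj_by (u ^ j) w" for i j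
  proof -
    obtain k where k: "j = i + k" using \<open>i \<le> j\<close> le_Suc_ex by blast
    then have "w = conj_by (u ^ k) w"
      using that(3) by (metis conj_by_conj_by conj_by_inject power_add)
    then show ?thesis using assms(3)[of k] that k by (auto simp: conj_by_commutes[symmetric])
  qed
  have "inj_on (\<lambda>j. conj_by (u ^ j) w) {..<m}"
    by (rule inj_onI) (metis * lessThan_iff linear)
  from card_transversal_mult[OF _ assms(1) this assms(2)]
  show "card ((\<lambda>(j, a). u ^ j * a) ` ({..<m} \<times> A)) = m * card A"
    and "finite ((\<lambda>(j, a). u ^ j * a) ` ({..<m} \<times> A))" by simp_all
qed

end

text \<open>
  Words in the $s_i$ with $i \<in> I$, with their exponent sum. The exponent sum belongs to the word
  and not to the group element. For \<open>I = {1..<n}\<close>, the elements with a word of exponent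
  sum zero are those coming from the commutator subgroup of the braid group.
\<close>

inductive word :: "(nat \<Rightarrow> 'g::grp) \<Rightarrow> nat set \<Rightarrow> 'g \<Rightarrow> int \<Rightarrow> bool" for s I where
  one: "word s I 1 0"
| gen: "word s I x k \<Longrightarrow> i \<in> I \<Longrightarrow> word s I (x * s i) (k + 1)"
| inv: "word s I x k \<Longrightarrow> i \<in> I \<Longrightarrow> word s I (x * inverse (s i)) (k - 1)"

lemma word_mult: "word s I y l \<Longrightarrow> word s I x k \<Longrightarrow> word s I (x * y) (k + l)"
proof (induction y l rule: word.induct)
  case one then show ?case by simp
next
  case (gen y l i) then show ?case
    using word.gen[of s I "x * y" "k + l" i] by (simp add: mult.assoc add.assoc)
next
  case (inv y l i) then show ?case
    using word.inv[of s I "x * y" "k + l" i] by (simp add: mult.assoc add_diff_eq)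
qed

lemma word_gen: "i \<in> I \<Longrightarrow> word s I (s i) 1" "i \<in> I \<Longrightarrow> word s I (inverse (s i)) (- 1)"
  using word.gen[OF word.one, of i I s] word.inv[OF word.one, of i I s] by simp_all

lemma word_inv: "word s I x k \<Longrightarrow> word s I (inverse x) (- k)"
proof (induction rule: word.induct)
  case one then show ?case by (simp add: inv_one word.one)
next
  case (gen x k i) show ?case
    using word_mult[OF gen.IH word_gen(2)[OF gen.hyps(2)]] by (simp add: inv_mult algebra_simps)
next
  case (inv x k i) show ?case
    using word_mult[OF inv.IH word_gen(1)[OF inv.hyps(2)]] by (simp add: inv_mult inv_inv algebra_simps)
qed

lemma word_pow: "word s I x k \<Longrightarrow> word s I (x ^ m) (int m * k)"
  by (induction m) (auto simp: algebra_simps word.one intro: word_mult[where k = k, simplified add.commute[of k]] dest: word_mult)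

lemma word_conj: "word s I x k \<Longrightarrow> word s I g l \<Longrightarrow> word s I (conj_by g x) k"
  using word_mult[OF word_inv[of s I g l] word_mult[of s I x k g l]] by (simp add: conj_by_def)

lemma word_mono: "word s I x k \<Longrightarrow> I \<subseteq> J \<Longrightarrow> word s J x k"
  by (induction rule: word.induct) (auto intro: word.intros)

lemma word_commutes: "word s I x k \<Longrightarrow> (\<And>i. i \<in> I \<Longrightarrow> commutes y (s i)) \<Longrightarrow> commutes y x"
  by (induction rule: word.induct) (auto intro: commutes_closed)

section \<open>Families satisfying the braid relations\<close>

text \<open>
  Generators are indexed by numerals, and the index $1$ should stay a numeral.
\<close>

declare One_nat_def [simp del]

locale braided =
  fixes s :: "nat \<Rightarrow> 'g::grp" and n :: nat
  assumes n5: "5 \<le> n"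
    and braid: "\<And>i. 1 \<le> i \<Longrightarrow> Suc i < n \<Longrightarrow> s i * s (Suc i) * s i = s (Suc i) * s i * s (Suc i)"
    and far: "\<And>i j. 1 \<le> i \<Longrightarrow> i + 2 \<le> j \<Longrightarrow> j < n \<Longrightarrow> commutes (s i) (s j)"
begin

lemma far': "1 \<le> i \<Longrightarrow> i + 2 \<le> j \<Longrightarrow> j < n \<Longrightarrow> commutes (s j) (s i)"
  by (simp add: far commutes_commute)

text \<open>
  The braid that moves one strand across $k$ others. For $k = n - 1$, below called
  \<open>delta\<close>, it is a rotation of all strands, and conjugation by it shifts the
  generators.
\<close>

fun gens_prod :: "nat \<Rightarrow> 'g" where
  "gens_prod 0 = 1"
| "gens_prod (Suc k) = gens_prod k * s (Suc k)"

lemma gens_prod_commutes: "k + 2 \<le> j \<Longrightarrow> j < n \<Longrightarrow> commutes (s j) (gens_prod k)"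
  by (induction k) (auto intro!: commutes_mult far')

lemma gens_prod_shift: "1 \<le> i \<Longrightarrow> i < k \<Longrightarrow> k < n \<Longrightarrow> gens_prod k * s i = s (Suc i) * gens_prod k"
proof (induction k arbitrary: i)
  case 0 then show ?case by simp
next
  case (Suc k)
  show ?case
  proof (cases "i < k")
    case True
    have "s (Suc k) * s i = s i * s (Suc k)"
      using far'[of i "Suc k"] True Suc.prems by (auto simp: commutes_def)
    then have "gens_prod (Suc k) * s i = gens_prod k * s i * s (Suc k)"
      by (simp add: mult.assoc)
    then show ?thesis using Suc True by (simp add: mult.assoc)
  next
    case False
    then obtain m where m: "k = Suc m" "i = Suc m" using Suc.prems
      by (metis Suc_le_D less_SucE One_nat_def)
    have "gens_prod m * (s (Suc m) * s (Suc (Suc m)) * s (Suc m))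
        = (gens_prod m * s (Suc (Suc m))) * s (Suc m) * s (Suc (Suc m))"
      using braid[of "Suc m"] Suc.prems m by (simp add: mult.assoc)
    also have "gens_prod m * s (Suc (Suc m)) = s (Suc (Suc m)) * gens_prod m"
      using gens_prod_commutes[of m "Suc (Suc m)"] Suc.prems m by (simp add: commutes_def)
    finally show ?thesis using m by (simp add: mult.assoc)
  qed
qed

text \<open>
  The rotation continues cyclically: two steps take the last generator past the end, back to the
  first one.
\<close>

lemma gens_prod_square: "1 \<le> k \<Longrightarrow> k < n \<Longrightarrow> gens_prod k * gens_prod k * s k = s 1 * (gens_prod k * gens_prod k)"
proof -
  assume k: "1 \<le> k" "k < n"
  have *: "s 1 * (gens_prod k * gens_prod j) = gens_prod (Suc j) * gens_prod k" if "Suc j \<le> k" for j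
    using that
  proof (induction j)
    case (Suc j)
    have "s 1 * (gens_prod k * gens_prod (Suc j)) = gens_prod (Suc j) * (gens_prod k * s (Suc j))"
      using Suc by (simp flip: mult.assoc)
    then show ?case using gens_prod_shift[of "Suc j" k] Suc.prems k by (simp add: mult.assoc)
  qed (simp add: One_nat_def)
  obtain m where "k = Suc m" using k by (cases k) auto
  then have "s 1 * (gens_prod k * gens_prod k) = s 1 * (gens_prod k * gens_prod m) * s k"
    by (simp add: mult.assoc)
  then show ?thesis using *[of m] \<open>k = Suc m\<close> by simp
qed

definition delta :: 'g where "delta = gens_prod (n - 1)"

lemma conj_shift: "1 \<le> i \<Longrightarrow> Suc i < n \<Longrightarrow> conj_by delta (s i) = s (Suc i)"
  using gens_prod_shift[of i "n - 1"] unfolding delta_def by (intro conj_by_eq) auto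

text \<open>
  By the shift of generators, this says that the $k$-th powers of all generators coincide;
  equivalently, that they are central.
\<close>

definition central_power :: "nat \<Rightarrow> bool" where "central_power k \<longleftrightarrow> s 1 ^ k = s 2 ^ k"

text \<open>
  Conjugation by \<open>delta\<close> moves each pair of neighbouring generators to the next one.
\<close>

lemma power_eq_shift:
  assumes "1 \<le> i" "Suc i < n"
  shows "s i ^ k = s (Suc i) ^ k \<longleftrightarrow> central_power k"
  using assms
proof (induction i)
  case (Suc i)
  show ?case
  proof (cases "i = 0")
    case False
    then have "s (Suc i) = conj_by delta (s i)" "s (Suc (Suc i)) = conj_by delta (s (Suc i))"
      using Suc by (simp_all add: conj_shift)
    then show ?thesis using Suc False by (simp flip: conj_by_pow)
  qed (simp add: central_power_def numeral_2_eq_2 One_nat_def)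
qed simp

lemma central_power_eq:
  assumes "central_power k" "1 \<le> i" "i < n"
  shows "s i ^ k = s 1 ^ k"
  using assms(2,3)
proof (induction i)
  case (Suc i)
  then show ?case using power_eq_shift[of i k] assms(1) by (cases "i = 0") (auto simp flip: One_nat_def)
qed simp

lemma central_power_commutes:
  assumes "central_power k" "1 \<le> i" "i < n" "1 \<le> j" "j < n"
  shows "commutes (s i ^ k) (s j)"
proof -
  have "s i ^ k = s j ^ k" using central_power_eq assms by metis
  then show ?thesis by (simp add: commutes_pow')
qed

text \<open>
  Conjugation by $s_i s_{i+1}$ takes $s_i$ to $s_{i+1}$, but under the hypothesis it fixes $s_i^k$.
\<close>

lemma central_power_if_commutes:
  assumes "1 \<le> i" "Suc i < n" "commutes (s i ^ k) (s (Suc i))"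
  shows "central_power k"
proof -
  have "conj_by (s i * s (Suc i)) (s i ^ k) = s (Suc i) ^ k"
    using braid_shift[OF braid, of i] assms by (simp add: conj_by_pow)
  moreover have "conj_by (s i * s (Suc i)) (s i ^ k) = s i ^ k"
    using assms(3) by (simp add: conj_by_commutes commutes_mult' commutes_pow commutes_sym[OF assms(3)])
  ultimately show ?thesis using power_eq_shift assms by simp
qed

lemma central_power_if_commutes':
  assumes "1 \<le> i" "Suc i < n" "commutes (s (Suc i) ^ k) (s i)"
  shows "central_power k"
proof -
  have "conj_by (s (Suc i) * s i) (s (Suc i) ^ k) = s i ^ k"
    using braid_shift[OF braid[symmetric], of i] assms by (simp add: conj_by_pow)
  moreover have "conj_by (s (Suc i) * s i) (s (Suc i) ^ k) = s (Suc i) ^ k"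
    using assms(3) by (simp add: conj_by_commutes commutes_mult' commutes_pow commutes_sym[OF assms(3)])
  ultimately show ?thesis using power_eq_shift[OF assms(1,2), of k] by simp
qed

lemma central_power_diff: "central_power a \<Longrightarrow> central_power (a + b) \<Longrightarrow> central_power b"
  by (simp add: central_power_def power_add mult_left_eq)

lemma central_power_mult: "central_power a \<Longrightarrow> central_power (k * a)"
  by (simp add: central_power_def power_mult mult.commute[of k])

lemma not_commutes_adjacent:
  assumes "\<not> central_power 1" "1 \<le> i" "Suc i < n"
  shows "\<not> commutes (s i) (s (Suc i))" "\<not> commutes (s (Suc i)) (s i)"
  using central_power_if_commutes[of i 1] central_power_if_commutes'[of i 1] assms by auto

text \<open>
  Conjugating by $e$ leaves $a$ and $b$ alone and turns $c$ into $c^{-1}ec$. So $b$ commutes with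
  both $ac^{-1}$ and $a(c^{-1}ec)^{-1}$, hence with $e^{-1}c$ and with $c$.
\<close>

lemma commutes_quotient:
  fixes a b c e :: "'h::grp"
  assumes "commutes b (a * inverse c)" "commutes e a" "commutes e b" "e * c * e = c * e * c"
  shows "commutes b c"
proof -
  have ec: "conj_by e c = conj_by (inverse c) e"
    using braid_conj(1)[OF assms(4)[symmetric]] .
  have "commutes (conj_by e b) (conj_by e (a * inverse c))"
    using assms(1) by (simp only: commutes_conj)
  then have "commutes b (a * inverse (conj_by (inverse c) e))"
    using assms(2,3) unfolding conj_by_mult conj_by_inv ec by (simp only: conj_by_commutes[THEN iffD2])
  from commutes_mult[OF commutes_inv[OF assms(1)] this]
  have "commutes b (inverse (a * inverse c) * (a * inverse (conj_by (inverse c) e)))" .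
  also have "inverse (a * inverse c) * (a * inverse (conj_by (inverse c) e)) = inverse e * c"
    by (simp add: conj_by_def grp_simps)
  finally have "commutes b (e * (inverse e * c))"
    by (rule commutes_mult[OF commutes_sym[OF assms(3)]])
  then show ?thesis by (simp only: right_cancel)
qed

text \<open>
  The generator before $s_i$ is braided with $s_i$ and commutes with the two others, so that the
  previous lemma applies.
\<close>

lemma not_commutes_quotient:
  assumes "\<not> central_power 1" "2 \<le> i" "i + 2 < n"
  shows "\<not> commutes (s i * inverse (s (i + 2))) (s (i + 1))"
proof
  let ?a = "s i" and ?b = "s (i + 1)" and ?c = "s (i + 2)" and ?e = "s (i - 1)"
  assume "commutes (?a * inverse ?c) ?b"
  then have *: "commutes ?b (?c * inverse ?a)"
    using commutes_inv[OF commutes_sym] by (fastforce simp only: inv_mult inv_inv)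
  have "?e * ?a * ?e = ?a * ?e * ?a"
    using braid[of "i - 1"] assms by simp
  from commutes_quotient[OF * _ _ this] have "commutes ?b ?a"
    using far[of "i - 1" "i + 1"] far[of "i - 1" "i + 2"] assms by simp
  then show False using not_commutes_adjacent(2)[of i] assms by (simp add: One_nat_def)
qed

abbreviation twist3 :: 'g where "twist3 \<equiv> (s 1 * s 2) ^ 3"

lemma braid12: "s 1 * s 2 * s 1 = s 2 * s 1 * s 2"
  using braid[of 1] n5 by (simp add: numeral_2_eq_2)

text \<open>
  The full twist of three strands as the square of the half twist $aba$, and as a loop of the third
  strand around the first two followed by the full twist $a^2$ of these.
\<close>

lemma full_twist_eq:
  fixes a b :: "'h::grp"
  assumes "a * b * a = b * a * b"
  shows "(a * b) ^ 3 = b * a ^ 2 * b * a ^ 2" "(a * b) ^ 3 = (a * b * a) ^ 2"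
    "commutes ((a * b) ^ 3) a" "commutes ((a * b) ^ 3) b"
proof -
  have "(a * b) ^ 3 = (a * b * a) * (b * a * b)"
    by (simp add: numeral_3_eq_3 mult.assoc)
  then show 2: "(a * b) ^ 3 = (a * b * a) ^ 2"
    by (simp add: power2_eq_square flip: assms)
  have "b * a ^ 2 * b * a ^ 2 = b * a * (a * b * a) * a"
    by (simp add: power2_eq_square mult.assoc)
  also have "\<dots> = b * a * (b * a * b) * a"
    by (simp only: assms)
  also have "\<dots> = (b * a * b) * (a * b * a)"
    by (simp only: mult.assoc)
  finally show "(a * b) ^ 3 = b * a ^ 2 * b * a ^ 2"
    by (simp only: 2 power2_eq_square assms)
  have "(a * b * a) * a = b * (a * b * a)" "(a * b * a) * b = a * (a * b * a)"
    using assms by (metis mult.assoc)+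
  then have "(a * b * a) ^ 2 * a = a * (a * b * a) ^ 2"
    unfolding power2_eq_square by (metis mult.assoc)
  then show ca: "commutes ((a * b) ^ 3) a"
    unfolding 2 commutes_def .
  have "commutes (a * b) ((a * b) ^ 3)" by (simp add: commutes_pow)
  from commutes_mult[OF commutes_inv[OF ca] commutes_sym[OF this]]
  show "commutes ((a * b) ^ 3) b" by (simp add: grp_simps)
qed

lemma twist3_commutes: "commutes twist3 (s 1)" "commutes twist3 (s 2)" "4 \<le> j \<Longrightarrow> j < n \<Longrightarrow> commutes twist3 (s j)"
  using full_twist_eq(3,4)[OF braid12] by (auto intro!: commutes_closed far)

text \<open>
  The fourth strand running around the first three; the half twist $s_2$ takes place inside the
  loop.
\<close>

lemma strand_loop_commutes:
  "commutes (s 3 * (s 2 * s 1 ^ 2 * s 2) * s 3) (s 2)"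
proof -
  have 23: "s 2 * s 3 * s 2 = s 3 * s 2 * s 3"
    using braid[of 2] n5 by (simp add: numeral_3_eq_3 numeral_2_eq_2)
  have "s 2 * (s 3 * (s 2 * s 1 ^ 2 * s 2) * s 3) = (s 2 * s 3 * s 2) * s 1 ^ 2 * s 2 * s 3"
    by (simp only: mult.assoc)
  also have "\<dots> = s 3 * s 2 * (s 3 * s 1 ^ 2) * s 2 * s 3"
    unfolding 23 by (simp only: mult.assoc)
  also have "s 3 * s 1 ^ 2 = s 1 ^ 2 * s 3"
    using commutes_pow'[OF far[of 1 3]] n5 by (simp add: commutes_def)
  also have "s 3 * s 2 * (s 1 ^ 2 * s 3) * s 2 * s 3 = s 3 * s 2 * s 1 ^ 2 * (s 3 * s 2 * s 3)"
    by (simp only: mult.assoc)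
  also have "\<dots> = s 3 * (s 2 * s 1 ^ 2 * s 2) * s 3 * s 2"
    unfolding 23[symmetric] by (simp only: mult.assoc)
  finally show ?thesis
    by (simp add: commutes_def)
qed

lemma twist3_eq: "s 2 * s 1 ^ 2 * s 2 = twist3 * inverse (s 1 ^ 2)"
  using full_twist_eq(1)[OF braid12] by (simp add: grp_simps)

text \<open>
  Two rotation steps move the full twist of strands $1,2,3$ to the full twist of strands $3,4,5$.
\<close>

lemma twist34: "conj_by (delta ^ 2) twist3 = (s 3 * s 4) ^ 3"
proof -
  have "conj_by (delta ^ 2) (s i) = s (Suc (Suc i))" if "1 \<le> i" "Suc (Suc i) < n" for i
    using conj_shift[of i] conj_shift[of "Suc i"] that by (simp add: power2_eq_square flip: conj_by_conj_by)
  from this[of 1] this[of 2] have "conj_by (delta ^ 2) (s 1) = s 3" "conj_by (delta ^ 2) (s 2) = s 4"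
    using n5 by (simp_all add: numeral_eq_Suc One_nat_def)
  then show ?thesis by (simp only: conj_by_pow conj_by_mult)
qed

text \<open>
  Under the hypothesis the full twist $T$ of the first three strands is central in the group of the
  $s_i$, so it equals the full twist of strands $3,4,5$. Expanding $T$ in both of these ways, the
  loop of the fourth strand becomes $T s_1^{-2} s_3^2$, and enclosing it by $s_4$ gives $T^2
  s_1^{-2}s_3^{-2}$. Both commute with $s_2$, hence so does their quotient up to powers of $T$,
  which is $s_3^4$.
\<close>

lemma central_power_4_if_twist3_commutes:
  assumes "commutes twist3 (s 3)"
  shows "central_power 4"
proof -
  have twist3: "commutes twist3 (s i)" if "1 \<le> i" "i < n" for i
  proof -
    have "i = 1 \<or> i = 2 \<or> i = 3 \<or> 4 \<le> i" using that by linarith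
    then show ?thesis using twist3_commutes assms that by auto
  qed
  then have twist_gens_prod: "commutes twist3 (gens_prod k)" if "k < n" for k
    using that by (induction k) (auto intro: commutes_closed)
  have twist34: "(s 3 * s 4) ^ 3 = twist3"
  proof -
    have "commutes (delta ^ 2) twist3"
      unfolding delta_def using n5 by (intro commutes_pow'[OF commutes_sym[OF twist_gens_prod]]) linarith
    then show ?thesis using twist34 unfolding conj_by_commutes[symmetric] by metis
  qed
  \<comment> \<open>The loop of the fourth strand around the first three is the product of the full twist and $w$.\<close>
  define w where "w = inverse (s 1 ^ 2) * s 3 ^ 2"
  let ?I = "inverse (s 1 ^ 2)"
  have c3: "s 3 * twist3 = twist3 * s 3" "s 3 * ?I = ?I * s 3" "s 4 * twist3 = twist3 * s 4" "s 4 * ?I = ?I * s 4"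
    "?I * twist3 = twist3 * ?I"
    using commutes_sym[OF twist3[of 3]] commutes_sym[OF twist3[of 4]] commutes_inv[OF commutes_pow[OF far'[of 1 3]], of 2]
      commutes_inv[OF commutes_pow[OF far'[of 1 4]], of 2] commutes_sym[OF commutes_inv[OF commutes_pow[OF twist3[of 1]]], of 2] n5
    unfolding commutes_def by simp_all
  have X4: "s 3 * (s 2 * s 1 ^ 2 * s 2) * s 3 = twist3 * w"
  proof -
    have "s 3 * (twist3 * ?I) * s 3 = (s 3 * twist3) * ?I * s 3" by (simp only: mult.assoc)
    also have "\<dots> = twist3 * (s 3 * ?I) * s 3" unfolding c3(1) by (simp only: mult.assoc)
    also have "\<dots> = twist3 * w" unfolding c3(2) w_def power2_eq_square[of "s 3"] by (simp only: mult.assoc)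
    finally show ?thesis unfolding twist3_eq .
  qed
  have c2w: "commutes (s 2) w"
  proof -
    have "commutes (s 2) (inverse twist3 * (twist3 * w))"
      using commutes_mult[OF commutes_inv[OF commutes_sym[OF twist3[of 2]]] commutes_sym[OF strand_loop_commutes]] n5
      unfolding X4 by simp
    then show ?thesis by (simp only: left_cancel)
  qed
  have "commutes (s 2) (s 4 * (twist3 * w) * s 4)"
    using c2w commutes_sym[OF twist3[of 2]] far[of 2 4] n5 by (intro commutes_mult) auto
  moreover have "s 4 * (twist3 * w) * s 4 = twist3 * twist3 * inverse (s 1 ^ 2) * inverse (s 3 ^ 2)"
  proof -
    have b: "twist3 = s 4 * s 3 ^ 2 * s 4 * s 3 ^ 2"
      using full_twist_eq(1)[of "s 3" "s 4"] braid[of 3] twist34 n5 by (simp add: numeral_eq_Suc)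
    have "s 4 * (twist3 * w) * s 4 = (s 4 * twist3) * ?I * s 3 ^ 2 * s 4"
      unfolding w_def by (simp only: mult.assoc)
    also have "\<dots> = twist3 * (s 4 * ?I) * s 3 ^ 2 * s 4"
      unfolding c3(3) by (simp only: mult.assoc)
    also have "\<dots> = twist3 * ?I * (s 4 * s 3 ^ 2 * s 4)"
      unfolding c3(4) by (simp only: mult.assoc)
    also have "s 4 * s 3 ^ 2 * s 4 = twist3 * inverse (s 3 ^ 2)"
      by (subst b) (simp only: mult.assoc right_inv mult_1_right)
    also have "twist3 * ?I * (twist3 * inverse (s 3 ^ 2)) = twist3 * (?I * twist3) * inverse (s 3 ^ 2)"
      by (simp only: mult.assoc)
    finally show ?thesis unfolding c3(5) by (simp only: mult.assoc)
  qed
  ultimately have *: "commutes (s 2) (twist3 * twist3 * ?I * inverse (s 3 ^ 2))"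
    by simp
  have "commutes (s 2) (twist3 * twist3)"
    using commutes_sym[OF twist3[of 2]] n5 by (intro commutes_mult) auto
  from commutes_mult[OF commutes_inv[OF this] *]
  have "commutes (s 2) (?I * inverse (s 3 ^ 2))"
    by (simp only: mult.assoc left_cancel inv_mult)
  from commutes_mult[OF c2w commutes_inv[OF this]]
  have "commutes (s 2) (w * (s 3 ^ 2 * s 1 ^ 2))"
    by (simp only: inv_mult inv_inv)
  also have "w * (s 3 ^ 2 * s 1 ^ 2) = ?I * (s 3 ^ 4 * s 1 ^ 2)"
    by (simp add: w_def numeral_eq_Suc mult.assoc)
  also have "s 3 ^ 4 * s 1 ^ 2 = s 1 ^ 2 * s 3 ^ 4"
  proof -
    have "commutes (s 3 ^ 4) (s 1 ^ 2)"
      using far'[of 1 3] n5 by (intro commutes_pow commutes_pow') auto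
    then show ?thesis by (simp only: commutes_def)
  qed
  also have "?I * (s 1 ^ 2 * s 3 ^ 4) = s 3 ^ 4"
    by (rule left_cancel)
  finally have "commutes (s (Suc 2) ^ 4) (s 2)" by (simp add: commutes_commute)
  then show ?thesis using central_power_if_commutes'[of 2 4] n5 by simp
qed

text \<open>
  The elements $y_0 = s_2s_1^{-1}$ and $y_1 = s_1s_2s_1^{-2}$ are the images of free generators of
  the commutator subgroup of the braid group on three strands.
\<close>

definition y0 :: 'g where "y0 = s 2 * inverse (s 1)"
definition y1 :: 'g where "y1 = conj_by (s 1) y0"

lemma conj_y: "conj_by (s 1) y0 = y1" "conj_by (s 1) y1 = inverse y0 * y1"
proof -
  show "conj_by (s 1) y0 = y1" by (simp add: y1_def)
  have "inverse (s 2) * s 1 * s 2 = conj_by (s 1) (s 2)"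
    using braid_conj(2)[OF braid12] by (simp add: conj_by_def grp_simps)
  then have "s 1 * (inverse (s 2) * s 1 * s 2) * inverse (s 1) * inverse (s 1) =
      s 1 * conj_by (s 1) (s 2) * inverse (s 1) * inverse (s 1)" by simp
  then show "conj_by (s 1) y1 = inverse y0 * y1"
    by (simp add: y1_def y0_def conj_by_def grp_simps)
qed

text \<open>
  Conjugation by $s_1$ acts on $y_0$ and $y_1$ as in \<open>conj_y\<close>. If they commute, this
  action has order dividing six, so $s_1^6$ is central, and multiplying out $(y_0s_1^2)^3$ shows
  that the full twist is $s_1^6$. As the full twist is now central, so is $s_1^4$ by
  \<open>central_power_4_if_twist3_commutes\<close>, and then also $s_1^2$.
\<close>

lemma y_noncommuting:
  assumes "\<not> central_power 2"
  shows "\<not> commutes y0 y1"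
proof
  assume c: "commutes y0 y1"
  let ?a = "s 1"
  have c': "inverse y0 * y1 = y1 * inverse y0"
    using commutes_inv[OF commutes_sym[OF c]] by (simp add: commutes_def)
  have y3: "conj_by ?a (inverse y0 * y1) = inverse y0"
    unfolding conj_by_mult conj_by_inv conj_y by (simp only: c' left_cancel)
  then have a3: "conj_by (?a ^ 3) y0 = inverse y0"
    by (simp add: numeral_3_eq_3 conj_y flip: conj_by_conj_by)
  have "conj_by (?a ^ 6) y0 = conj_by (?a ^ 3) (conj_by (?a ^ 3) y0)"
    by (simp add: conj_by_conj_by flip: power_add)
  then have "conj_by (?a ^ 6) y0 = y0" by (simp add: a3 conj_by_inv inv_inv)
  then have "commutes (?a ^ 6) (y0 * ?a)"
    by (intro commutes_mult) (simp_all add: conj_by_commutes commutes_pow')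
  then have "commutes (?a ^ 6) (s 2)"
    by (simp add: y0_def grp_simps)
  then have c6: "central_power 6" using central_power_if_commutes[of 1 6] n5 by (simp add: numeral_2_eq_2 One_nat_def)
  have "s 2 * ?a = y0 * ?a ^ 2" by (simp add: y0_def grp_simps power2_eq_square)
  \<comment> \<open>The powers of $s_1$ are collected on the right.\<close>
  moreover have "(y0 * ?a ^ 2) ^ 3 = y0 * conj_by (?a ^ 2) y0 * conj_by (?a ^ 2) (conj_by (?a ^ 2) y0) * ?a ^ 6"
    by (simp add: numeral_eq_Suc conj_by_def grp_simps One_nat_def)
  moreover have "conj_by (?a ^ 2) y0 = inverse y0 * y1"
    by (simp add: power2_eq_square conj_y flip: conj_by_conj_by)
  moreover have "conj_by (?a ^ 2) (inverse y0 * y1) = inverse y1"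
    by (simp add: power2_eq_square y3 conj_by_inv conj_y flip: conj_by_conj_by)
  ultimately have "(s 2 * ?a) ^ 3 = ?a ^ 6"
    by (simp add: grp_simps)
  moreover have "(s 2 * ?a) ^ 3 = twist3"
  proof -
    have "(s 2 * ?a) ^ 3 = (s 2 * ?a * s 2) ^ 2" "twist3 = (?a * s 2 * ?a) ^ 2"
      using full_twist_eq(2)[OF braid12] full_twist_eq(2)[OF braid12[symmetric]] by simp_all
    then show ?thesis by (simp add: braid12)
  qed
  ultimately have "commutes twist3 (s 3)"
    using central_power_commutes[OF c6, of 1 3] n5 by simp
  then have "central_power 4" by (rule central_power_4_if_twist3_commutes)
  from central_power_diff[OF this, of 2] show False using c6 assms by simp
qed

text \<open>
  Membership in the centraliser of the commutator subgroup of $\<langle>s_1,s_2\<rangle>$.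
\<close>

definition centralizes_y :: "'g \<Rightarrow> bool" where "centralizes_y x \<longleftrightarrow> commutes x y0 \<and> commutes x y1"

lemma centralizes_y_closed: "centralizes_y 1" "centralizes_y x \<Longrightarrow> centralizes_y y \<Longrightarrow> centralizes_y (x * y)" "centralizes_y x \<Longrightarrow> centralizes_y (inverse x)"
  by (auto simp: centralizes_y_def intro: commutes_mult' commutes_inv')

text \<open>
  The first generator normalises $\<langle>y_0,y_1\<rangle>$, hence its centraliser, and $s_2 =
  y_0s_1$ acts on the centraliser as $s_1$ does.
\<close>

lemma centralizes_y_conj:
  shows "centralizes_y (conj_by (s 1) x) \<longleftrightarrow> centralizes_y x" "centralizes_y (conj_by (s 2) x) \<longleftrightarrow> centralizes_y x"
    "centralizes_y (conj_by (inverse (s 1)) x) \<longleftrightarrow> centralizes_y x" "centralizes_y (conj_by (inverse (s 2)) x) \<longleftrightarrow> centralizes_y x"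
proof -
  have 1: "centralizes_y (conj_by (s 1) x)" if "centralizes_y x" for x
  proof -
    have "commutes (conj_by (s 1) x) (conj_by (s 1) y0)" "commutes (conj_by (s 1) x) (conj_by (s 1) y1)"
      using that unfolding centralizes_y_def commutes_conj by blast+
    then have *: "commutes (conj_by (s 1) x) y1" "commutes (conj_by (s 1) x) (inverse y0 * y1)"
      unfolding conj_y .
    from commutes_mult[OF *(1) commutes_inv[OF *(2)]] have "commutes (conj_by (s 1) x) y0"
      by (simp add: grp_simps)
    with * show ?thesis by (simp add: centralizes_y_def)
  qed
  have 2: "centralizes_y (conj_by (inverse (s 1)) x)" if "centralizes_y x" for x
  proof -
    note i = conj_by_inv_eq[OF conj_y(1)] conj_by_inv_eq[OF conj_y(2)]
    have "commutes x y1" "commutes x (inverse y0 * y1)"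
      using that commutes_mult[OF commutes_inv] by (auto simp: centralizes_y_def)
    then have "commutes (conj_by (inverse (s 1)) x) (conj_by (inverse (s 1)) y1)"
      "commutes (conj_by (inverse (s 1)) x) (conj_by (inverse (s 1)) (inverse y0 * y1))"
      unfolding commutes_conj .
    then show ?thesis unfolding i centralizes_y_def by simp
  qed
  show z1: "centralizes_y (conj_by (s 1) x) \<longleftrightarrow> centralizes_y x" "centralizes_y (conj_by (inverse (s 1)) x) \<longleftrightarrow> centralizes_y x" for x
    by (metis 1 2 conj_by_cancel)+
  have 3: "conj_by (s 2) x = conj_by (s 1) x" if "centralizes_y x" for x
  proof -
    have "conj_by (s 2) x = conj_by y0 (conj_by (s 1) x)"
      by (simp add: conj_by_conj_by y0_def mult.assoc left_inv)
    also have "\<dots> = conj_by (s 1) x"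
      using 1[OF that] unfolding conj_by_commutes centralizes_y_def by (blast intro: commutes_sym)
    finally show ?thesis .
  qed
  have 4: "centralizes_y (conj_by (inverse (s 2)) x)" if "centralizes_y x" for x
  proof -
    have "conj_by (s 2) (conj_by (inverse (s 1)) x) = x"
      using 3[OF 2[OF that]] by (simp add: conj_by_cancel)
    then have "conj_by (inverse (s 2)) x = conj_by (inverse (s 1)) x" by (rule conj_by_inv_eq)
    then show ?thesis using 2[OF that] by simp
  qed
  show "centralizes_y (conj_by (s 2) x) \<longleftrightarrow> centralizes_y x" "centralizes_y (conj_by (inverse (s 2)) x) \<longleftrightarrow> centralizes_y x" for x
    by (metis 1 3 4 conj_by_cancel)+
qed

end

section \<open>Finite simple images of the elements of exponent sum zero\<close>

text \<open>
  The situation in which $B_n'/K$ has to be shown large: $D$ is the image of $B_n'$ under the action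
  on cosets, $f$ the induced map onto the simple group, and \<open>detect\<close> says that $f$
  detects triviality on the centraliser of any generator. There equations in $H$ can be lifted to
  $D$.
\<close>

locale simple_quotient = braided s n + H: simple_group H
  for s :: "nat \<Rightarrow> 'g::grp" and n :: nat and H :: "('h, 'm) monoid_scheme" (structure) +
  fixes f :: "'g \<Rightarrow> 'h" and D :: "'g set"
  defines "D \<equiv> {x. word s {1..<n} x 0}"
  assumes finite_H: "finite (carrier H)"
    and f_mult: "x \<in> D \<Longrightarrow> y \<in> D \<Longrightarrow> f (x * y) = f x \<otimes> f y"
    and f_onto: "f ` D = carrier H"
    and detect: "x \<in> D \<Longrightarrow> 1 \<le> i \<Longrightarrow> i < n \<Longrightarrow> commutes x (s i) \<Longrightarrow> f x = \<one> \<Longrightarrow> x = 1"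
    and not_central2: "\<not> central_power 2"
begin

lemma f_closed: "x \<in> D \<Longrightarrow> f x \<in> carrier H"
  using f_onto by blast

lemma D_one: "1 \<in> D"
  by (simp add: D_def word.one)

lemma D_mult: "x \<in> D \<Longrightarrow> y \<in> D \<Longrightarrow> x * y \<in> D"
  unfolding D_def using word_mult[of s "{1..<n}" y 0 x 0] by simp

lemma D_inv: "x \<in> D \<Longrightarrow> inverse x \<in> D"
  unfolding D_def using word_inv[of s "{1..<n}" x 0] by simp

lemma D_I: "word s I x 0 \<Longrightarrow> I \<subseteq> {1..<n} \<Longrightarrow> x \<in> D"
  unfolding D_def using word_mono by blast

lemma f_one: "f 1 = \<one>"
proof -
  have "f 1 \<otimes> f 1 = f 1" using f_mult[OF D_one D_one] by simp
  then show ?thesis using H.l_cancel_one[OF f_closed[OF D_one] f_closed[OF D_one]] by simp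
qed

lemma f_inv: "x \<in> D \<Longrightarrow> f (inverse x) = inv f x"
  using f_mult[OF D_inv, of x x] by (simp add: left_inv f_one D_inv f_closed H.inv_equality)

lemma f_conj: "x \<in> D \<Longrightarrow> g \<in> D \<Longrightarrow> f (conj_by g x) = f g \<otimes> f x \<otimes> inv f g"
  by (simp add: conj_by_def f_mult f_inv D_mult D_inv)

lemma f_eqD:
  assumes "x \<in> D" "y \<in> D" "f x = f y" "1 \<le> i" "i < n" "commutes x (s i)" "commutes y (s i)"
  shows "x = y"
proof -
  have "f (x * inverse y) = \<one>"
    using assms(1-3) by (simp add: f_mult f_inv D_inv f_closed)
  then have "x * inverse y = 1"
    using assms by (intro detect[of _ i] D_mult D_inv commutes_mult' commutes_inv')
  then show ?thesis by (metis mult_right_eq right_inv)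
qed

lemma f_commutes:
  assumes "x \<in> D" "y \<in> D" "1 \<le> i" "i < n" "commutes x (s i)" "commutes y (s i)" "f x \<otimes> f y = f y \<otimes> f x"
  shows "commutes x y"
proof -
  have "x * y = y * x"
    using assms by (intro f_eqD[of _ _ i] D_mult commutes_mult') (simp_all add: f_mult)
  then show ?thesis by (simp add: commutes_def)
qed

lemma y_in_D: "y0 \<in> D" "y1 \<in> D" "word s {1, 2} y0 0" "word s {1, 2} y1 0"
proof -
  show w: "word s {1, 2} y0 0"
    unfolding y0_def using word_mult[OF word_gen(2) word_gen(1), of 1 "{1,2}" 2 s] by simp
  show w1: "word s {1, 2} y1 0"
    unfolding y1_def using word_conj[OF w word_gen(1)] by simp
  show "y0 \<in> D" "y1 \<in> D" using w w1 n5 by (auto intro!: D_I)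
qed

lemma block12_commutes: "word s {1, 2} q k \<Longrightarrow> 4 \<le> j \<Longrightarrow> j < n \<Longrightarrow> commutes q (s j)"
  by (rule commutes_sym, erule word_commutes) (auto intro: far')

text \<open>
  The elements $y_0, y_1$ do not commute, and $f$ detects this since both commute with $s_4$.
\<close>

lemma H_noncommutative: "\<not> (\<forall>x\<in>carrier H. \<forall>y\<in>carrier H. x \<otimes> y = y \<otimes> x)"
proof
  assume "\<forall>x\<in>carrier H. \<forall>y\<in>carrier H. x \<otimes> y = y \<otimes> x"
  then have "f y0 \<otimes> f y1 = f y1 \<otimes> f y0" using f_closed[OF y_in_D(1)] f_closed[OF y_in_D(2)] by simp
  moreover have "commutes y0 (s 4)" "commutes y1 (s 4)"
    using n5 block12_commutes[OF y_in_D(3)] block12_commutes[OF y_in_D(4)] by simp_all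
  ultimately have "commutes y0 y1"
    using y_in_D(1,2) n5 f_commutes[of y0 y1 4] by simp
  then show False using y_noncommuting[OF not_central2] by simp
qed

lemma central_trivial:
  assumes "x \<in> carrier H" "\<And>y. y \<in> carrier H \<Longrightarrow> x \<otimes> y = y \<otimes> x"
  shows "x = \<one>"
proof (rule ccontr)
  assume "x \<noteq> \<one>"
  have "y \<otimes> z = z \<otimes> y" if "y \<in> carrier H" "z \<in> carrier H" for y z
    by (rule H.centralizer_of_invariant_set[OF subset_refl _ assms(1) \<open>x \<noteq> \<one>\<close> assms(2) that]) simp_all
  then show False using H_noncommutative by simp
qed

lemma not_central1: "\<not> central_power 1"
  using central_power_mult[of 1 2] not_central2 by auto

lemma order_bound_by_subgroup:
  assumes "subgroup M H" "M \<noteq> carrier H" "order H \<le> b"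
  obtains k where "0 < k" "k * card M \<le> b" "k * card M \<le> fact k"
proof -
  have k: "card M * card (rcosets M) = order H"
    using H.lagrange[OF assms(1)] by (simp only: mult.commute)
  have "0 < card (rcosets M)"
    using k H.order_gt_one by (cases "card (rcosets M) = 0") simp_all
  from that[OF this] H.order_le_fact_index[OF finite_H assms(1,2) k] assms(3)
  show thesis unfolding k[symmetric] by (simp only: mult.commute)
qed

end

section \<open>Conjugates of a generator: arcs and chords\<close>

context grp begin

text \<open>
  With three punctures, the four conjugates $a$, $b$, $bab^{-1}$, $b^{-1}ab$ are half twists along
  different arcs. The assumption on $b^2$ is what separates the last two.
\<close>

lemma arcs_distinct:
  assumes "a * b * a = b * a * b" "\<not> commutes (b ^ 2) a"
  shows "inj_on (\<lambda>j. conj_by (([1, a * b, b, inverse b] ! j)) a) {..<4}"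
proof -
  have nc: "\<not> commutes b a"
    using assms(2) commutes_pow' by blast
  have ab: "conj_by (a * b) a = b" using assms(1) by (rule braid_shift)
  have b: "conj_by b b = b" "conj_by (inverse b) b = b"
    by (simp_all add: conj_by_commutes commutes_inv')
  have ne: "a \<noteq> b" using nc by auto
  have 1: "conj_by b a \<noteq> b" "conj_by (inverse b) a \<noteq> b"
    using ne b by (metis conj_by_inject)+
  have 2: "conj_by b a \<noteq> a" "conj_by (inverse b) a \<noteq> a"
    using nc commutes_inv'[of "inverse b" a] by (simp_all add: conj_by_commutes inv_inv) blast
  have 3: "conj_by b a \<noteq> conj_by (inverse b) a"
  proof
    assume "conj_by b a = conj_by (inverse b) a"
    then have "conj_by b (conj_by b a) = a" by (simp add: conj_by_cancel)
    then have "commutes (b ^ 2) a" by (simp add: conj_by_conj_by conj_by_commutes power2_eq_square)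
    then show False using assms(2) by simp
  qed
  have "{..<4::nat} = {0, 1, 2, 3}" by auto
  then show ?thesis
    using ab ne 1 2 3 by (simp add: numeral_eq_Suc)
qed

end

text \<open>
  Right multiplication by a power of $s_i$ adjusts the exponent sum and does not change the
  conjugate of $s_i$.
\<close>

lemma word_normalize:
  assumes "word s I h k" "i \<in> I"
  obtains h' where "word s I h' 0" "conj_by h' (s i) = conj_by h (s i)"
proof -
  define g where "g = (if k \<ge> 0 then inverse (s i) ^ nat k else s i ^ nat (- k))"
  have "word s I g (- k)"
    unfolding g_def using word_pow[OF word_gen(2)[OF assms(2)], of s "nat k"] word_pow[OF word_gen(1)[OF assms(2)], of s "nat (- k)"]
    by auto
  then have "word s I (h * g) 0" using word_mult[OF _ assms(1)] by fastforce
  moreover have "commutes g (s i)"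
    unfolding g_def by (simp add: commutes_pow' commutes_inv')
  then have "conj_by g (s i) = s i"
    by (simp only: conj_by_commutes)
  then have "conj_by (h * g) (s i) = conj_by h (s i)"
    by (simp only: flip: conj_by_conj_by)
  ultimately show thesis by (rule that)
qed

context braided begin

text \<open>
  The half twist that exchanges the points $i$ and $i + m + 1$ along a fixed side of the points in
  between.
\<close>

fun chord :: "nat \<Rightarrow> nat \<Rightarrow> 'g" where
  "chord i 0 = s i"
| "chord i (Suc m) = conj_by (s (i + Suc m)) (chord i m)"

text \<open>
  A chord is conjugate to the generator at either of its ends by a word commuting with the generator
  just outside this end. This settles whether the chord commutes with the latter.
\<close>

lemma chord_word:
  assumes "1 \<le> i" "i + m < n"
  shows "\<exists>L k. word s {i..<i + m} L k \<and> chord i m = conj_by L (s (i + m))"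
    and "\<exists>R k. word s {Suc i..i + m} R k \<and> chord i m = conj_by R (s i)"
proof -
  show "\<exists>L k. word s {i..<i + m} L k \<and> chord i m = conj_by L (s (i + m))"
    using assms(2)
  proof (induction m)
    case 0 show ?case by (intro exI[of _ 1] exI[of _ 0]) (simp add: word.one)
  next
    case (Suc m)
    then obtain L k where L: "word s {i..<i + m} L k" "chord i m = conj_by L (s (i + m))"
      by auto
    let ?t = "s (i + Suc m)"
    have "commutes ?t L"
      using L(1) by (rule word_commutes) (use Suc.prems assms(1) in \<open>auto intro!: far'\<close>)
    then have "conj_by ?t (chord i m) = conj_by L (conj_by ?t (s (i + m)))"
      unfolding L(2) conj_by_conj_by commutes_def by simp
    also have "conj_by ?t (s (i + m)) = conj_by (inverse (s (i + m))) ?t"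
      using braid_conj(1)[OF braid[of "i + m"]] assms(1) Suc.prems by simp
    finally have "chord i (Suc m) = conj_by (L * inverse (s (i + m))) ?t"
      by (simp add: conj_by_conj_by)
    moreover have "word s {i..<i + Suc m} (L * inverse (s (i + m))) (k - 1)"
      using word_mono[OF L(1), of "{i..<i + Suc m}"] by (intro word.inv) auto
    ultimately show ?case by blast
  qed
  show "\<exists>R k. word s {Suc i..i + m} R k \<and> chord i m = conj_by R (s i)"
  proof (induction m)
    case 0 show ?case by (intro exI[of _ 1] exI[of _ 0]) (simp add: word.one)
  next
    case (Suc m)
    then obtain R k where R: "word s {Suc i..i + m} R k" "chord i m = conj_by R (s i)" by auto
    have "word s {Suc i..i + Suc m} (s (i + Suc m) * R) (1 + k)"
      using word_mult[OF word_mono[OF R(1)] word_gen(1)] by auto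
    then show ?case using R(2) by (auto simp: conj_by_conj_by)
  qed
qed

lemma chord_commutes_far:
  assumes "1 \<le> i" "i + m < n" "1 \<le> k" "k < n" "k + 1 < i \<or> i + m + 1 < k"
  shows "commutes (chord i m) (s k)"
  using assms(2,5)
proof (induction m)
  case 0 then show ?case using far[of k i] far'[of k i] far[of i k] far'[of i k] assms by auto
next
  case (Suc m)
  have "commutes (s (i + Suc m)) (s k)"
    using far[of k "i + Suc m"] far[of "i + Suc m" k] Suc.prems assms by (auto intro: commutes_sym)
  moreover have "commutes (chord i m) (s k)"
    using Suc.prems by (intro Suc.IH) auto
  ultimately show ?case by (simp add: commutes_conj_iff)
qed

lemma chord_noncommutes_ends:
  assumes "\<not> central_power 1" "1 \<le> i" "i + m < n"
  shows "i + m + 1 < n \<Longrightarrow> \<not> commutes (chord i m) (s (i + m + 1))"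
    and "2 \<le> i \<Longrightarrow> \<not> commutes (chord i m) (s (i - 1))"
proof -
  assume n: "i + m + 1 < n"
  obtain L k where L: "word s {i..<i + m} L k" "chord i m = conj_by L (s (i + m))"
    using chord_word(1)[OF assms(2,3)] by blast
  have "commutes (s (i + m + 1)) L"
    using L(1) by (rule word_commutes) (use n assms(2) in \<open>auto intro!: far'\<close>)
  then show "\<not> commutes (chord i m) (s (i + m + 1))"
    using not_commutes_adjacent(1)[OF assms(1), of "i + m"] assms(2) n
    unfolding L(2) by (simp add: commutes_conj_iff commutes_sym One_nat_def)
next
  assume i: "2 \<le> i"
  obtain R k where R: "word s {Suc i..i + m} R k" "chord i m = conj_by R (s i)"
    using chord_word(2)[OF assms(2,3)] by blast
  have "commutes (s (i - 1)) R"
    using R(1) by (rule word_commutes) (use i assms(3) in \<open>auto intro!: far\<close>)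
  then show "\<not> commutes (chord i m) (s (i - 1))"
    using not_commutes_adjacent(2)[OF assms(1), of "i - 1"] i assms(3)
    unfolding R(2) by (simp add: commutes_conj_iff commutes_sym)
qed

lemma chord_noncommutes_last:
  assumes "\<not> central_power 1" "1 \<le> i" "i + Suc m < n"
  shows "\<not> commutes (chord i (Suc m)) (s (i + Suc m))"
  using chord_noncommutes_ends(1)[OF assms(1,2), of m] assms(3)
  by (simp add: commutes_conj_iff One_nat_def)

text \<open>
  A half twist in the middle takes place on one side of the chord. Algebraically, conjugation by
  $s_{k+1}s_k$ turns the case $k = i + m - 1$ into commutation with a generator beyond the end of a
  shorter chord.
\<close>

lemma chord_commutes_inner:
  assumes "1 \<le> i" "i + m < n" "i < k" "k < i + m"
  shows "commutes (chord i m) (s k)"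
  using assms(2,4)
proof (induction m)
  case (Suc m)
  show ?case
  proof (cases "k < i + m")
    case True
    have "commutes (s (i + Suc m)) (s k)"
      using far'[of k "i + Suc m"] True Suc.prems assms by auto
    then show ?thesis using Suc True by (simp add: commutes_conj_iff)
  next
    case False
    then have k: "k = i + m" using Suc.prems by simp
    with assms(3) obtain l where m: "m = Suc l" by (cases m) auto
    have kk: "conj_by (s (Suc k) * s k) (s (Suc k)) = s k"
      using braid_shift[OF braid[symmetric], of k] assms(1,3) Suc.prems k by simp
    have "commutes (chord i l) (s (Suc k))"
      using chord_commutes_far[of i l "Suc k"] assms(1) Suc.prems k m by simp
    then have "commutes (conj_by (s (Suc k) * s k) (chord i l)) (conj_by (s (Suc k) * s k) (s (Suc k)))"
      by (simp only: commutes_conj)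
    then show ?thesis unfolding kk by (simp add: m k conj_by_conj_by)
  qed
qed (use assms in simp)

text \<open>
  The ends of a chord are visible in the generators with which it commutes: it commutes with those
  strictly outside and strictly inside, and not with those that share exactly one end with it.
\<close>

lemma chord_inj:
  assumes "\<not> central_power 1" "2 \<le> i" "i + m < n" "2 \<le> j" "j + l < n" "chord i m = chord j l"
  shows "i = j \<and> m = l"
proof -
  have "\<not> i < j" if "2 \<le> i" "i + m < n" "2 \<le> j" "j + l < n" "chord i m = chord j l" for i j m l
  proof
    assume "i < j"
    then have "commutes (chord j l) (s (i - 1))"
      using that by (intro chord_commutes_far) auto
    then show False using chord_noncommutes_ends(2)[of i m] that assms(1) by simp
  qed
  from this[of i m j l] this[of j l i m] assms have ij: "i = j" by simp
  have "\<not> m < l" if "i + l < n" "chord i m = chord i l" for m l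
  proof
    assume "m < l"
    show False
    proof (cases m)
      case 0
      have "commutes (chord i m) (s i)" using 0 by simp
      moreover have "chord i l = conj_by (inverse (s i)) (chord (Suc i) (l - 1))"
        using \<open>i + l < n\<close> \<open>m < l\<close>
      proof (induction l)
        case (Suc l)
        show ?case
        proof (cases "l = 0")
          case True
          then show ?thesis using braid_conj(1)[OF braid[of i]] Suc.prems assms(2) by simp
        next
          case False
          then have IH: "chord i l = conj_by (inverse (s i)) (chord (Suc i) (l - 1))"
            using Suc 0 by simp
          have "commutes (inverse (s i)) (s (i + Suc l))"
            using far[of i "i + Suc l"] Suc.prems assms(2) False by (intro commutes_inv') auto
          then have "s (i + Suc l) * inverse (s i) = inverse (s i) * s (i + Suc l)"
            by (simp add: commutes_def)
          moreover have "chord (Suc i) (Suc l - 1) = conj_by (s (i + Suc l)) (chord (Suc i) (l - 1))"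
            using False by (cases l) simp_all
          ultimately show ?thesis by (simp add: IH conj_by_conj_by)
        qed
      qed simp
      moreover have "\<not> commutes (chord (Suc i) (l - 1)) (s i)"
        using chord_noncommutes_ends(2)[OF assms(1), of "Suc i" "l - 1"] that \<open>m < l\<close> assms(2) by simp
      ultimately show False using that by (simp add: commutes_conj_iff commutes_inv')
    next
      case (Suc k)
      have "\<not> commutes (chord i m) (s (i + m))"
        using chord_noncommutes_last[OF assms(1), of i k] that \<open>m < l\<close> assms(2) Suc by simp
      moreover have "commutes (chord i l) (s (i + m))"
        using chord_commutes_inner[of i l "i + m"] that \<open>m < l\<close> assms(2) Suc by simp
      ultimately show False using that by simp
    qed
  qed
  from this[of l m] this[of m l] assms ij show ?thesis by (metis linorder_neqE_nat)
qed

end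

section \<open>Braids in two commuting blocks of strands\<close>

context simple_quotient begin

text \<open>
  In the following, $x$ and $y$ count as equal if $xy^{-1}$ centralises $y_0$ and $y_1$; by this
  lemma the relation is invariant under conjugation by words in $s_1$ and $s_2$.
\<close>

lemma centralizes_y_conj_word: "word s {1, 2} g k \<Longrightarrow> centralizes_y (conj_by g x) \<longleftrightarrow> centralizes_y x"
proof (induction arbitrary: x rule: word.induct)
  case (gen g k i)
  have "centralizes_y (conj_by (s i) x) \<longleftrightarrow> centralizes_y x"
    using gen.hyps(2) by (elim insertE emptyE) (simp_all add: centralizes_y_conj)
  then show ?case using gen.IH by (simp flip: conj_by_conj_by)
next
  case (inv g k i)
  have "centralizes_y (conj_by (inverse (s i)) x) \<longleftrightarrow> centralizes_y x"
    using inv.hyps(2) by (elim insertE emptyE) (simp_all add: centralizes_y_conj)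
  then show ?case using inv.IH by (simp flip: conj_by_conj_by)
qed simp

text \<open>
  Conjugators taking $s_1$ to the half twists $s_1$, $s_2$, $s_2s_1s_2^{-1}$, $s_2^{-1}s_1s_2$ along
  four arcs.
\<close>

abbreviation arcs12 :: "'g list" where
  "arcs12 \<equiv> [1, s 1 * s 2, s 2, inverse (s 2)]"

text \<open>
  The commutator turns $y_0$ into $y_0^{-1}y_1$, so $y_0$ would commute with $y_1$.
\<close>

lemma not_centralizes_y_commutator: "\<not> centralizes_y (s 1 ^ 2 * s 2 * inverse (s 1 ^ 2) * inverse (s 2))"
proof
  let ?x = "s 1 ^ 2 * s 2 * inverse (s 1 ^ 2) * inverse (s 2)"
  assume centralizes_y: "centralizes_y ?x"
  have "?x * y0 = conj_by (s 1) (conj_by (s 1) y0)"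
    by (simp add: y0_def conj_by_def power2_eq_square grp_simps)
  then have "?x * y0 = inverse y0 * y1" by (simp only: conj_y)
  then have "y1 = y0 * (?x * y0)" by (simp add: right_cancel)
  moreover have "commutes y0 (y0 * (?x * y0))"
    using centralizes_y commutes_mult[OF commutes_refl commutes_mult[OF commutes_sym commutes_refl], of ?x y0]
    unfolding centralizes_y_def by simp
  ultimately show False using y_noncommuting[OF not_central2] by simp
qed

text \<open>
  Conjugation inside $\<langle>s_1,s_2\<rangle>$ reduces five of the six pairs to $s_1$ and $s_2$,
  whose quotient is $y_0$, and the last pair to the commutator of the previous lemma.
\<close>

lemma arcs12_separated:
  assumes "i < 4" "j < 4" "centralizes_y (conj_by (arcs12 ! i) (s 1) * inverse (conj_by (arcs12 ! j) (s 1)))"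
  shows "i = j"
proof -
  let ?a = "s 1" and ?b = "s 2"
  let ?R = "\<lambda>x y. centralizes_y (x * inverse y)"
  have sym: "?R x y \<longleftrightarrow> ?R y x" for x y
    using centralizes_y_closed(3)[of "x * inverse y"] centralizes_y_closed(3)[of "y * inverse x"] unfolding inv_mult inv_inv by (rule iffI)
  have conj: "?R (conj_by g x) (conj_by g y) \<longleftrightarrow> ?R x y" if "word s {1, 2} g k" for g x y k
    using centralizes_y_conj_word[OF that, of "x * inverse y"] by (simp only: conj_by_mult conj_by_inv)
  have wa: "word s {1, 2} ?a 1" "word s {1, 2} (inverse ?a) (-1)" and wb: "word s {1, 2} ?b 1" "word s {1, 2} (inverse ?b) (-1)"
    by (auto intro: word_gen)
  have ab: "\<not> ?R ?a ?b"
  proof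
    assume "?R ?a ?b"
    then have "centralizes_y y0" unfolding y0_def using sym[of ?a ?b] by (rule iffD1[rotated])
    then have "commutes y0 y1" by (simp add: centralizes_y_def)
    then show False using y_noncommuting[OF not_central2] by simp
  qed
  have cfix: "conj_by g g = g" "conj_by (inverse g) g = g" for g
    by (simp_all add: conj_by_commutes commutes_inv')
  note br = braid_conj[OF braid12]
  have 2: "\<not> ?R ?a (conj_by ?b ?a)"
    using conj[OF wa(2), of ?a ?b] ab unfolding br cfix by blast
  have 3: "\<not> ?R ?a (conj_by (inverse ?b) ?a)"
    using conj[OF wa(1), of ?a ?b] ab unfolding br cfix by blast
  have 4: "\<not> ?R ?b (conj_by ?b ?a)"
    using conj[OF wb(1), of ?b ?a] ab unfolding cfix sym[of ?b ?a] by blast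
  have 5: "\<not> ?R ?b (conj_by (inverse ?b) ?a)"
    using conj[OF wb(2), of ?b ?a] ab unfolding cfix sym[of ?b ?a] by blast
  have 6: "\<not> ?R (conj_by ?b ?a) (conj_by (inverse ?b) ?a)"
  proof
    assume "?R (conj_by ?b ?a) (conj_by (inverse ?b) ?a)"
    then have "?R (conj_by ?a (conj_by (inverse ?a) ?b)) (conj_by ?a (conj_by ?a ?b))"
      unfolding conj[OF wa(1)] br .
    then have "?R (conj_by ?a (conj_by ?a ?b)) ?b"
      unfolding conj_by_cancel by (rule iffD1[OF sym])
    then show False using not_centralizes_y_commutator
      by (simp add: conj_by_def power2_eq_square grp_simps)
  qed
  have shift: "conj_by (?a * ?b) ?a = ?b" using braid12 by (rule braid_shift)
  define c where "c k = conj_by (arcs12 ! k) (s 1)" for k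
  have c: "c 0 = ?a" "c 1 = ?b" "c 2 = conj_by ?b ?a" "c 3 = conj_by (inverse ?b) ?a"
    using shift by (simp_all add: c_def One_nat_def)
  have *: "\<not> ?R (c 0) (c 1)" "\<not> ?R (c 0) (c 2)" "\<not> ?R (c 0) (c 3)" "\<not> ?R (c 1) (c 2)" "\<not> ?R (c 1) (c 3)" "\<not> ?R (c 2) (c 3)"
    unfolding c by fact+
  have "\<not> ?R (c 1) (c 0)" "\<not> ?R (c 2) (c 0)" "\<not> ?R (c 3) (c 0)" "\<not> ?R (c 2) (c 1)" "\<not> ?R (c 3) (c 1)" "\<not> ?R (c 3) (c 2)"
    by (rule notI, drule iffD1[OF sym], use * in blast)+
  moreover have "i = 0 \<or> i = 1 \<or> i = 2 \<or> i = 3" "j = 0 \<or> j = 1 \<or> j = 2 \<or> j = 3"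
    using assms(1,2) by auto
  moreover have "?R (c i) (c j)" using assms(3) unfolding c_def .
  ultimately show ?thesis using * by blast
qed

text \<open>
  Elements whose effect on the exponent sum zero part of $\<langle>s_1,s_2\<rangle>$ is that of a
  power of $s_1$. They are the elements whose products with the four arc conjugators can be told
  apart.
\<close>

definition acts_like_s1 :: "'g set" where
  "acts_like_s1 = {t \<in> D. commutes t (s 1) \<and>
     (\<exists>u k. word s {1} u k \<and> (\<forall>q. word s {1, 2} q 0 \<longrightarrow> conj_by t q = conj_by u q))}"

lemma acts_like_s1_mult:
  assumes "x \<in> acts_like_s1" "y \<in> acts_like_s1" shows "x * y \<in> acts_like_s1"
proof -
  obtain u k v l where u: "word s {1} u k" "\<And>q. word s {1, 2} q 0 \<Longrightarrow> conj_by x q = conj_by u q"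
    and v: "word s {1} v l" "\<And>q. word s {1, 2} q 0 \<Longrightarrow> conj_by y q = conj_by v q"
    using assms unfolding acts_like_s1_def by blast
  have "conj_by (x * y) q = conj_by (u * v) q" if "word s {1, 2} q 0" for q
  proof -
    have "word s {1, 2} (conj_by v q) 0"
      using word_conj[OF that word_mono[OF v(1)]] by auto
    then show ?thesis using u(2) v(2)[OF that] by (simp flip: conj_by_conj_by)
  qed
  moreover have "word s {1} (u * v) (k + l)" using word_mult[OF v(1) u(1)] .
  ultimately show ?thesis
    using assms D_mult[of x y] unfolding acts_like_s1_def by (auto intro: commutes_mult')
qed

lemma acts_like_s1_one: "1 \<in> acts_like_s1"
  unfolding acts_like_s1_def using D_one word.one[of s "{1}"] by auto

lemma acts_like_s1_far_block:
  assumes "word s {4..<n} p 0" shows "p \<in> acts_like_s1"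
proof -
  have c: "commutes (s j) p" if "j \<in> {1, 2}" for j
    using assms by (rule word_commutes) (use that in \<open>auto intro!: far\<close>)
  have "conj_by p q = q" if "word s {1, 2} q 0" for q
  proof -
    have "commutes p q" using that by (rule word_commutes) (blast intro: commutes_sym c)
    then show ?thesis by (simp only: conj_by_commutes)
  qed
  moreover have "p \<in> D" using assms by (rule D_I) auto
  moreover have "commutes p (s 1)" using c[of 1] by (simp add: commutes_commute)
  ultimately show ?thesis unfolding acts_like_s1_def using word.one[of s "{1}"] by auto
qed

text \<open>
  Products of a braid on strands $1,2,3$ and a braid on strands $4,\<dots>,n$ with total exponent
  sum zero.
\<close>

definition blocks :: "'g set" where
  "blocks = {x. \<exists>b p j. word s {1, 2} b j \<and> word s {4..<n} p (- j) \<and> x = b * p}"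

lemma blocks_commute: "word s {1, 2} b j \<Longrightarrow> word s {4..<n} p k \<Longrightarrow> commutes b p"
  by (rule word_commutes) (auto intro: block12_commutes)

lemma blocks_mult: assumes "x \<in> blocks" "y \<in> blocks" shows "x * y \<in> blocks"
proof -
  obtain b p j b' p' j' where x: "word s {1, 2} b j" "word s {4..<n} p (- j)" "x = b * p"
    and y: "word s {1, 2} b' j'" "word s {4..<n} p' (- j')" "y = b' * p'"
    using assms unfolding blocks_def by blast
  have "p * b' = b' * p" using blocks_commute[OF y(1) x(2)] by (simp add: commutes_def)
  then have "x * y = (b * b') * (p * p')" unfolding x y by (metis mult.assoc)
  moreover have "word s {1, 2} (b * b') (j + j')" "word s {4..<n} (p * p') (- (j + j'))"
    using word_mult[OF y(1) x(1)] word_mult[OF y(2) x(2)] by simp_all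
  ultimately show ?thesis unfolding blocks_def by blast
qed

lemma blocks_inv: assumes "x \<in> blocks" shows "inverse x \<in> blocks"
proof -
  obtain b p j where x: "word s {1, 2} b j" "word s {4..<n} p (- j)" "x = b * p"
    using assms unfolding blocks_def by blast
  have "inverse x = inverse b * inverse p"
    using blocks_commute[OF x(1,2)] unfolding x(3) commutes_def by (metis inv_mult)
  then show ?thesis using word_inv[OF x(1)] word_inv[OF x(2)] unfolding blocks_def by blast
qed

lemma blocks_D: "blocks \<subseteq> D"
proof
  fix x assume "x \<in> blocks"
  then obtain b p j where x: "word s {1, 2} b j" "word s {4..<n} p (- j)" "x = b * p"
    unfolding blocks_def by blast
  have "word s {1..<n} b j" "word s {1..<n} p (- j)"
    using word_mono[OF x(1), of "{1..<n}"] word_mono[OF x(2), of "{1..<n}"] n5 by auto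
  then show "x \<in> D" unfolding D_def x(3) using word_mult[of s "{1..<n}" p "-j" b j] by simp
qed

lemma blocks_I: "word s {1, 2} b 0 \<Longrightarrow> b \<in> blocks" "word s {4..<n} p 0 \<Longrightarrow> p \<in> blocks"
  unfolding blocks_def using word.one[of s "{1,2}"] word.one[of s "{4..<n}"] by force+

lemma blocks_power: "x \<in> blocks \<Longrightarrow> x ^ k \<in> blocks"
  using blocks_I(1)[OF word.one] by (induction k) (auto simp: blocks_mult)

lemma blocks_subgroup: "subgroup (f ` blocks) H"
proof (rule H.subgroupI)
  show "f ` blocks \<subseteq> carrier H" using blocks_D f_closed by blast
  show "f ` blocks \<noteq> {}" using blocks_I(1)[OF word.one] by blast
  fix x assume "x \<in> f ` blocks"
  then obtain u where u: "u \<in> blocks" "x = f u" by blast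
  have "f (inverse u) = inv x" using f_inv[of u] u blocks_D by auto
  then show "inv x \<in> f ` blocks" using blocks_inv[OF u(1)] by (metis imageI)
  fix y assume "y \<in> f ` blocks"
  then obtain v where v: "v \<in> blocks" "y = f v" by blast
  have "x \<otimes> y = f (u * v)" using f_mult[OF subsetD[OF blocks_D u(1)] subsetD[OF blocks_D v(1)]] u v by simp
  then show "x \<otimes> y \<in> f ` blocks" using blocks_mult[OF u(1) v(1)] by blast
qed

text \<open>
  Otherwise the image of the exponent sum zero part of $\<langle>s_1,s_2\<rangle>$ is conjugation
  invariant in $H$. It commutes with the nontrivial image of $s_4s_5^{-1}$, so by simplicity it is
  central, against the choice of $y_0$ and $y_1$.
\<close>

lemma blocks_proper:
  assumes "6 \<le> n" shows "f ` blocks \<noteq> carrier H"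
proof
  assume M: "f ` blocks = carrier H"
  let ?U = "f ` {q. word s {1, 2} q 0}"
  have qD: "q \<in> D" if "word s {1, 2} q 0" for q
    using blocks_I(1)[OF that] blocks_D by blast
  let ?r = "s 4 * inverse (s 5)"
  have r: "word s {4..<n} ?r 0"
    using word_mult[OF word_gen(2) word_gen(1), of 5 "{4..<n}" 4 s] assms by simp
  have rD: "?r \<in> D" using r by (rule D_I) auto
  have U1: "?U \<subseteq> carrier H" using qD f_closed by blast
  have U2: "g \<otimes> u \<otimes> inv g \<in> ?U" if gu: "g \<in> carrier H" "u \<in> ?U" for g u
  proof -
    obtain x q where x: "x \<in> blocks" "g = f x" and q: "word s {1, 2} q 0" "u = f q"
      using gu M by blast
    obtain b p j where b: "word s {1, 2} b j" "word s {4..<n} p (- j)" "x = b * p"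
      using x(1) unfolding blocks_def by blast
    have "conj_by x q = conj_by b q"
      using blocks_commute[OF q(1) b(2)] unfolding b(3) conj_by_conj_by[symmetric]
      by (simp only: conj_by_inject conj_by_commutes) (rule commutes_sym)
    then have "g \<otimes> u \<otimes> inv g = f (conj_by b q)"
      using f_conj[OF qD[OF q(1)], of x] x blocks_D q(2) by auto
    then show ?thesis using word_conj[OF q(1) b(1)] by blast
  qed
  have r1: "f ?r \<noteq> \<one>"
  proof
    assume "f ?r = \<one>"
    moreover have "commutes ?r (s 1)"
      using far'[of 1 4] far'[of 1 5] assms by (intro commutes_mult' commutes_inv') auto
    ultimately have "?r = 1" using detect[OF rD, of 1] n5 by simp
    then have "s 4 = s 5" by (metis left_inv mult_right_eq right_inv)
    then have "commutes (s 4) (s (Suc 4))" by simp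
    then show False using not_commutes_adjacent(1)[OF not_central1, of 4] assms by simp
  qed
  have rU: "f ?r \<otimes> u = u \<otimes> f ?r" if u: "u \<in> ?U" for u
  proof -
    obtain q where q: "word s {1, 2} q 0" "u = f q" using u by blast
    have "?r * q = q * ?r" using blocks_commute[OF q(1) r] by (simp add: commutes_def)
    then show ?thesis using f_mult[OF rD qD[OF q(1)]] f_mult[OF qD[OF q(1)] rD] q(2) by simp
  qed
  have "f y0 \<otimes> f y1 = f y1 \<otimes> f y0"
    using H.centralizer_of_invariant_set[OF U1 U2 f_closed[OF rD] r1 rU f_closed[OF y_in_D(1)]] y_in_D(4) by blast
  moreover have "commutes y0 (s 4)" "commutes y1 (s 4)"
    using n5 block12_commutes[OF y_in_D(3)] block12_commutes[OF y_in_D(4)] by simp_all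
  ultimately have "commutes y0 y1"
    using y_in_D(1,2) n5 f_commutes[of y0 y1 4] by simp
  then show False using y_noncommuting[OF not_central2] by simp
qed

text \<open>
  The products $g_it$ of the four arc conjugators with $t \<in> T$ have different images. If
  $f(g_it) = f(g_jr)$ then both sides act alike on the exponent sum zero part of
  $\<langle>s_1,s_2\<rangle>$, where $f$ is injective, and there $t$ and $r$ act as powers of $s_1$.
  So the $i$-th and $j$-th half twist differ only by an element that centralises $y_0$ and $y_1$,
  hence $i = j$. Then $f(t) = f(r)$, and $t = r$ as both commute with $s_1$.
\<close>

lemma card_block_product:
  assumes T: "finite T" "T \<subseteq> acts_like_s1" "T \<subseteq> blocks"
  shows "4 * card T \<le> card (f ` blocks)"
proof -
  have "\<exists>g. word s {1, 2} g 0 \<and> conj_by g (s 1) = conj_by (arcs12 ! i) (s 1)" if "i < 4" for i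
  proof -
    have *: "\<exists>k. word s {1, 2} x k" if "x \<in> set arcs12" for x
      using that word.one[of s "{1,2}"] word_gen[of 1 "{1,2}" s] word_gen[of 2 "{1,2}" s]
        word_mult[OF word_gen(1) word_gen(1), of 2 "{1,2}" 1 s] by auto
    have "arcs12 ! i \<in> set arcs12" using that by (intro nth_mem) simp
    from *[OF this] obtain k where "word s {1, 2} (arcs12 ! i) k" by blast
    then show ?thesis using word_normalize[of s "{1,2}" _ k 1] by (metis insertI1)
  qed
  then obtain g where g: "\<And>i. i < 4 \<Longrightarrow> word s {1, 2} (g i) 0"
    and ga: "\<And>i. i < 4 \<Longrightarrow> conj_by (g i) (s 1) = conj_by (arcs12 ! i) (s 1)"
    by metis
  have gD: "g i \<in> D" "g i \<in> blocks" if "i < 4" for i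
    using blocks_I(1)[OF g[OF that]] blocks_D by blast+
  have TD: "t \<in> D" "commutes t (s 1)" if "t \<in> T" for t
    using that T(2) unfolding acts_like_s1_def by auto
  have sep: "i = j \<and> t = r"
    if i': "i < 4" and i: "t \<in> T" and j': "j < 4" and j: "r \<in> T" and eq: "f (g i * t) = f (g j * r)"
    for i j t r
  proof -
    obtain u k where u: "word s {1} u k" "\<And>q. word s {1, 2} q 0 \<Longrightarrow> conj_by t q = conj_by u q"
      using i T(2) unfolding acts_like_s1_def by blast
    obtain v l where v: "word s {1} v l" "\<And>q. word s {1, 2} q 0 \<Longrightarrow> conj_by r q = conj_by v q"
      using j T(2) unfolding acts_like_s1_def by blast
    \<comment> \<open>Both sides are compared through their action on exponent sum zero words of the first block.\<close>
    have wu: "word s {1, 2} (g i * u) (0 + k)" and wv: "word s {1, 2} (g j * v) (0 + l)"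
      using word_mult[OF word_mono[OF u(1)] g[OF i']] word_mult[OF word_mono[OF v(1)] g[OF j']] by auto
    define z where "z = inverse (g j * v) * (g i * u)"
    have same: "conj_by (g i * u) q = conj_by (g j * v) q" if q: "word s {1, 2} q 0" for q
    proof -
      have qD: "q \<in> D" using blocks_I(1)[OF q] blocks_D by blast
      have "f (conj_by (g i * t) q) = f (conj_by (g j * r) q)"
        using f_conj[OF qD D_mult[OF gD(1)[OF i'] TD(1)[OF i]]] f_conj[OF qD D_mult[OF gD(1)[OF j'] TD(1)[OF j]]] eq
        by simp
      then have e: "f (conj_by (g i * u) q) = f (conj_by (g j * v) q)"
        using u(2)[OF q] v(2)[OF q] by (simp flip: conj_by_conj_by)
      have w: "word s {1, 2} (conj_by (g i * u) q) 0" "word s {1, 2} (conj_by (g j * v) q) 0"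
        using word_conj[OF q wu] word_conj[OF q wv] .
      have "conj_by (g i * u) q \<in> D" "conj_by (g j * v) q \<in> D"
        using blocks_I(1)[OF w(1)] blocks_I(1)[OF w(2)] blocks_D by blast+
      then show ?thesis
        using f_eqD[of "conj_by (g i * u) q" "conj_by (g j * v) q" 4] e n5 block12_commutes[OF w(1), of 4] block12_commutes[OF w(2), of 4]
        by simp
    qed
    have "conj_by z q = q" if "word s {1, 2} q 0" for q
    proof -
      have "conj_by z q = conj_by (inverse (g j * v)) (conj_by (g i * u) q)"
        by (simp only: z_def conj_by_conj_by)
      then show ?thesis unfolding same[OF that] conj_by_cancel .
    qed
    then have centralizes_y: "centralizes_y z" using y_in_D(3,4) unfolding centralizes_y_def conj_by_commutes by blast
    have gz: "g i * u = (g j * v) * z" by (simp add: z_def right_cancel)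
    have cu: "conj_by u (s 1) = s 1" and cv: "conj_by v (s 1) = s 1"
      using word_commutes[OF u(1), of "s 1"] word_commutes[OF v(1), of "s 1"]
      by (simp_all add: conj_by_commutes commutes_commute)
    have a: "conj_by (arcs12 ! i) (s 1) = conj_by (g j * v) (conj_by z (s 1))"
      using gz cu ga[OF i'] by (metis conj_by_conj_by)
    have b: "conj_by (arcs12 ! j) (s 1) = conj_by (g j * v) (s 1)"
      using cv ga[OF j'] by (metis conj_by_conj_by)
    \<comment> \<open>The commutator of $z$ and $s_1$ is the product of $z$ and a conjugate of its inverse.\<close>
    have "centralizes_y (conj_by z (s 1) * inverse (s 1))"
    proof -
      have "conj_by z (s 1) * inverse (s 1) = z * conj_by (s 1) (inverse z)"
        by (simp add: conj_by_def mult.assoc)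
      then show ?thesis using centralizes_y centralizes_y_closed centralizes_y_conj(1) by simp
    qed
    then have "centralizes_y (conj_by (arcs12 ! i) (s 1) * inverse (conj_by (arcs12 ! j) (s 1)))"
      unfolding a b using centralizes_y_conj_word[OF wv] by (simp flip: conj_by_mult conj_by_inv)
    then have ij: "i = j" by (rule arcs12_separated[OF i' j'])
    have "f (g i) \<otimes> f t = f (g i) \<otimes> f r"
      using eq f_mult[OF gD(1)[OF i'] TD(1)[OF i]] f_mult[OF gD(1)[OF i'] TD(1)[OF j]]
      unfolding ij by simp
    then have "f t = f r"
      by (rule H.l_cancel) (intro f_closed TD(1) gD(1) i' i j)+
    then have "t = r" using f_eqD[of t r 1] TD i j n5 by simp
    with ij show ?thesis by simp
  qed
  have inj: "inj_on (\<lambda>(i, t). f (g i * t)) ({..<4} \<times> T)"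
  proof (rule inj_onI)
    fix x y assume *: "x \<in> {..<4} \<times> T" "y \<in> {..<4} \<times> T" "(\<lambda>(i, t). f (g i * t)) x = (\<lambda>(i, t). f (g i * t)) y"
    obtain i t j r where "x = (i, t)" "y = (j, r)" by (cases x, cases y)
    with sep[of i t j r] * show "x = y" by simp
  qed
  have sub: "(\<lambda>(i, t). f (g i * t)) ` ({..<4} \<times> T) \<subseteq> f ` blocks"
    using blocks_mult gD(2) T(3) by auto
  have "finite (f ` blocks)"
    using finite_H blocks_D f_closed by (meson finite_subset image_subsetI subsetD)
  from card_inj_on_le[OF inj sub this] show ?thesis
    by (simp add: card_cartesian_product)
qed

end

section \<open>Abelian groups of elements acting like the first generator\<close>

lemma (in grp) commutes_mult_power:
  assumes "commutes a b" shows "(a * b) ^ k = a ^ k * b ^ k"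
proof (induction k)
  case (Suc k)
  have "b * a ^ k = a ^ k * b"
    using commutes_pow'[OF assms, of k] by (simp add: commutes_def)
  then have "a * (b * a ^ k) * b ^ k = a * (a ^ k * b) * b ^ k" by simp
  then show ?case using Suc by (simp add: mult.assoc)
qed simp

context simple_quotient begin

lemma not_central3_if: "central_power 4 \<Longrightarrow> \<not> central_power 3"
  using central_power_diff[of 3 1] not_central1 by auto

abbreviation u14 :: 'g where "u14 \<equiv> s 1 * inverse (s 4)"
abbreviation u46 :: 'g where "u46 \<equiv> s 4 * inverse (s 6)"
text \<open>
  The full twist of the first three strands, brought to exponent sum zero. It acts on the first
  block as $s_1^{-6}$ does. It replaces the missing powers when cubes of generators are central.
\<close>

definition twist_quot :: 'g where "twist_quot = twist3 * inverse (s 1) ^ 6"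

lemma twist_quot_word: "word s {1, 2} twist_quot 0"
proof -
  have "word s {1, 2} twist3 6"
    using word_pow[OF word_mult[OF word_gen(1) word_gen(1)], of 2 "{1,2}" 1 s 3] by simp
  moreover have "word s {1, 2} (inverse (s 1) ^ 6) (- 6)"
    using word_pow[OF word_gen(2), of 1 "{1,2}" s 6] by simp
  ultimately show ?thesis
    unfolding twist_quot_def using word_mult by fastforce
qed

lemma twist_quot_acts_like_s1: "twist_quot \<in> acts_like_s1" "twist_quot \<in> blocks"
proof -
  show M: "twist_quot \<in> blocks" using twist_quot_word by (rule blocks_I)
  have twist3: "commutes twist3 q" if "word s {1, 2} q k" for q k
    using that by (rule word_commutes) (auto simp: twist3_commutes)
  have "conj_by twist_quot q = conj_by (inverse (s 1) ^ 6) q" if "word s {1, 2} q 0" for q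
  proof -
    have "word s {1, 2} (conj_by (inverse (s 1) ^ 6) q) 0"
      using word_conj[OF that word_pow[OF word_gen(2)]] by simp
    then show ?thesis
      using twist3 unfolding twist_quot_def conj_by_conj_by[symmetric] by (simp only: conj_by_commutes)
  qed
  moreover have "word s {1} (inverse (s 1) ^ 6) (- 6)"
    using word_pow[OF word_gen(2), of 1 "{1}" s 6] by simp
  moreover have "commutes twist_quot (s 1)"
    unfolding twist_quot_def by (rule commutes_mult'[OF twist3_commutes(1)]) (simp add: commutes_pow' commutes_inv')
  ultimately show "twist_quot \<in> acts_like_s1"
    using M blocks_D unfolding acts_like_s1_def by blast
qed

lemma twist_quot_commutes: "4 \<le> j \<Longrightarrow> j < n \<Longrightarrow> commutes twist_quot (s j)"
  using block12_commutes[OF twist_quot_word] .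

lemma twist_quot_commutes_central3:
  assumes "central_power 3"
  shows "commutes twist_quot (s 2)" "\<not> commutes twist_quot (s 3)"
proof -
  have c6: "central_power 6" using central_power_mult[OF assms, of 2] by simp
  have c: "commutes (inverse (s 1) ^ 6) (s j)" if "1 \<le> j" "j < n" for j
    using central_power_commutes[OF c6, of 1 j] that n5 by (simp add: commutes_inv' flip: inv_power)
  show "commutes twist_quot (s 2)"
    unfolding twist_quot_def using commutes_mult'[OF twist3_commutes(2) c[of 2]] n5 by simp
  show "\<not> commutes twist_quot (s 3)"
  proof
    assume "commutes twist_quot (s 3)"
    then have "commutes (twist_quot * inverse (inverse (s 1) ^ 6)) (s 3)"
      using commutes_mult'[OF _ commutes_inv'[OF c[of 3]]] n5 by simp
    then have "commutes twist3 (s 3)" by (simp add: twist_quot_def grp_simps)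
    then have "central_power 4" by (rule central_power_4_if_twist3_commutes)
    then show False using not_central3_if assms by blast
  qed
qed

lemma u14_acts_like_s1: "u14 \<in> acts_like_s1" "u14 \<in> blocks"
proof -
  show M: "u14 \<in> blocks"
    unfolding blocks_def using word_gen(1)[of 1 "{1,2}" s] word_gen(2)[of 4 "{4..<n}" s] n5 by fastforce
  have "conj_by u14 q = conj_by (s 1) q" if "word s {1, 2} q 0" for q
  proof -
    have "conj_by (inverse (s 4)) q = q"
      using commutes_inv'[OF commutes_sym[OF block12_commutes[OF that, of 4]]] n5 by (simp add: conj_by_commutes)
    then show ?thesis by (simp flip: conj_by_conj_by)
  qed
  moreover have "commutes u14 (s 1)"
    using commutes_mult'[OF commutes_refl commutes_inv'[OF far'[of 1 4]]] n5 by simp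
  ultimately show "u14 \<in> acts_like_s1"
    using M blocks_D word_gen(1)[of 1 "{1}" s] unfolding acts_like_s1_def by blast
qed

lemma u14_power_commutes:
  assumes "commutes (u14 ^ k) (s 2)" shows "central_power k"
proof -
  have 42: "commutes (s 4) (s 2)" and 41: "commutes (s 4) (s 1)" using far'[of 2 4] far'[of 1 4] n5 by auto
  have "u14 ^ k = s 1 ^ k * inverse (s 4) ^ k"
    by (rule commutes_mult_power[OF commutes_inv[OF commutes_sym[OF 41]]])
  then have "commutes (s 1 ^ k * inverse (s 4) ^ k * inverse (inverse (s 4) ^ k)) (s 2)"
    using commutes_mult'[OF assms commutes_inv'[OF commutes_pow'[OF commutes_inv'[OF 42]]], of k] by simp
  then have "commutes (s 1 ^ k) (s (Suc 1))"
    by (simp add: mult.assoc right_inv One_nat_def numeral_2_eq_2)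
  then show ?thesis by (rule central_power_if_commutes[rotated 2]) (use n5 in auto)
qed

text \<open>
  Commuting with $s_4$ and $s_m$ allows these elements to be multiplied by transversals for
  conjugates of the two generators.
\<close>

definition torus :: "nat \<Rightarrow> 'g set" where
  "torus m = {x \<in> acts_like_s1 \<inter> blocks. \<forall>i\<in>{1, 4, m}. commutes x (s i)}"

lemma torus_one: "1 \<in> torus m"
  using acts_like_s1_one blocks_I(1)[OF word.one] by (simp add: torus_def)

lemma torus_mult:
  assumes "x \<in> torus m" "y \<in> torus m" shows "x * y \<in> torus m"
  using assms acts_like_s1_mult[of x y] blocks_mult[of x y] commutes_mult'[of x _ y] unfolding torus_def by simp

lemma torus_power: "x \<in> torus m \<Longrightarrow> x ^ k \<in> torus m"
  by (induction k) (simp_all add: torus_one torus_mult)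

lemma torus_products:
  assumes "u \<in> torus m" "B \<subseteq> torus m"
  shows "(\<lambda>(j, a). u ^ j * a) ` (J \<times> B) \<subseteq> torus m"
proof (rule image_subsetI, clarify)
  fix j a assume "a \<in> B"
  then show "u ^ j * a \<in> torus m"
    by (intro torus_mult torus_power[OF assms(1)] subsetD[OF assms(2)])
qed

text \<open>
  The powers of $s_1s_4^{-1}$ below the fourth are told apart by commuting with $s_2$, unless cubes
  of generators are central. In that case three powers remain, and \<open>twist_quot\<close>
  provides a factor two: it commutes with $s_2$ but not with $s_3$.
\<close>

lemma small_torus:
  obtains A where "finite A" "A \<subseteq> torus 4" "4 \<le> card A"
proof -
  have u: "u14 \<in> torus 4"
    using u14_acts_like_s1 commutes_mult'[OF far[of 1 4] commutes_inv'[OF commutes_refl]] n5 unfolding torus_def acts_like_s1_def by simp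
  show thesis
  proof (cases "central_power 3")
    case False
    have n: "\<not> commutes (u14 ^ k) (s 2)" if "0 < k" "k < 4" for k
    proof
      assume "commutes (u14 ^ k) (s 2)"
      then have "central_power k" by (rule u14_power_commutes)
      moreover have "k = 1 \<or> k = 2 \<or> k = 3" using that by auto
      ultimately show False using not_central1 not_central2 False by auto
    qed
    let ?A = "(\<lambda>(j, a). u14 ^ j * a) ` ({..<4} \<times> {1})"
    have "card ?A = 4 * card {1::'g}" "finite ?A"
      by (rule card_power_mult[where w = "s 2"], use n in simp_all)+
    moreover have "?A \<subseteq> torus 4" using u torus_one by (intro torus_products) simp_all
    ultimately show thesis using that[of ?A] by simp
  next
    case True
    have n: "\<not> commutes (u14 ^ k) (s 2)" if "0 < k" "k < 3" for k
    proof
      assume "commutes (u14 ^ k) (s 2)"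
      then have "central_power k" by (rule u14_power_commutes)
      moreover have "k = 1 \<or> k = 2" using that by auto
      ultimately show False using not_central1 not_central2 by auto
    qed
    let ?B = "(\<lambda>(j, a). twist_quot ^ j * a) ` ({..<2} \<times> {1})"
    have zk: "\<not> commutes (twist_quot ^ k) (s 3)" if "0 < k" "k < 2" for k
      using that twist_quot_commutes_central3(2)[OF True] by (cases "k = 1") auto
    have B: "card ?B = 2 * card {1::'g}" "finite ?B"
      by (rule card_power_mult[where w = "s 3"], use zk in simp_all)+
    have B2: "commutes b (s 2)" if "b \<in> ?B" for b
      using that twist_quot_commutes_central3(1)[OF True] by (auto intro: commutes_pow')
    let ?A = "(\<lambda>(j, a). u14 ^ j * a) ` ({..<3} \<times> ?B)"
    have A: "card ?A = 3 * card ?B" "finite ?A"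
      by (rule card_power_mult[OF B(2) B2 n]; assumption)+
    have "twist_quot \<in> torus 4" using twist_quot_acts_like_s1 twist_quot_commutes[of 4] n5 unfolding torus_def acts_like_s1_def by auto
    then have "?A \<subseteq> torus 4" using u torus_one by (intro torus_products) simp_all
    then show thesis using that[OF A(2)] A(1) B(1) by simp
  qed
qed

end

section \<open>Six, seven and eight strands\<close>

context simple_quotient begin

text \<open>
  With seven strands, $s_4s_6^{-1}$ is an independent second direction. If cubes are central, the
  count is $3 \<cdot> 3 \<cdot> 2$ in place of $4 \<cdot> 4$.
\<close>

lemma large_torus:
  assumes "7 \<le> n"
  obtains A where "finite A" "A \<subseteq> torus 6" "16 \<le> card A"
proof -
  have c: "commutes (s 1) (s 4)" "commutes (s 1) (s 6)" "commutes (s 4) (s 6)"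
    using assms by (auto intro: far)
  have u14: "u14 \<in> torus 6"
    using u14_acts_like_s1 commutes_mult'[OF c(1) commutes_inv'[OF commutes_refl]]
      commutes_mult'[OF c(2) commutes_inv'[OF c(3)]] unfolding torus_def acts_like_s1_def by simp
  have w46: "word s {4..<n} u46 0"
    using word_mult[OF word_gen(2) word_gen(1), of 6 "{4..<n}" 4 s] assms by simp
  have u46: "u46 \<in> torus 6"
    using acts_like_s1_far_block[OF w46] blocks_I(2)[OF w46] commutes_mult'[OF commutes_sym[OF c(1)] commutes_inv'[OF commutes_sym[OF c(2)]]]
      commutes_mult'[OF commutes_refl commutes_inv'[OF commutes_sym[OF c(3)]]]
      commutes_mult'[OF c(3) commutes_inv'[OF commutes_refl]] unfolding torus_def by simp
  have twist_quot: "twist_quot \<in> torus 6"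
    using twist_quot_acts_like_s1 twist_quot_commutes[of 4] twist_quot_commutes[of 6] assms unfolding torus_def acts_like_s1_def by simp
  have p46: "u46 ^ k = s 4 ^ k * inverse (s 6) ^ k" for k
    by (rule commutes_mult_power[OF commutes_inv[OF c(3)]])
  have c2: "commutes u46 (s 2)"
    using commutes_mult'[OF far'[of 2 4] commutes_inv'[OF far'[of 2 6]]] assms by simp
  show thesis
  proof (cases "central_power 3")
    case False
    have nc: "\<not> central_power k" if "0 < k" "k < 4" for k
    proof -
      have "k = 1 \<or> k = 2 \<or> k = 3" using that by auto
      then show ?thesis using not_central1 not_central2 False by auto
    qed
    have n46: "\<not> commutes (u46 ^ k) (s 3)" if "0 < k" "k < 4" for k
    proof
      assume *: "commutes (u46 ^ k) (s 3)"
      have "commutes (inverse (s 6) ^ k) (s 3)"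
        using commutes_pow'[OF commutes_inv'[OF far'[of 3 6]]] assms by simp
      from commutes_mult'[OF * commutes_inv'[OF this]] have "commutes (s 4 ^ k) (s 3)"
        unfolding p46 by (simp add: mult.assoc right_inv)
      then have "central_power k" using central_power_if_commutes'[of 3 k] assms by simp
      then show False using nc that by blast
    qed
    have n14: "\<not> commutes (u14 ^ k) (s 2)" if "0 < k" "k < 4" for k
      using u14_power_commutes nc[OF that] by blast
    let ?B = "(\<lambda>(j, a). u46 ^ j * a) ` ({..<4} \<times> {1})"
    have B: "card ?B = 4 * card {1::'g}" "finite ?B"
      by (rule card_power_mult[where w = "s 3"], use n46 in simp_all)+
    have B2: "commutes b (s 2)" if "b \<in> ?B" for b
      using that commutes_pow'[OF c2] by auto
    let ?A = "(\<lambda>(j, a). u14 ^ j * a) ` ({..<4} \<times> ?B)"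
    have A: "card ?A = 4 * card ?B" "finite ?A"
      by (rule card_power_mult[OF B(2) B2 n14]; assumption)+
    have "?A \<subseteq> torus 6" using u14 u46 torus_one by (intro torus_products) simp_all
    then show thesis using that[OF A(2)] A(1) B(1) by simp
  next
    case True
    have n14: "\<not> commutes (u14 ^ k) (s 2)" if "0 < k" "k < 3" for k
    proof
      assume "commutes (u14 ^ k) (s 2)"
      then have "central_power k" by (rule u14_power_commutes)
      moreover have "k = 1 \<or> k = 2" using that by auto
      ultimately show False using not_central1 not_central2 by auto
    qed
    \<comment> \<open>Now $s_4s_6^{-1}$ has order three. Its powers are separated by $s_5$, since $s_3$ is needed for \<open>twist_quot\<close>.\<close>
    have n1: "\<not> commutes u46 (s 5)"
      using not_commutes_quotient[OF not_central1, of 4] assms by simp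
    have "u46 ^ 3 = 1"
      unfolding p46 using central_power_eq[OF True, of 4] central_power_eq[OF True, of 6] assms
      by (simp add: right_inv flip: inv_power)
    then have "u46 * u46 ^ 2 = 1" by (simp flip: power_Suc)
    then have "inverse u46 * (u46 * u46 ^ 2) = inverse u46" by simp
    then have "u46 ^ 2 = inverse u46" by (simp only: left_cancel)
    then have n2: "\<not> commutes (u46 ^ 2) (s 5)"
      using n1 commutes_inv'[of "inverse u46" "s 5"] by (auto simp only: inv_inv)
    have n46: "\<not> commutes (u46 ^ k) (s 5)" if "0 < k" "k < 3" for k
    proof -
      have "k = 1 \<or> k = 2" using that by auto
      then show ?thesis using n1 n2 by auto
    qed
    let ?C = "(\<lambda>(j, a). twist_quot ^ j * a) ` ({..<2} \<times> {1})"
    have zk: "\<not> commutes (twist_quot ^ k) (s 3)" if "0 < k" "k < 2" for k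
      using that twist_quot_commutes_central3(2)[OF True] by (cases "k = 1") auto
    have C: "card ?C = 2 * card {1::'g}" "finite ?C"
      by (rule card_power_mult[where w = "s 3"], use zk in simp_all)+
    have C2: "commutes b (s 5)" if "b \<in> ?C" for b
      using that commutes_pow'[OF twist_quot_commutes[of 5]] assms by auto
    let ?B = "(\<lambda>(j, a). u46 ^ j * a) ` ({..<3} \<times> ?C)"
    have B: "card ?B = 3 * card ?C" "finite ?B"
      by (rule card_power_mult[OF C(2) C2 n46]; assumption)+
    have B2: "commutes b (s 2)" if "b \<in> ?B" for b
      using that commutes_mult'[OF commutes_pow'[OF c2] commutes_pow'[OF twist_quot_commutes_central3(1)[OF True]]] by auto
    let ?A = "(\<lambda>(j, a). u14 ^ j * a) ` ({..<3} \<times> ?B)"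
    have A: "card ?A = 3 * card ?B" "finite ?A"
      by (rule card_power_mult[OF B(2) B2 n14]; assumption)+
    have "?A \<subseteq> torus 6" using u14 u46 twist_quot torus_one by (intro torus_products) simp_all
    then show thesis using that[OF A(2)] A(1) B(1) C(1) by simp
  qed
qed

text \<open>
  Multiplies a set $A$ in the centraliser of $s_i$ by conjugators of exponent sum zero that realise
  the conjugates $E$ of $s_i$. The conclusion on commuting elements allows the construction to be
  iterated.
\<close>

lemma arc_products:
  assumes i: "i \<in> I" and fin: "finite E" "finite A"
    and E: "\<And>e. e \<in> E \<Longrightarrow> \<exists>h k. word s I h k \<and> e = conj_by h (s i)"
    and A: "\<And>a. a \<in> A \<Longrightarrow> commutes a (s i)" "A \<subseteq> P"
    and P: "\<And>h. word s I h 0 \<Longrightarrow> h \<in> P" "\<And>x y. x \<in> P \<Longrightarrow> y \<in> P \<Longrightarrow> x * y \<in> P"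
  obtains T where "finite T" "T \<subseteq> P" "card T = card E * card A"
    "\<forall>x. (\<forall>j\<in>I. commutes x (s j)) \<longrightarrow> (\<forall>a\<in>A. commutes x a) \<longrightarrow> (\<forall>t\<in>T. commutes x t)"
proof -
  have "\<exists>h. word s I h 0 \<and> conj_by h (s i) = e" if e: "e \<in> E" for e
  proof -
    obtain h k where h: "word s I h k" "e = conj_by h (s i)" using E[OF e] by blast
    obtain h' where "word s I h' 0" "conj_by h' (s i) = conj_by h (s i)"
      using word_normalize[OF h(1) i] .
    then show ?thesis using h(2) by auto
  qed
  then obtain h where h: "\<And>e. e \<in> E \<Longrightarrow> word s I (h e) 0" "\<And>e. e \<in> E \<Longrightarrow> conj_by (h e) (s i) = e"
    by metis
  have inj: "inj_on (\<lambda>e. conj_by (h e) (s i)) E"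
    using h(2) by (simp add: inj_on_def)
  let ?T = "(\<lambda>(e, a). h e * a) ` (E \<times> A)"
  show thesis
  proof (rule that[of ?T])
    show "finite ?T" "card ?T = card E * card A"
      using card_transversal_mult[OF fin inj A(1)] by simp_all
    show "?T \<subseteq> P"
    proof (rule image_subsetI, clarify)
      fix e a assume "e \<in> E" "a \<in> A"
      then show "h e * a \<in> P" by (intro P h subsetD[OF A(2)])
    qed
    show "\<forall>x. (\<forall>j\<in>I. commutes x (s j)) \<longrightarrow> (\<forall>a\<in>A. commutes x a) \<longrightarrow> (\<forall>t\<in>?T. commutes x t)"
    proof (intro allI impI ballI)
      fix x t assume xI: "\<forall>j\<in>I. commutes x (s j)" and xA: "\<forall>a\<in>A. commutes x a" and "t \<in> ?T"
      then obtain e a where t: "e \<in> E" "a \<in> A" "t = h e * a" by auto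
      show "commutes x t"
        unfolding t(3) by (rule commutes_mult[OF word_commutes[OF h(1)[OF t(1)] bspec[OF xI]] bspec[OF xA t(2)]])
    qed
  qed
qed

lemma four_arcs:
  assumes "1 \<le> i" "Suc i < n"
  obtains E where "finite E" "card E = 4" "\<And>e. e \<in> E \<Longrightarrow> \<exists>h k. word s {i, Suc i} h k \<and> e = conj_by h (s i)"
proof -
  let ?l = "[1, s i * s (Suc i), s (Suc i), inverse (s (Suc i))]"
  let ?c = "\<lambda>j. conj_by (?l ! j) (s i)"
  have "\<not> commutes (s (Suc i) ^ 2) (s i)"
    using central_power_if_commutes'[OF assms] not_central2 by blast
  from arcs_distinct[OF braid[OF assms] this] have "card (?c ` {..<4}) = 4"
    by (simp only: card_image card_lessThan)
  moreover have "\<exists>h k. word s {i, Suc i} h k \<and> e = conj_by h (s i)" if e: "e \<in> ?c ` {..<4}" for e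
  proof -
    have w: "\<exists>k. word s {i, Suc i} x k" if "x \<in> set ?l" for x
      using that word.one[of s "{i, Suc i}"] word_gen[of i "{i, Suc i}" s] word_gen[of "Suc i" "{i, Suc i}" s]
        word_mult[OF word_gen(1) word_gen(1), of "Suc i" "{i, Suc i}" i s] by auto
    obtain j where j: "j < 4" "e = ?c j" using e by auto
    have "?l ! j \<in> set ?l" using j(1) by (intro nth_mem) simp
    then show ?thesis using w j(2) by blast
  qed
  ultimately show thesis using that[of "?c ` {..<4}"] by simp
qed

text \<open>
  All generators from the fourth on are conjugate, hence so are all chords between the points
  $4,\<dots>,n$.
\<close>

lemma all_chords:
  assumes "5 \<le> n"
  obtains E where "finite E" "card E = (\<Sum>i = 4..<n. n - i)"
    "\<And>e. e \<in> E \<Longrightarrow> \<exists>h k. word s {4..<n} h k \<and> e = conj_by h (s 4)"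
proof -
  let ?J = "SIGMA i:{4..<n}. {..<n - i}"
  let ?E = "(\<lambda>(i, m). chord i m) ` ?J"
  have "inj_on (\<lambda>(i, m). chord i m) ?J"
  proof (rule inj_onI)
    fix x y assume *: "x \<in> ?J" "y \<in> ?J" "(\<lambda>(i, m). chord i m) x = (\<lambda>(i, m). chord i m) y"
    obtain i m j l where xy: "x = (i, m)" "y = (j, l)" by (cases x, cases y)
    with * have "2 \<le> i" "i + m < n" "2 \<le> j" "j + l < n" "chord i m = chord j l" by auto
    from chord_inj[OF not_central1 this] show "x = y" by (simp add: xy)
  qed
  then have "card ?E = card ?J" by (rule card_image)
  also have "\<dots> = (\<Sum>i = 4..<n. n - i)" by (simp add: card_SigmaI)
  finally have "card ?E = (\<Sum>i = 4..<n. n - i)" .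
  moreover have "\<exists>h k. word s {4..<n} h k \<and> e = conj_by h (s 4)" if e: "e \<in> ?E" for e
  proof -
    obtain i m where "(i, m) \<in> ?J" "e = chord i m" using e by auto
    then have im: "4 \<le> i" "i + m < n" "e = chord i m" by auto
    obtain R k where R: "word s {Suc i..i + m} R k" "chord i m = conj_by R (s i)"
      using chord_word(2)[of i m] im by auto
    have "{Suc i..i + m} \<subseteq> {4..<n}" using im(1,2) by auto
    with R(1) have R': "word s {4..<n} R k" by (rule word_mono)
    have "\<exists>h k. word s {4..<n} h k \<and> s i = conj_by h (s 4)"
      using im(1) less_le_trans[OF _ im(2)[THEN less_imp_le]] im(2)
    proof (induction i rule: dec_induct)
      case base show ?case by (intro exI[of _ 1] exI[of _ 0]) (simp add: word.one)
    next
      case (step j)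
      then obtain h l where h: "word s {4..<n} h l" "s j = conj_by h (s 4)" by auto
      have "s (Suc j) = conj_by (s j * s (Suc j)) (s j)"
        using braid_shift[OF braid[of j]] step by simp
      moreover have "word s {4..<n} (s j * s (Suc j)) 2"
        using word_mult[OF word_gen(1) word_gen(1), of "Suc j" "{4..<n}" j s] step by simp
      ultimately show ?case using h word_mult[OF h(1)] by (metis conj_by_conj_by)
    qed
    then obtain h l where "word s {4..<n} h l" "s i = conj_by h (s 4)" by blast
    then show ?thesis using word_mult[OF _ R'] im(3) R(2) by (metis conj_by_conj_by)
  qed
  ultimately show thesis using that[of ?E] by simp
qed

text \<open>
  What remains of a supposed small $H$: an index $k$ that satisfies two numerical inequalities, to
  be refuted for each $n$.
\<close>

lemma contradiction_by_count:
  assumes "6 \<le> n" "finite T" "T \<subseteq> acts_like_s1 \<inter> blocks" "order H \<le> fact n div 2" "b \<le> 4 * card T"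
  shows "\<exists>k>0. k * b \<le> fact n div 2 \<and> k * b \<le> fact k"
proof -
  have b: "b \<le> card (f ` blocks)"
    using order_trans[OF assms(5) card_block_product[OF assms(2)]] assms(3) by simp
  obtain k where "0 < k" "k * card (f ` blocks) \<le> fact n div 2" "k * card (f ` blocks) \<le> fact k"
    using order_bound_by_subgroup[OF blocks_subgroup blocks_proper[OF assms(1)] assms(4)] .
  moreover have "k * b \<le> k * card (f ` blocks)" using b by simp
  ultimately show ?thesis by (intro exI[of _ k]) linarith
qed

lemma acting_blocks_closed: "word s I h 0 \<Longrightarrow> I \<subseteq> {4..<n} \<Longrightarrow> h \<in> acts_like_s1 \<inter> blocks" "x \<in> acts_like_s1 \<inter> blocks \<Longrightarrow> y \<in> acts_like_s1 \<inter> blocks \<Longrightarrow> x * y \<in> acts_like_s1 \<inter> blocks"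
proof -
  assume "word s I h 0" "I \<subseteq> {4..<n}"
  then have "word s {4..<n} h 0" by (rule word_mono)
  then show "h \<in> acts_like_s1 \<inter> blocks" using acts_like_s1_far_block blocks_I(2) by simp
qed (simp add: acts_like_s1_mult blocks_mult)

text \<open>
  Four arcs on strands $4,5,6$ and an abelian set of four elements give $4 \<cdot> 4 \<cdot> 4 =
  64$.
\<close>

lemma order_large_6:
  assumes "n = 6" shows "\<not> order H \<le> fact n div 2"
proof
  assume o: "order H \<le> fact n div 2"
  obtain A where A: "finite A" "A \<subseteq> torus 4" "4 \<le> card A" by (rule small_torus)
  obtain E where E: "finite E" "card E = 4" "\<And>e. e \<in> E \<Longrightarrow> \<exists>h k. word s {4, Suc 4} h k \<and> e = conj_by h (s 4)"
    using four_arcs[of 4] assms by auto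
  have AP: "A \<subseteq> acts_like_s1 \<inter> blocks" and A4: "\<And>a. a \<in> A \<Longrightarrow> commutes a (s 4)"
    using A(2) unfolding torus_def by auto
  have I: "{4, Suc 4} \<subseteq> {4..<n}" using assms by auto
  obtain T where T: "finite T" "T \<subseteq> acts_like_s1 \<inter> blocks" "card T = card E * card A"
    by (rule arc_products[OF _ E(1) A(1) E(3) A4 AP acting_blocks_closed(1)[OF _ I] acting_blocks_closed(2)]) ((assumption | rule insertI1 | (rule that; assumption))+)
  have "64 \<le> 4 * card T" using T(3) E(2) A(3) by simp
  from contradiction_by_count[OF _ T(1,2) o this] assms
  obtain k where k: "0 < k" "k * 64 \<le> 360" "k * 64 \<le> fact k" by (auto simp: fact_numeral)
  have "k = 1 \<or> k = 2 \<or> k = 3 \<or> k = 4 \<or> k = 5" using k(1,2) by linarith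
  then show False using k(3) by (elim disjE) (simp_all add: fact_numeral)
qed

text \<open>
  Six chords between the points $4,5,6,7$ and an abelian set of sixteen elements give $4 \<cdot> 6
  \<cdot> 16 = 384$.
\<close>

lemma order_large_7:
  assumes "n = 7" shows "\<not> order H \<le> fact n div 2"
proof
  assume o: "order H \<le> fact n div 2"
  obtain A where A: "finite A" "A \<subseteq> torus 6" "16 \<le> card A"
    by (rule large_torus) (use assms in simp)
  obtain E where E: "finite E" "card E = (\<Sum>i = 4..<n. n - i)" "\<And>e. e \<in> E \<Longrightarrow> \<exists>h k. word s {4..<n} h k \<and> e = conj_by h (s 4)"
    by (rule all_chords[OF n5]) (rule that; assumption)
  have AP: "A \<subseteq> acts_like_s1 \<inter> blocks" and A4: "\<And>a. a \<in> A \<Longrightarrow> commutes a (s 4)"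
    using A(2) unfolding torus_def by auto
  have 4: "4 \<in> {4..<n}" using assms by simp
  obtain T where T: "finite T" "T \<subseteq> acts_like_s1 \<inter> blocks" "card T = card E * card A"
    by (rule arc_products[OF 4 E(1) A(1) E(3) A4 AP acting_blocks_closed(1)[OF _ subset_refl] acting_blocks_closed(2)]) ((assumption | (rule that; assumption))+)
  have "{4..<n} = {4, 5, 6}" using assms by auto
  then have "card E = 6" using E(2) assms by simp
  then have "384 \<le> 4 * card T" using T(3) A(3) by simp
  from contradiction_by_count[OF _ T(1,2) o this] assms
  obtain k where k: "0 < k" "k * 384 \<le> 2520" "k * 384 \<le> fact k" by (auto simp: fact_numeral)
  have "k = 1 \<or> k = 2 \<or> k = 3 \<or> k = 4 \<or> k = 5 \<or> k = 6" using k(1,2) by linarith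
  then show False using k(3) by (elim disjE) (simp_all add: fact_numeral)
qed

text \<open>
  Ten chords between the points $4,\<dots>,8$, four arcs on strands $6,7,8$ that commute with $s_4$,
  and an abelian set of sixteen elements give $4 \<cdot> 10 \<cdot> 4 \<cdot> 16 = 2560$.
\<close>

lemma order_large_8:
  assumes "n = 8" shows "\<not> order H \<le> fact n div 2"
proof
  assume o: "order H \<le> fact n div 2"
  obtain A where A: "finite A" "A \<subseteq> torus 6" "16 \<le> card A"
    by (rule large_torus) (use assms in simp)
  obtain F where F: "finite F" "card F = 4" "\<And>e. e \<in> F \<Longrightarrow> \<exists>h k. word s {6, Suc 6} h k \<and> e = conj_by h (s 6)"
    using four_arcs[of 6] assms by auto
  obtain E where E: "finite E" "card E = (\<Sum>i = 4..<n. n - i)" "\<And>e. e \<in> E \<Longrightarrow> \<exists>h k. word s {4..<n} h k \<and> e = conj_by h (s 4)"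
    by (rule all_chords[OF n5]) (rule that; assumption)
  have AP: "A \<subseteq> acts_like_s1 \<inter> blocks" and A6: "\<And>a. a \<in> A \<Longrightarrow> commutes a (s 6)"
    using A(2) unfolding torus_def by auto
  have A4: "commutes (s 4) a" if "a \<in> A" for a
    using A(2) that commutes_sym[of a "s 4"] unfolding torus_def by auto
  have I: "{6, Suc 6} \<subseteq> {4..<n}" using assms by auto
  have s4: "commutes (s 4) (s j)" if "j \<in> {6, Suc 6}" for j
    using that assms by (auto intro!: far)
  obtain B where B: "finite B" "B \<subseteq> acts_like_s1 \<inter> blocks" "card B = card F * card A"
    "\<forall>x. (\<forall>j\<in>{6, Suc 6}. commutes x (s j)) \<longrightarrow> (\<forall>a\<in>A. commutes x a) \<longrightarrow> (\<forall>t\<in>B. commutes x t)"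
    by (rule arc_products[OF _ F(1) A(1) F(3) A6 AP acting_blocks_closed(1)[OF _ I] acting_blocks_closed(2)]) ((assumption | rule insertI1 | (rule that; assumption))+)
  have BP: "commutes b (s 4)" if "b \<in> B" for b
    using B(4)[rule_format, OF s4 A4 that] by (rule commutes_sym)
  have 4: "4 \<in> {4..<n}" using assms by simp
  obtain T where T: "finite T" "T \<subseteq> acts_like_s1 \<inter> blocks" "card T = card E * card B"
    by (rule arc_products[OF 4 E(1) B(1) E(3) BP B(2) acting_blocks_closed(1)[OF _ subset_refl] acting_blocks_closed(2)]) ((assumption | (rule that; assumption))+)
  have "{4..<n} = {4, 5, 6, 7}" using assms by auto
  then have "card E = 10" using E(2) assms by simp
  then have "2560 \<le> 4 * card T" using T(3) A(3) B(3) F(2) by simp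
  from contradiction_by_count[OF _ T(1,2) o this] assms
  obtain k where k: "0 < k" "k * 2560 \<le> 20160" "k * 2560 \<le> fact k" by (auto simp: fact_numeral)
  have "k = 1 \<or> k = 2 \<or> k = 3 \<or> k = 4 \<or> k = 5 \<or> k = 6 \<or> k = 7" using k(1,2) by linarith
  then show False using k(3) by (elim disjE) (simp_all add: fact_numeral)
qed

end

section \<open>Five strands\<close>

context simple_quotient begin

context
  assumes n_eq: "n = 5"
begin

lemma last_block: "{4..<n} = {4}"
  using n_eq by auto

lemma blocks_commutes_s4: "x \<in> blocks \<Longrightarrow> commutes x (s 4)"
proof -
  assume "x \<in> blocks"
  then obtain b p j where x: "word s {1, 2} b j" "word s {4..<n} p (- j)" "x = b * p"
    unfolding blocks_def by blast
  have "commutes (s 4) p" using x(2) by (rule word_commutes) (simp add: last_block)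
  then show ?thesis
    unfolding x(3) using block12_commutes[OF x(1), of 4] n_eq by (simp add: commutes_mult' commutes_sym)
qed

lemma f_inj_blocks: "inj_on f blocks"
  using f_eqD[of _ _ 4] blocks_D blocks_commutes_s4 n_eq by (auto intro!: inj_onI)

lemma card_subset_block: "T \<subseteq> blocks \<Longrightarrow> card T \<le> card (f ` blocks)"
proof -
  assume T: "T \<subseteq> blocks"
  have "finite (f ` blocks)"
    using finite_subset[OF subgroup.subset[OF blocks_subgroup] finite_H] .
  then have "card (f ` T) \<le> card (f ` blocks)" using T by (intro card_mono image_mono)
  then show ?thesis using card_image[OF inj_on_subset[OF f_inj_blocks T]] by simp
qed

lemma card_block_image_5: "16 \<le> card (f ` blocks)"
proof -
  obtain A where A: "finite A" "A \<subseteq> torus 4" "4 \<le> card A" by (rule small_torus)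
  have 12: "{1, Suc 1} = {1, 2::nat}" by (simp add: numeral_2_eq_2 One_nat_def)
  obtain E where E: "finite E" "card E = 4" "\<And>e. e \<in> E \<Longrightarrow> \<exists>h k. word s {1, 2} h k \<and> e = conj_by h (s 1)"
    using four_arcs[of 1] n_eq unfolding 12 by auto
  have AP: "A \<subseteq> blocks" and A1: "\<And>a. a \<in> A \<Longrightarrow> commutes a (s 1)"
    using A(2) unfolding torus_def by auto
  obtain T where T: "finite T" "T \<subseteq> blocks" "card T = card E * card A"
    by (rule arc_products[OF _ E(1) A(1) E(3) A1 AP blocks_I(1) blocks_mult]) ((assumption | rule insertI1 | (rule that; assumption))+)
  show ?thesis using card_subset_block[OF T(2)] T(3) E(2) A(3) by simp
qed

text \<open>
  If the blocks already cover $H$, the image of $x$ is central in $H$, hence trivial, and $f$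
  detects this since $x$ commutes with $s_4$.
\<close>

lemma blocks_generators_central:
  assumes "f ` blocks = carrier H" "x \<in> D" "commutes x (s 1)" "commutes x (s 2)" "commutes x (s 4)"
  shows "x = 1"
proof -
  have c: "commutes x y" if yM: "y \<in> blocks" for y
  proof -
    obtain b p j where y: "word s {1, 2} b j" "word s {4..<n} p (- j)" "y = b * p"
      using yM unfolding blocks_def by blast
    have "commutes x b" using y(1) by (rule word_commutes) (use assms in auto)
    moreover have "commutes x p" using y(2) by (rule word_commutes) (use assms last_block in auto)
    ultimately show ?thesis unfolding y(3) by (rule commutes_mult)
  qed
  have "f x = \<one>"
  proof (rule central_trivial)
    show "f x \<in> carrier H" using f_closed[OF assms(2)] .
    fix h assume "h \<in> carrier H"
    then obtain y where y: "y \<in> blocks" "h = f y" using assms(1) by blast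
    have yD: "y \<in> D" using y(1) blocks_D by blast
    have "x * y = y * x" using c[OF y(1)] by (simp add: commutes_def)
    then show "f x \<otimes> h = h \<otimes> f x"
      using f_mult[OF assms(2) yD] f_mult[OF yD assms(2)] y(2) by simp
  qed
  then show ?thesis using detect[OF assms(2), of 4] assms(5) n_eq by simp
qed

context
  assumes full: "f ` blocks = carrier H"
begin

text \<open>
  The full twist of the first three strands commutes with $s_1, s_2, s_4$, and so does $s_4^6$, of
  the same exponent sum.
\<close>

lemma twist3_eq_power: "twist3 = s 4 ^ 6"
proof -
  have w: "word s {1..<n} twist3 6" "word s {1..<n} (inverse (s 4) ^ 6) (- 6)"
    using word_pow[OF word_mult[OF word_gen(1) word_gen(1)], of 2 "{1..<n}" 1 s 3] word_pow[OF word_gen(2), of 4 "{1..<n}" s 6] n_eq by simp_all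
  have "twist3 * inverse (s 4) ^ 6 = 1"
  proof (rule blocks_generators_central[OF full])
    show "twist3 * inverse (s 4) ^ 6 \<in> D" unfolding D_def using word_mult[OF w(2,1)] by simp
    have "commutes (inverse (s 4) ^ 6) (s j)" if "j = 1 \<or> j = 2 \<or> j = 4" for j
      using that far'[of 1 4] far'[of 2 4] n_eq by (intro commutes_pow' commutes_inv') auto
    then show "commutes (twist3 * inverse (s 4) ^ 6) (s 1)" "commutes (twist3 * inverse (s 4) ^ 6) (s 2)" "commutes (twist3 * inverse (s 4) ^ 6) (s 4)"
      using twist3_commutes(1,2) twist3_commutes(3)[of 4] n_eq by (simp_all add: commutes_mult')
  qed
  then have "twist3 * inverse (s 4 ^ 6) * s 4 ^ 6 = s 4 ^ 6" by (simp add: inv_power)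
  then show ?thesis by (simp add: mult.assoc left_inv)
qed

lemma delta_gens_prod: "delta = gens_prod 4"
  unfolding delta_def using n_eq by simp

lemma delta_rotations: "conj_by delta (s 1) = s 2" "conj_by delta (s 2) = s 3" "conj_by delta (s 3) = s 4"
  "conj_by (delta ^ 2) (s 4) = s 1"
proof -
  show "conj_by delta (s 1) = s 2" "conj_by delta (s 2) = s 3" "conj_by delta (s 3) = s 4"
    using conj_shift[of 1] conj_shift[of 2] conj_shift[of 3] n_eq by (simp_all add: numeral_eq_Suc One_nat_def)
  have "delta ^ 2 * s 4 = s 1 * delta ^ 2"
    unfolding delta_gens_prod power2_eq_square using gens_prod_square[of 4] n_eq by simp
  then show "conj_by (delta ^ 2) (s 4) = s 1" by (rule conj_by_eq)
qed

text \<open>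
  Conjugation by \<open>delta\<close> takes $s_1$ to $s_2$, $s_3$ and $s_4$, and two further steps
  lead back to $s_1$. So the fifth power of \<open>delta\<close>, the full twist of five strands, is
  central. It has exponent sum $20$ and is therefore equal to $s_4^{20}$.
\<close>

lemma central_power_20: "central_power 20"
proof -
  note r = delta_rotations
  have e: "conj_by (delta ^ 5) x = conj_by (delta ^ 2) (conj_by delta (conj_by delta (conj_by delta x)))"
    "conj_by (delta ^ 5) x = conj_by delta (conj_by (delta ^ 2) (conj_by delta (conj_by delta x)))"
    "conj_by (delta ^ 5) x = conj_by delta (conj_by delta (conj_by (delta ^ 2) (conj_by delta x)))"
    "conj_by (delta ^ 5) x = conj_by delta (conj_by delta (conj_by delta (conj_by (delta ^ 2) x)))" for x
    by (simp_all add: conj_by_conj_by numeral_eq_Suc One_nat_def mult.assoc)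
  have c: "commutes (delta ^ 5) (s 1)" "commutes (delta ^ 5) (s 2)" "commutes (delta ^ 5) (s 3)" "commutes (delta ^ 5) (s 4)"
    using e(1)[of "s 1"] e(2)[of "s 2"] e(3)[of "s 3"] e(4)[of "s 4"]
    unfolding r by (simp_all only: conj_by_commutes)
  have word: "word s {1..<n} (gens_prod k) (int k)" if "k < n" for k
    using that
  proof (induction k)
    case (Suc k)
    then show ?case using word.gen[of s "{1..<n}" "gens_prod k" "int k" "Suc k"] by (simp add: add.commute)
  qed (simp add: word.one)
  have w: "word s {1..<n} (delta ^ 5) 20" "word s {1..<n} (inverse (s 4) ^ 20) (- 20)"
    unfolding delta_gens_prod using word_pow[OF word[of 4], of 5] word_pow[OF word_gen(2), of 4 "{1..<n}" s 20] n_eq by simp_all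
  have "delta ^ 5 * inverse (s 4) ^ 20 = 1"
  proof (rule blocks_generators_central[OF full])
    show "delta ^ 5 * inverse (s 4) ^ 20 \<in> D" unfolding D_def using word_mult[OF w(2,1)] by simp
    have "commutes (inverse (s 4) ^ 20) (s j)" if "j = 1 \<or> j = 2 \<or> j = 4" for j
      using that far'[of 1 4] far'[of 2 4] n_eq by (intro commutes_pow' commutes_inv') auto
    then show "commutes (delta ^ 5 * inverse (s 4) ^ 20) (s 1)" "commutes (delta ^ 5 * inverse (s 4) ^ 20) (s 2)" "commutes (delta ^ 5 * inverse (s 4) ^ 20) (s 4)"
      using c by (simp_all add: commutes_mult')
  qed
  then have "delta ^ 5 * inverse (s 4 ^ 20) * s 4 ^ 20 = s 4 ^ 20" by (simp add: inv_power)
  then have "delta ^ 5 = s 4 ^ 20" by (simp add: mult.assoc left_inv)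
  then have "commutes (s 4 ^ 20) (s 3)" using c(3) by (simp only:)
  then show ?thesis using central_power_if_commutes'[of 3 20] n_eq by simp
qed

lemma twist34_power: "(s 3 * s 4) ^ 3 = s 1 ^ 6"
  using twist34 delta_rotations(4) by (simp add: twist3_eq_power conj_by_pow)

text \<open>
  If fifth powers are central, $s_4^6 = s_4s_1^5$, and the loop of the fourth strand becomes
  $(s_3s_4s_3)s_1^3$. Its square is $s_1^{12}$ and commutes with $s_2$, which leaves $12 - 2 \<cdot>
  5 = 2$.
\<close>

lemma not_central5: "\<not> central_power 5"
proof
  assume c5: "central_power 5"
  have far1: "s 1 * s 3 = s 3 * s 1" "s 1 * s 4 = s 4 * s 1"
    using far[of 1 3] far[of 1 4] n_eq by (simp_all add: commutes_def)
  have "s 4 ^ 5 = s 1 ^ 5"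
    using central_power_eq[OF c5, of 4] n_eq by simp
  moreover have "s 4 ^ 6 = s 4 * s 4 ^ 5"
    using power_Suc[of "s 4" 5] by simp
  ultimately have "s 4 ^ 6 = s 4 * s 1 ^ 5"
    by (simp only:)
  then have "s 2 * s 1 ^ 2 * s 2 = s 4 * (s 1 ^ 5 * inverse (s 1 ^ 2))"
    unfolding twist3_eq twist3_eq_power by (simp add: mult.assoc)
  also have "s 1 ^ 5 = s 1 ^ 3 * s 1 ^ 2"
    by (simp flip: power_add)
  also have "s 1 ^ 3 * s 1 ^ 2 * inverse (s 1 ^ 2) = s 1 ^ 3"
    by (simp only: mult.assoc right_inv mult_1_right)
  finally have X3: "s 2 * s 1 ^ 2 * s 2 = s 4 * s 1 ^ 3" .
  let ?y = "s 3 * s 4 * s 3"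
  have c13: "commutes (s 1 ^ 3) ?y" "commutes (s 1 ^ 3) (s 3)"
    using far[of 1 3] far[of 1 4] n_eq by (auto intro!: commutes_pow' commutes_mult)
  have "s 3 * (s 4 * s 1 ^ 3) * s 3 = s 3 * s 4 * (s 1 ^ 3 * s 3)" by (simp only: mult.assoc)
  also have "\<dots> = ?y * s 1 ^ 3" using c13(2) by (simp add: commutes_def mult.assoc)
  finally have X4: "s 3 * (s 2 * s 1 ^ 2 * s 2) * s 3 = ?y * s 1 ^ 3" unfolding X3 .
  have "commutes ((?y * s 1 ^ 3) ^ 2) (s 2)"
    using strand_loop_commutes unfolding X4 by (rule commutes_pow')
  also have "(?y * s 1 ^ 3) ^ 2 = ?y ^ 2 * (s 1 ^ 3) ^ 2"
    by (rule commutes_mult_power[OF commutes_sym[OF c13(1)]])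
  also have "?y ^ 2 = s 1 ^ 6"
    using full_twist_eq(2)[of "s 3" "s 4"] braid[of 3] twist34_power n_eq by simp
  also have "s 1 ^ 6 * (s 1 ^ 3) ^ 2 = s 1 ^ 12"
    by (simp flip: power_mult power_add)
  finally have "commutes (s 1 ^ 12) (s (Suc 1))" by (simp only: Suc_1)
  then have "central_power 12" using n_eq by (intro central_power_if_commutes[of 1 12]) simp_all
  then have "central_power 2" using central_power_diff[OF central_power_mult[OF c5, of 2], of 2] by simp
  then show False using not_central2 by simp
qed

text \<open>
  If fourth powers are central, then $s_1^2$ and $s_2^2$ commute, and $\<langle>s_1,s_2\<rangle>$
  permutes the three elements $s_1^2$, $s_2^2$, $s_1s_2^2s_1^{-1}$. Multiplied by $s_4^{-2}$, they
  have a conjugation invariant image in $H$ on which one of them acts trivially, so that this one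
  would be central.
\<close>

lemma not_central4: "\<not> central_power 4"
proof
  assume c4: "central_power 4"
  let ?x = "s 1 ^ 2" and ?y = "s 2 ^ 2" and ?t = "inverse (s 4 ^ 2)"
  have e4: "s 4 ^ 4 = s 1 ^ 4" "s 2 ^ 4 = s 1 ^ 4" using central_power_eq[OF c4, of 4] central_power_eq[OF c4, of 2] n_eq by simp_all
  have c4s: "commutes (s 4) (s 1)" "commutes (s 4) (s 2)" using far'[of 1 4] far'[of 2 4] n_eq by simp_all
  have "s 4 ^ 6 * inverse ?x = s 4 ^ 2 * (s 4 ^ 4 * inverse ?x)"
    by (simp add: mult.assoc[symmetric] flip: power_add)
  also have "s 4 ^ 4 * inverse ?x = ?x"
  proof -
    have "s 1 ^ 4 = ?x * ?x" by (simp flip: power_add)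
    then show ?thesis unfolding e4 by (simp only: mult.assoc right_inv mult_1_right)
  qed
  finally have X3: "s 2 * ?x * s 2 = s 4 ^ 2 * ?x"
    unfolding twist3_eq twist3_eq_power .
  have c2: "s 4 ^ 2 * ?x = ?x * s 4 ^ 2"
    using commutes_pow[OF commutes_pow'[OF c4s(1), of 2], of 2] by (simp only: commutes_def)
  have "conj_by (inverse ?x) (s 2) = s 4 ^ 2 * inverse (s 2)"
  proof -
    have "s 2 * ?x = s 2 * ?x * s 2 * inverse (s 2)" by (simp add: mult.assoc right_inv)
    also have "\<dots> = ?x * (s 4 ^ 2 * inverse (s 2))" unfolding X3 c2 by (simp add: mult.assoc)
    finally have "inverse ?x * (s 2 * ?x) = s 4 ^ 2 * inverse (s 2)" by (simp add: left_cancel)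
    then show ?thesis by (simp add: conj_by_def inv_inv mult.assoc)
  qed
  then have "conj_by (inverse ?x) ?y = (s 4 ^ 2 * inverse (s 2)) ^ 2"
    by (simp only: conj_by_pow)
  also have "\<dots> = (s 4 ^ 2) ^ 2 * inverse (s 2) ^ 2"
    by (rule commutes_mult_power[OF commutes_inv[OF commutes_pow'[OF c4s(2)]]])
  also have "(s 4 ^ 2) ^ 2 = s 2 ^ 4"
    using e4 by (simp flip: power_mult)
  also have "s 2 ^ 4 * inverse (s 2) ^ 2 = ?y"
  proof -
    have "s 2 ^ 4 = ?y * ?y" by (simp flip: power_add)
    then show ?thesis by (simp only: mult.assoc right_inv mult_1_right flip: inv_power)
  qed
  finally have inv_xy: "conj_by (inverse ?x) ?y = ?y" .
  then have "commutes (inverse ?x) ?y" by (simp only: conj_by_commutes)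
  from commutes_inv'[OF this] have xy: "commutes ?x ?y" by (simp only: inv_inv)
  let ?r = "conj_by (s 1) ?y"
  \<comment> \<open>Conjugation by $s_1$ and $s_2$ permutes the following three elements.\<close>
  let ?W = "{?x, ?y, ?r}"
  have a: "conj_by (s 1) ?x = ?x" by (simp only: conj_by_commutes) (simp add: commutes_pow)
  have b: "conj_by (s 1) ?r = ?y"
  proof -
    have "conj_by (s 1) ?r = conj_by ?x ?y" by (simp only: conj_by_conj_by power2_eq_square)
    also have "\<dots> = ?y" using xy by (rule iffD2[OF conj_by_commutes])
    finally show ?thesis .
  qed
  have c: "conj_by (s 2) ?y = ?y" by (simp only: conj_by_commutes) (simp add: commutes_pow)
  have "conj_by (s 2) ?x = conj_by (inverse (s 1)) ?y"
    using braid_conj(1)[OF braid12] by (simp only: conj_by_pow)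
  moreover have "conj_by (inverse (s 1)) ?y = ?r"
    by (rule conj_by_inv_eq[OF b])
  ultimately have d: "conj_by (s 2) ?x = ?r" by simp
  have e: "conj_by (s 2) ?r = ?x"
  proof -
    have "conj_by (s 2) ?r = conj_by ?y ?x" unfolding d[symmetric] by (simp only: conj_by_conj_by power2_eq_square)
    also have "\<dots> = ?x" using commutes_sym[OF xy] by (rule iffD2[OF conj_by_commutes])
    finally show ?thesis .
  qed
  have W1: "conj_by (s 1) ` ?W = ?W" by (simp only: image_insert image_empty a b) blast
  have W2: "conj_by (s 2) ` ?W = ?W" by (simp only: image_insert image_empty c d e) blast
  have inv_image: "conj_by (inverse g) ` S = S" if "conj_by g ` S = S" for g and S :: "'g set"
  proof -
    have "conj_by (inverse g) ` S = conj_by (inverse g) ` conj_by g ` S" by (simp only: that)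
    also have "\<dots> = S" by (simp only: image_image conj_by_cancel image_ident)
    finally show ?thesis .
  qed
  have W: "conj_by g ` ?W = ?W" if "word s {1, 2} g k" for g k
    using that
  proof (induction rule: word.induct)
    case one show ?case by (simp only: conj_by_one image_ident)
  next
    case (gen g k i)
    have "conj_by (s i) ` ?W = ?W" using gen.hyps(2) W1 W2 by (elim insertE emptyE) (simp_all only:)
    then have "conj_by g ` conj_by (s i) ` ?W = ?W" using gen.IH by (simp only:)
    then show ?case by (simp only: image_image conj_by_conj_by)
  next
    case (inv g k i)
    have "conj_by (inverse (s i)) ` ?W = ?W"
      using inv.hyps(2) inv_image[OF W1] inv_image[OF W2] by (elim insertE emptyE) (simp_all only:)
    then have "conj_by g ` conj_by (inverse (s i)) ` ?W = ?W" using inv.IH by (simp only:)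
    then show ?case by (simp only: image_image conj_by_conj_by)
  qed
  have w2: "word s {1, 2} w 2" if "w \<in> ?W" for w
  proof -
    have "word s {1, 2} ?x 2" "word s {1, 2} ?y 2" "word s {1, 2} (s 1) 1"
      using word_pow[OF word_gen(1), of 1 "{1,2}" s 2] word_pow[OF word_gen(1), of 2 "{1,2}" s 2] word_gen(1)[of 1 "{1,2}" s] by simp_all
    with word_conj[of s "{1,2}" ?y 2 "s 1" 1] have "word s {1, 2} ?r 2" by simp
    with \<open>word s {1, 2} ?x 2\<close> \<open>word s {1, 2} ?y 2\<close> show ?thesis
      using that by (elim insertE emptyE) (simp_all only:)
  qed
  have t: "word s {4..<n} ?t (- 2)" using word_inv[OF word_pow[OF word_gen(1), of 4 "{4..<n}" s 2]] n_eq by simp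
  have WM: "w * ?t \<in> blocks" if "w \<in> ?W" for w
    using w2[OF that] t unfolding blocks_def by blast
  \<comment> \<open>The factor $s_4^{-2}$ brings their exponent sum to zero without changing how they are permuted.\<close>
  let ?U = "(\<lambda>w. f (w * ?t)) ` ?W"
  have U1: "?U \<subseteq> carrier H"
    using f_closed[OF subsetD[OF blocks_D WM]] by (rule image_subsetI)
  have U2: "g \<otimes> u \<otimes> inv g \<in> ?U" if gu: "g \<in> carrier H" "u \<in> ?U" for g u
  proof -
    obtain y where y: "y \<in> blocks" "g = f y" using gu(1) full by blast
    obtain w where w: "w \<in> ?W" "u = f (w * ?t)" using gu(2) by blast
    obtain b p j where b: "word s {1, 2} b j" "word s {4..<n} p (- j)" "y = b * p"
      using y(1) unfolding blocks_def by blast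
    have pw: "conj_by p w = w"
      by (rule iffD2[OF conj_by_commutes]) (rule commutes_sym[OF blocks_commute[OF w2[OF w(1)] b(2)]])
    have "commutes (s 4) p" using b(2) by (rule word_commutes) (simp add: last_block)
    then have "commutes (s 4) y"
      unfolding b(3) using commutes_mult[OF commutes_sym[OF block12_commutes[OF b(1), of 4]]] n_eq by simp
    then have yt: "conj_by y ?t = ?t"
      by (intro iffD2[OF conj_by_commutes] commutes_inv commutes_pow) (rule commutes_sym)
    have "conj_by y (w * ?t) = conj_by b w * ?t"
      unfolding conj_by_mult yt by (simp only: b(3) conj_by_conj_by[symmetric] pw)
    then have "g \<otimes> u \<otimes> inv g = f (conj_by b w * ?t)"
      using f_conj[OF subsetD[OF blocks_D WM[OF w(1)]] subsetD[OF blocks_D y(1)]] y(2) w(2) by simp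
    moreover have "conj_by b w \<in> ?W" using W[OF b(1)] w(1) by blast
    ultimately show ?thesis by blast
  qed
  let ?v = "?x * ?t"
  have vM: "?v \<in> blocks" by (rule WM) blast
  have vD: "?v \<in> D" using vM blocks_D by blast
  have v1: "f ?v \<noteq> \<one>"
  proof
    assume "f ?v = \<one>"
    then have "?v = 1" using detect[OF vD, of 4] blocks_commutes_s4[OF vM] n_eq by simp
    then have "?v * s 4 ^ 2 = s 4 ^ 2" by simp
    then have "?x = s 4 ^ 2" by (simp add: mult.assoc left_inv)
    then have "commutes ?x (s (Suc 1))" using commutes_pow'[OF c4s(2), of 2] by (simp only: Suc_1)
    then have "central_power 2" using n_eq by (intro central_power_if_commutes[of 1 2]) simp_all
    then show False using not_central2 by simp
  qed
  have xW: "commutes ?x w" if "w \<in> ?W" for w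
  proof -
    have "commutes ?x ?r" using xy a commutes_conj[of "s 1" ?x ?y] by simp
    then show ?thesis using that xy by (elim insertE emptyE) simp_all
  qed
  have vU: "f ?v \<otimes> u = u \<otimes> f ?v" if u: "u \<in> ?U" for u
  proof -
    obtain w where w: "w \<in> ?W" "u = f (w * ?t)" using u by blast
    have tW: "commutes ?t w'" if "w' \<in> ?W" for w'
      using commutes_inv'[OF commutes_pow'[OF commutes_sym[OF block12_commutes[OF w2[OF that], of 4]]]] n_eq by simp
    have "commutes ?t ?x" by (rule tW) blast
    then have "commutes ?v (w * ?t)"
      by (intro commutes_mult[OF commutes_mult'[OF xW[OF w(1)] tW[OF w(1)]] commutes_mult'[OF commutes_sym commutes_refl]])
    then have "?v * (w * ?t) = (w * ?t) * ?v" by (simp only: commutes_def)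
    then show ?thesis
      using f_mult[OF vD subsetD[OF blocks_D WM[OF w(1)]]] f_mult[OF subsetD[OF blocks_D WM[OF w(1)]] vD] w(2) by simp
  qed
  have "f ?v = \<one>"
  proof (rule central_trivial)
    show "f ?v \<in> carrier H" using f_closed[OF vD] .
    fix g assume g: "g \<in> carrier H"
    have "f ?v \<in> ?U" by blast
    from H.centralizer_of_invariant_set[OF U1 U2 f_closed[OF vD] v1 vU g this]
    show "f ?v \<otimes> g = g \<otimes> f ?v" by simp
  qed
  with v1 show False by simp
qed

text \<open>
  Exponents of central powers are closed under differences. Reducing $20$ modulo $3$ or $6$ leaves
  $2$, and reducing it modulo $7$ leaves $6$ and thus $7 - 6 = 1$; the exponents $1, 2, 4, 5$ have
  been excluded.
\<close>

lemma not_central_small: "0 < k \<Longrightarrow> k < 8 \<Longrightarrow> \<not> central_power k"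
proof
  assume k: "0 < k" "k < 8" and c: "central_power k"
  have "central_power (20 - k * (20 div k))"
    using central_power_diff[OF central_power_mult[OF c, of "20 div k"], of "20 - k * (20 div k)"] central_power_20 by (simp add: mult.commute)
  moreover have "k = 1 \<or> k = 2 \<or> k = 3 \<or> k = 4 \<or> k = 5 \<or> k = 6 \<or> k = 7" using k by linarith
  moreover have "central_power 6 \<Longrightarrow> central_power 7 \<Longrightarrow> central_power 1" using central_power_diff[of 6 1] by simp
  ultimately show False
    using c not_central1 not_central2 not_central4 not_central5 by (elim disjE) (simp_all add: One_nat_def)
qed

text \<open>
  The powers of $s_2s_4^{-1}$ and of $s_1s_4^{-1}$ below the eighth are told apart by their
  commutation with $s_1$ and $s_2$.
\<close>

lemma card_block_image_64: "64 \<le> card (f ` blocks)"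
proof -
  let ?u = "s 2 * inverse (s 4)"
  have 24: "commutes (s 2) (inverse (s 4))" and 41: "commutes (s 4) (s 1)" and 42: "commutes (s 4) (s 2)"
    using commutes_inv[OF far[of 2 4]] far'[of 1 4] far'[of 2 4] n_eq by simp_all
  have n24: "\<not> commutes (?u ^ k) (s 1)" if "0 < k" "k < 8" for k
  proof
    assume "commutes (?u ^ k) (s 1)"
    from commutes_mult'[OF this commutes_inv'[OF commutes_pow'[OF commutes_inv'[OF 41], of k]]]
    have "commutes (s 2 ^ k) (s 1)"
      unfolding commutes_mult_power[OF 24] by (simp add: mult.assoc right_inv)
    then have "central_power k" using n_eq by (intro central_power_if_commutes'[of 1 k]) (simp_all add: Suc_1)
    then show False using not_central_small that by blast
  qed
  have n14: "\<not> commutes (u14 ^ k) (s 2)" if "0 < k" "k < 8" for k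
    using u14_power_commutes not_central_small[OF that] by blast
  let ?B = "(\<lambda>(j, a). u14 ^ j * a) ` ({..<8} \<times> {1})"
  have B: "card ?B = 8 * card {1::'g}" "finite ?B"
    by (rule card_power_mult[where w = "s 2"], use n14 in simp_all)+
  have "commutes u14 (s 1)" using commutes_mult'[OF commutes_refl commutes_inv'[OF 41]] .
  then have B1: "commutes b (s 1)" if "b \<in> ?B" for b
    using that commutes_pow' by auto
  let ?A = "(\<lambda>(j, a). ?u ^ j * a) ` ({..<8} \<times> ?B)"
  have A: "card ?A = 8 * card ?B" "finite ?A"
    by (rule card_power_mult[OF B(2) B1 n24]; assumption)+
  have "word s {1, 2} (s 2) 1" "word s {4..<n} (inverse (s 4)) (- 1)"
    using word_gen(1)[of 2 "{1,2}" s] word_gen(2)[of 4 "{4..<n}" s] n_eq by simp_all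
  then have u: "?u \<in> blocks" unfolding blocks_def by blast
  have "?A \<subseteq> blocks"
  proof (rule image_subsetI, clarify)
    fix j i show "?u ^ j * (u14 ^ i * 1) \<in> blocks"
      using blocks_mult[OF blocks_power[OF u] blocks_power[OF u14_acts_like_s1(2)]] by simp
  qed
  from card_subset_block[OF this] show ?thesis using A(1) B(1) by simp
qed

end

text \<open>
  A proper image of the blocks, of at least $16$ elements, has an index that is at most three and
  too small for $16k \<le> k!$. If the blocks cover $H$, there are at least $64$ elements.
\<close>

lemma order_large_5: "\<not> order H \<le> fact n div 2"
proof
  assume o: "order H \<le> fact n div 2"
  then have o60: "order H \<le> 60" by (simp add: n_eq fact_numeral)
  show False
  proof (cases "f ` blocks = carrier H")
    case True
    have "64 \<le> order H" using card_block_image_64[OF True] True by (simp add: order_def)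
    then show False using o60 by simp
  next
    case False
    obtain k where k: "0 < k" "k * card (f ` blocks) \<le> 60" "k * card (f ` blocks) \<le> fact k"
      using order_bound_by_subgroup[OF blocks_subgroup False o60] .
    have "k * 16 \<le> k * card (f ` blocks)" using card_block_image_5 by simp
    then have k16: "k * 16 \<le> 60" "k * 16 \<le> fact k" using k(2,3) by linarith+
    then have "k = 1 \<or> k = 2 \<or> k = 3" using k(1) by linarith
    then show False using k16(2) by (elim disjE) (simp_all add: fact_numeral)
  qed
qed

end

theorem order_large: "n \<in> {5, 6, 7, 8} \<Longrightarrow> order H > fact n div 2"
  using order_large_5 order_large_6 order_large_7 order_large_8 by (elim insertE emptyE) (simp_all add: not_le)

end

section \<open>Permutations as a group type, and the bound for involutive generators\<close>

text \<open>
  The permutations of a type, to make the group in which the braid group acts an instance of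
  \<open>grp\<close>.
\<close>

typedef 'a bijection = "{p :: 'a \<Rightarrow> 'a. bij p}"
  by (rule exI[of _ id]) simp

setup_lifting type_definition_bijection

instantiation bijection :: (type) monoid_mult
begin

lift_definition one_bijection :: "'a bijection" is id by simp
lift_definition times_bijection :: "'a bijection \<Rightarrow> 'a bijection \<Rightarrow> 'a bijection" is "(\<circ>)" by (rule bij_comp)

instance
proof
  fix a b c :: "'a bijection"
  show "a * b * c = a * (b * c)" by transfer (rule comp_assoc)
  show "1 * a = a" "a * 1 = a" by (transfer, simp)+
qed

end

instantiation bijection :: (type) inverse
begin

lift_definition inverse_bijection :: "'a bijection \<Rightarrow> 'a bijection" is "inv_into UNIV" by (rule bij_imp_bij_inv)
definition divide_bijection :: "'a bijection \<Rightarrow> 'a bijection \<Rightarrow> 'a bijection" where "divide_bijection a b = a * inverse b"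

instance ..

end

instance bijection :: (type) grp
proof
  fix a :: "'a bijection"
  show "inverse a * a = 1" by transfer (simp add: bij_is_inj)
qed

context braided begin

text \<open>
  Candidates $s_m s_{m-1} \<cdots> s_{m-j+1}$ for representatives of the cosets of the subgroup
  generated by the first $m - 1$ involutions in that generated by the first $m$.
\<close>

fun coset_rep :: "nat \<Rightarrow> nat \<Rightarrow> 'g" where
  "coset_rep m 0 = 1"
| "coset_rep m (Suc j) = coset_rep m j * s (m - j)"

context
  assumes involution: "\<And>i. 1 \<le> i \<Longrightarrow> i < n \<Longrightarrow> s i * s i = 1"
begin

lemma coset_rep_commutes:
  assumes "1 \<le> i" "m < n" "i + j < m" shows "commutes (s i) (coset_rep m j)"
  using assms(3) by (induction j) (auto intro!: commutes_mult far simp: assms(1,2) less_imp_diff_less less_diff_conv)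

lemma coset_rep_shift:
  assumes "i \<le> m" "m < n" "j \<le> m" "m + 1 < i + j"
  shows "coset_rep m j * s i = s (i - 1) * coset_rep m j"
  using assms(3,4)
proof (induction j)
  case (Suc j)
  show ?case
  proof (cases "m + 1 < i + j")
    case True
    have "commutes (s (m - j)) (s i)"
      using True Suc.prems assms by (intro far) auto
    then have "coset_rep m (Suc j) * s i = (coset_rep m j * s i) * s (m - j)"
      by (simp add: commutes_def mult.assoc)
    also have "coset_rep m j * s i = s (i - 1) * coset_rep m j"
      using True Suc.prems by (intro Suc.IH) auto
    finally show ?thesis by (simp add: mult.assoc)
  next
    case False
    define k where "k = i - 1"
    have i: "i = Suc k" "1 \<le> k" "m - j = k" "j = Suc (m - i)" "m - (m - i) = Suc k"
      using False Suc.prems assms unfolding k_def by auto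
    let ?r = "coset_rep m (m - i)"
    have r: "coset_rep m (Suc j) = ?r * s (Suc k) * s k"
      using i by (simp add: i(4))
    have "coset_rep m (Suc j) * s i = ?r * (s (Suc k) * s k * s (Suc k))"
      unfolding r i(1) by (simp add: mult.assoc)
    also have "\<dots> = ?r * (s k * s (Suc k) * s k)"
      using braid[of k] i assms by simp
    also have "\<dots> = s k * coset_rep m (Suc j)"
      using coset_rep_commutes[of k m "m - i"] i assms unfolding r by (simp add: commutes_def flip: mult.assoc)
    finally show ?thesis unfolding i(1) by simp
  qed
qed (use assms(1) in simp)

text \<open>
  Multiplying a representative by a generator gives a representative again, up to a factor in the
  smaller subgroup: the generator passes through, prolongs it, cancels its last letter, or passes
  with its index lowered.
\<close>

lemma coset_rep_closed:
  assumes "1 \<le> i" "i \<le> m" "m < n" "j \<le> m"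
  shows "\<exists>x k l. word s {1..<m} x k \<and> l \<le> m \<and> coset_rep m j * s i = x * coset_rep m l"
proof -
  consider "i + j < m" | "i + j = m" | "i + j = m + 1" | "m + 1 < i + j" by linarith
  then show ?thesis
  proof cases
    case 1
    then have "coset_rep m j * s i = s i * coset_rep m j"
      using coset_rep_commutes[of i m j] assms by (simp add: commutes_def)
    moreover have "word s {1..<m} (s i) 1" using 1 assms by (intro word_gen) auto
    ultimately show ?thesis using assms(4) by blast
  next
    case 2
    then have "coset_rep m j * s i = 1 * coset_rep m (Suc j)" "Suc j \<le> m" using assms by auto
    then show ?thesis using word.one by blast
  next
    case 3
    then obtain l where l: "j = Suc l" "m - l = i" using assms by (cases j) auto
    have "coset_rep m j * s i = 1 * coset_rep m l"
      using involution[of i] assms l by (simp add: mult.assoc)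
    moreover have "l \<le> m" using l assms by simp
    ultimately show ?thesis using word.one by blast
  next
    case 4
    then have "coset_rep m j * s i = s (i - 1) * coset_rep m j"
      using assms by (intro coset_rep_shift) auto
    moreover have "word s {1..<m} (s (i - 1)) 1" using 4 assms by (intro word_gen) auto
    ultimately show ?thesis using assms(4) by blast
  qed
qed

lemma coxeter_step:
  assumes "1 \<le> m" "m < n" "word s {1..<Suc m} y k"
  shows "\<exists>x l j. word s {1..<m} x l \<and> j \<le> m \<and> y = x * coset_rep m j"
  using assms(3)
proof (induction rule: word.induct)
  case one
  then show ?case using word.one[of s "{1..<m}"] by (intro exI[of _ 1] exI[of _ 0]) simp
next
  case (gen y k i)
  then obtain x l j where x: "word s {1..<m} x l" "j \<le> m" "y = x * coset_rep m j" by blast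
  obtain x' k' l' where x': "word s {1..<m} x' k'" "l' \<le> m" "coset_rep m j * s i = x' * coset_rep m l'"
    using coset_rep_closed[of i m j] gen.hyps(2) assms(1,2) x(2) by auto
  have "y * s i = x * x' * coset_rep m l'" unfolding x(3) using x'(3) by (simp add: mult.assoc)
  then show ?case using word_mult[OF x'(1) x(1)] x'(2) by blast
next
  case (inv y k i)
  then obtain x l j where x: "word s {1..<m} x l" "j \<le> m" "y = x * coset_rep m j" by blast
  obtain x' k' l' where x': "word s {1..<m} x' k'" "l' \<le> m" "coset_rep m j * s i = x' * coset_rep m l'"
    using coset_rep_closed[of i m j] inv.hyps(2) assms(1,2) x(2) by auto
  have "s i * s i = 1" using involution[of i] inv.hyps(2) assms by simp
  then have "inverse (s i) * (s i * s i) = inverse (s i)" by simp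
  then have "inverse (s i) = s i" by (simp only: left_cancel)
  then have "y * inverse (s i) = x * x' * coset_rep m l'" unfolding x(3) using x'(3) by (simp add: mult.assoc)
  then show ?case using word_mult[OF x'(1) x(1)] x'(2) by blast
qed

text \<open>
  By induction, there are at most $m + 1$ cosets in the step from $m$ to $m + 1$.
\<close>

lemma coxeter_card:
  assumes "1 \<le> m" "m \<le> n"
  shows "finite {x. \<exists>k. word s {1..<m} x k} \<and> card {x. \<exists>k. word s {1..<m} x k} \<le> fact m"
  using assms
proof (induction m rule: dec_induct)
  case base
  have "x = 1" if "word s {1..<1} x k" for x k
    using that by (induction rule: word.induct) auto
  then have sub: "{x. \<exists>k. word s {1..<1} x k} \<subseteq> {1}" by blast
  have "finite {x. \<exists>k. word s {1..<1} x k}" "card {x. \<exists>k. word s {1..<1} x k} \<le> card {1::'g}"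
    using finite_subset[OF sub] card_mono[OF _ sub] by simp_all
  then show ?case by simp
next
  case (step m)
  let ?W = "\<lambda>m. {x. \<exists>k. word s {1..<m} x k}"
  have fin: "finite (?W m)" and card: "card (?W m) \<le> fact m" using step by auto
  have sub: "?W (Suc m) \<subseteq> (\<lambda>(x, j). x * coset_rep m j) ` (?W m \<times> {..m})"
  proof
    fix y assume "y \<in> ?W (Suc m)"
    then obtain k where "word s {1..<Suc m} y k" by blast
    from coxeter_step[OF _ _ this] obtain x l j where "word s {1..<m} x l" "j \<le> m" "y = x * coset_rep m j"
      using step.hyps step.prems by auto
    then show "y \<in> (\<lambda>(x, j). x * coset_rep m j) ` (?W m \<times> {..m})" by auto
  qed
  have "card (?W (Suc m)) \<le> card (?W m \<times> {..m})"
    using sub fin by (intro surj_card_le) auto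
  also have "\<dots> = card (?W m) * Suc m" by (simp add: card_cartesian_product)
  also have "\<dots> \<le> fact m * Suc m" using card by (intro mult_le_mono1)
  finally have "card (?W (Suc m)) \<le> fact (Suc m)" by (simp add: mult.commute)
  moreover have "finite (?W (Suc m))" using finite_subset[OF sub] fin by simp
  ultimately show ?case by simp
qed

end

end

section \<open>Presentation, exponent sum and commutator subgroup of the braid group\<close>

definition braid_gen :: "nat \<Rightarrow> nat \<Rightarrow> braid_word set" where
  "braid_gen n i = braid_rel n `` {[(i, True)]}"

context
  fixes n :: nat and G :: "braid_word set monoid"
  defines "G \<equiv> braid_group n"
begin

interpretation G: group G
  unfolding G_def by (rule group_braid_group)

lemma braid_carrier: "x \<in> carrier G \<longleftrightarrow> (\<exists>w\<in>braid_words n. x = braid_rel n `` {w})"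
  unfolding G_def braid_group_def by (auto simp: quotient_def)

lemma braid_class_mult:
  "u \<in> braid_words n \<Longrightarrow> v \<in> braid_words n \<Longrightarrow> braid_rel n `` {u} \<otimes>\<^bsub>G\<^esub> braid_rel n `` {v} = braid_rel n `` {u @ v}"
  unfolding G_def by (rule braid_mult_class)

lemma braid_one: "\<one>\<^bsub>G\<^esub> = braid_rel n `` {[]}"
  unfolding G_def braid_group_def by simp

lemma braid_class_eq: "(u, v) \<in> braid_rel n \<Longrightarrow> braid_rel n `` {u} = braid_rel n `` {v}"
  by (rule equiv_class_eq[OF equiv_braid_rel])

lemma letter_in_words: "1 \<le> i \<Longrightarrow> i < n \<Longrightarrow> [(i, b)] \<in> braid_words n"
  by (simp add: braid_words_def)

lemma words_append: "u @ v \<in> braid_words n \<longleftrightarrow> u \<in> braid_words n \<and> v \<in> braid_words n"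
  by (simp add: braid_words_def)

lemma braid_gen_closed: "1 \<le> i \<Longrightarrow> i < n \<Longrightarrow> braid_gen n i \<in> carrier G"
  unfolding braid_carrier braid_gen_def using letter_in_words by blast

lemma braid_gen_inv:
  assumes "1 \<le> i" "i < n" shows "inv\<^bsub>G\<^esub> braid_gen n i = braid_rel n `` {[(i, False)]}"
proof (rule G.inv_equality)
  have "([(i, False), (i, \<not> False)], []) \<in> braid_rel n" using assms by (intro braid_rel.cancel) simp
  then show "braid_rel n `` {[(i, False)]} \<otimes>\<^bsub>G\<^esub> braid_gen n i = \<one>\<^bsub>G\<^esub>"
    unfolding braid_gen_def braid_one using braid_class_mult[OF letter_in_words[OF assms] letter_in_words[OF assms]] braid_class_eq
    by simp
  show "braid_gen n i \<in> carrier G" by (rule braid_gen_closed[OF assms])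
  show "braid_rel n `` {[(i, False)]} \<in> carrier G"
    unfolding braid_carrier using letter_in_words[OF assms] by blast
qed

lemma braid_gen_commute:
  assumes "1 \<le> i" "i + 2 \<le> j" "j < n"
  shows "braid_gen n i \<otimes>\<^bsub>G\<^esub> braid_gen n j = braid_gen n j \<otimes>\<^bsub>G\<^esub> braid_gen n i"
proof -
  have "([(i, True), (j, True)], [(j, True), (i, True)]) \<in> braid_rel n"
    using assms by (intro braid_rel.commute) auto
  moreover have w: "[(i, True)] \<in> braid_words n" "[(j, True)] \<in> braid_words n"
    using assms by (auto intro!: letter_in_words)
  ultimately show ?thesis
    unfolding braid_gen_def using braid_class_mult[OF w(1,2)] braid_class_mult[OF w(2,1)] braid_class_eq by simp
qed

lemma braid_gen_braid:
  assumes "1 \<le> i" "Suc i < n"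
  shows "braid_gen n i \<otimes>\<^bsub>G\<^esub> braid_gen n (Suc i) \<otimes>\<^bsub>G\<^esub> braid_gen n i
    = braid_gen n (Suc i) \<otimes>\<^bsub>G\<^esub> braid_gen n i \<otimes>\<^bsub>G\<^esub> braid_gen n (Suc i)"
proof -
  have "([(i, True), (Suc i, True), (i, True)], [(Suc i, True), (i, True), (Suc i, True)]) \<in> braid_rel n"
    using assms by (intro braid_rel.braid) auto
  note r = braid_class_eq[OF this]
  have w: "[(i, True)] \<in> braid_words n" "[(Suc i, True)] \<in> braid_words n"
    using assms by (auto intro!: letter_in_words)
  then have "[(i, True), (Suc i, True)] \<in> braid_words n" "[(Suc i, True), (i, True)] \<in> braid_words n"
    by (simp_all add: braid_words_def)
  with w show ?thesis
    unfolding braid_gen_def using r by (simp add: braid_class_mult)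
qed

lemma braid_induct [consumes 1, case_names one gen inv]:
  assumes "x \<in> carrier G" "P \<one>\<^bsub>G\<^esub>"
    and "\<And>x i. x \<in> carrier G \<Longrightarrow> P x \<Longrightarrow> 1 \<le> i \<Longrightarrow> i < n \<Longrightarrow> P (x \<otimes>\<^bsub>G\<^esub> braid_gen n i)"
    and "\<And>x i. x \<in> carrier G \<Longrightarrow> P x \<Longrightarrow> 1 \<le> i \<Longrightarrow> i < n \<Longrightarrow> P (x \<otimes>\<^bsub>G\<^esub> inv\<^bsub>G\<^esub> braid_gen n i)"
  shows "P x"
proof -
  have "P (braid_rel n `` {w})" if "w \<in> braid_words n" for w
    using that
  proof (induction w rule: rev_induct)
    case Nil then show ?case using assms(2) by (simp add: braid_one)
  next
    case (snoc a w)
    obtain i b where a: "a = (i, b)" by force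
    have w: "w \<in> braid_words n" and i: "1 \<le> i" "i < n"
      using snoc.prems by (auto simp: a braid_words_def)
    have x: "braid_rel n `` {w} \<in> carrier G" unfolding braid_carrier using w by blast
    have "braid_rel n `` {w @ [a]} = braid_rel n `` {w} \<otimes>\<^bsub>G\<^esub> braid_rel n `` {[a]}"
      using braid_class_mult[OF w, of "[a]"] letter_in_words[OF i] a by simp
    also have "braid_rel n `` {[a]} = (if b then braid_gen n i else inv\<^bsub>G\<^esub> braid_gen n i)"
      using braid_gen_inv[OF i] by (simp add: a braid_gen_def)
    finally show ?case using assms(3,4)[OF x snoc.IH[OF w] i] by simp
  qed
  then show ?thesis using assms(1) unfolding braid_carrier by blast
qed

text \<open>
  The universal property of the presentation: words are evaluated letter by letter, and the
  evaluation respects each defining relation.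
\<close>

lemma braid_lift:
  fixes Y :: "('b, 'c) monoid_scheme" (structure)
  assumes "group Y" and t: "\<And>i. 1 \<le> i \<Longrightarrow> i < n \<Longrightarrow> t i \<in> carrier Y"
    and far: "\<And>i j. 1 \<le> i \<Longrightarrow> i + 2 \<le> j \<Longrightarrow> j < n \<Longrightarrow> t i \<otimes> t j = t j \<otimes> t i"
    and br: "\<And>i. 1 \<le> i \<Longrightarrow> Suc i < n \<Longrightarrow> t i \<otimes> t (Suc i) \<otimes> t i = t (Suc i) \<otimes> t i \<otimes> t (Suc i)"
  obtains h where "h \<in> hom G Y" "\<And>i. 1 \<le> i \<Longrightarrow> i < n \<Longrightarrow> h (braid_gen n i) = t i"
proof -
  interpret Y: group Y by (rule assms)
  define l where "l = (\<lambda>(i::nat, b). if b then t i else inv t i)"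
  define v where "v = (\<lambda>w. foldr (\<lambda>a y. l a \<otimes> y) w \<one>)"
  have l: "l (i, b) \<in> carrier Y" if "1 \<le> i" "i < n" for i b using t[OF that] by (simp add: l_def)
  have v_closed: "v w \<in> carrier Y" if "w \<in> braid_words n" for w
    using that unfolding v_def by (induction w) (auto simp: braid_words_def intro!: l)
  have v_append: "v (w @ u) = v w \<otimes> v u" if "w \<in> braid_words n" "u \<in> braid_words n" for w u
    using that
  proof (induction w)
    case Nil then show ?case using v_closed[of u] by (simp add: v_def)
  next
    case (Cons a w)
    have w: "w \<in> braid_words n" and a: "l a \<in> carrier Y"
      using Cons.prems(1) l by (auto simp: braid_words_def)
    have "v ((a # w) @ u) = l a \<otimes> v (w @ u)" "v (a # w) = l a \<otimes> v w" by (simp_all add: v_def)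
    then show ?case using Cons.IH[OF w Cons.prems(2)] v_closed[OF w] v_closed[OF Cons.prems(2)] a by (simp add: Y.m_assoc)
  qed
  have v_rel: "v w = v u" if "(w, u) \<in> braid_rel n" for w u
    using that
  proof (induction rule: braid_rel.induct)
    case (append u u' w w')
    then show ?case using braid_rel_in_words[OF append.hyps(1)] braid_rel_in_words[OF append.hyps(2)] by (simp add: v_append)
  next
    case (cancel i b) then show ?case using t[of i] by (cases b) (auto simp: v_def l_def)
  next
    case (commute i j) then show ?case using t[of i] t[of j] far[of i j] by (simp add: v_def l_def)
  next
    case (braid i) then show ?case using t[of i] t[of "Suc i"] br[of i] by (simp add: v_def l_def Y.m_assoc)
  qed simp_all
  define h where "h U = v (SOME w. w \<in> U)" for U
  have h: "h (braid_rel n `` {w}) = v w" if "w \<in> braid_words n" for w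
  proof -
    have "w \<in> braid_rel n `` {w}" using braid_rel.refl[OF that] by simp
    then have "(SOME u. u \<in> braid_rel n `` {w}) \<in> braid_rel n `` {w}" by (rule someI)
    then show ?thesis unfolding h_def using v_rel by simp
  qed
  have "h \<in> hom G Y"
  proof (rule homI)
    fix x y assume "x \<in> carrier G" "y \<in> carrier G"
    then obtain w u where wu: "w \<in> braid_words n" "x = braid_rel n `` {w}" "u \<in> braid_words n" "y = braid_rel n `` {u}"
      unfolding braid_carrier by blast
    then show "h x \<in> carrier Y" using h v_closed by simp
    show "h (x \<otimes>\<^bsub>G\<^esub> y) = h x \<otimes> h y"
      using wu words_append by (simp add: braid_class_mult h v_append)
  qed
  moreover have "h (braid_gen n i) = t i" if "1 \<le> i" "i < n" for i
    unfolding braid_gen_def h[OF letter_in_words[OF that]] using t[OF that] by (simp add: v_def l_def)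
  ultimately show thesis using that by blast
qed

lemma braid_hom_unique:
  fixes Y :: "('b, 'c) monoid_scheme" (structure)
  assumes "group Y" "h \<in> hom G Y" "k \<in> hom G Y" "\<And>i. 1 \<le> i \<Longrightarrow> i < n \<Longrightarrow> h (braid_gen n i) = k (braid_gen n i)"
    and "x \<in> carrier G"
  shows "h x = k x"
proof -
  interpret h: group_hom G Y h using assms by (intro group_hom.intro G.is_group group_hom_axioms.intro)
  interpret k: group_hom G Y k using assms by (intro group_hom.intro G.is_group group_hom_axioms.intro)
  show ?thesis using assms(5)
    by (induction rule: braid_induct) (simp_all add: assms(4) braid_gen_closed)
qed

lemma braid_exponent_sum:
  obtains e where "e \<in> hom G integer_group" "\<And>i. 1 \<le> i \<Longrightarrow> i < n \<Longrightarrow> e (braid_gen n i) = 1"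
proof (rule braid_lift[of integer_group "\<lambda>_. 1"])
  fix h :: "braid_word set \<Rightarrow> int"
  assume "h \<in> hom G integer_group" "\<And>i. 1 \<le> i \<Longrightarrow> i < n \<Longrightarrow> h (braid_gen n i) = 1"
  then show thesis by (rule that)
qed simp_all

text \<open>
  In the abelianisation all generators become equal by the braid relation, so that a braid is
  determined there by its exponent sum.
\<close>

lemma braid_derived_kernel:
  assumes n: "2 \<le> n" and e: "e \<in> hom G integer_group" "\<And>i. 1 \<le> i \<Longrightarrow> i < n \<Longrightarrow> e (braid_gen n i) = 1"
  shows "derived G (carrier G) = {x \<in> carrier G. e x = 0}"
proof -
  interpret e: group_hom G integer_group e using e by (intro group_hom.intro G.is_group group_hom_axioms.intro) simp_all
  let ?D = "derived G (carrier G)"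
  interpret D: normal ?D G by (rule G.derived_self_is_normal)
  show ?thesis
  proof
    have "subgroup {x \<in> carrier G. e x = 0} G"
      using e.subgroup_kernel by (simp add: kernel_def)
    moreover have "derived_set G (carrier G) \<subseteq> {x \<in> carrier G. e x = 0}" by auto
    ultimately show "?D \<subseteq> {x \<in> carrier G. e x = 0}"
      unfolding derived_def by (intro G.generate_subgroup_incl)
  next
    let ?Q = "G Mod ?D"
    interpret Q: comm_group ?Q by (rule G.derived_quot_is_comm_group)
    let ?q = "\<lambda>x. ?D #>\<^bsub>G\<^esub> x"
    have q: "?q \<in> hom G ?Q" by (rule D.r_coset_hom_Mod)
    interpret q: group_hom G ?Q ?q using q by (intro group_hom.intro G.is_group Q.is_group group_hom_axioms.intro)
    have gens: "?q (braid_gen n i) = ?q (braid_gen n 1)" if "1 \<le> i" "i < n" for i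
      using that
    proof (induction i rule: dec_induct)
      case (step i)
      let ?a = "?q (braid_gen n i)" and ?b = "?q (braid_gen n (Suc i))"
      have ab: "?a \<in> carrier ?Q" "?b \<in> carrier ?Q"
        using step braid_gen_closed by (intro q.hom_closed; simp)+
      have "?q (braid_gen n i \<otimes>\<^bsub>G\<^esub> braid_gen n (Suc i) \<otimes>\<^bsub>G\<^esub> braid_gen n i)
        = ?q (braid_gen n (Suc i) \<otimes>\<^bsub>G\<^esub> braid_gen n i \<otimes>\<^bsub>G\<^esub> braid_gen n (Suc i))"
        using braid_gen_braid[of i] step by simp
      then have "?a \<otimes>\<^bsub>?Q\<^esub> ?b \<otimes>\<^bsub>?Q\<^esub> ?a = ?b \<otimes>\<^bsub>?Q\<^esub> ?a \<otimes>\<^bsub>?Q\<^esub> ?b"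
        using step braid_gen_closed[of i] braid_gen_closed[of "Suc i"] by (simp only: q.hom_mult G.m_closed)
      then have "(?a \<otimes>\<^bsub>?Q\<^esub> ?b) \<otimes>\<^bsub>?Q\<^esub> ?a = (?a \<otimes>\<^bsub>?Q\<^esub> ?b) \<otimes>\<^bsub>?Q\<^esub> ?b"
        using Q.m_comm[OF ab] by simp
      then have "?a = ?b" using Q.l_cancel[OF _ ab(1) ab(2) Q.m_closed[OF ab]] by simp
      then show ?case using step by simp
    qed simp
    let ?k = "\<lambda>x. ?q (braid_gen n 1) [^]\<^bsub>?Q\<^esub> (e x)"
    have g1: "?q (braid_gen n 1) \<in> carrier ?Q" using n by (intro q.hom_closed braid_gen_closed) auto
    have "?k \<in> hom G ?Q"
    proof (rule homI)
      fix x y assume x: "x \<in> carrier G" and y: "y \<in> carrier G"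
      show "?k x \<in> carrier ?Q" using g1 by (rule Q.int_pow_closed)
      have "e (x \<otimes>\<^bsub>G\<^esub> y) = e x + e y" using e.hom_mult[OF x y] by simp
      then show "?k (x \<otimes>\<^bsub>G\<^esub> y) = ?k x \<otimes>\<^bsub>?Q\<^esub> ?k y" using Q.int_pow_mult[OF g1] by (simp only:)
    qed
    moreover have "?q (braid_gen n i) = ?k (braid_gen n i)" if "1 \<le> i" "i < n" for i
      unfolding e(2)[OF that] Q.int_pow_1[OF g1] by (rule gens[OF that])
    ultimately have qk: "?q x = ?k x" if "x \<in> carrier G" for x
      using that by (rule braid_hom_unique[OF Q.is_group q])
    show "{x \<in> carrier G. e x = 0} \<subseteq> ?D"
    proof clarify
      fix x assume x: "x \<in> carrier G" "e x = 0"
      have "?q x = ?D" unfolding qk[OF x(1)] x(2) by (simp add: FactGroup_def)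
      then show "x \<in> ?D" using x(1) by (rule G.coset_join1) (rule D.subgroup_axioms)
    qed
  qed
qed

end

section \<open>The permutation of a braid\<close>

lemma adjacent_transposition_far:
  "i + 2 \<le> j \<Longrightarrow> transpose i (Suc i) \<circ> transpose j (Suc j) = transpose j (Suc j) \<circ> transpose (i::nat) (Suc i)"
  by (auto simp: fun_eq_iff transpose_def)

lemma adjacent_transposition_braid:
  "transpose i (Suc i) \<circ> transpose (Suc i) (Suc (Suc i)) \<circ> transpose i (Suc i)
    = transpose (Suc i) (Suc (Suc i)) \<circ> transpose (i::nat) (Suc i) \<circ> transpose (Suc i) (Suc (Suc i))"
  by (auto simp: fun_eq_iff transpose_def)

lemma braid_permutation:
  obtains p where "p \<in> hom (braid_group n) (sym_group n)"
    "\<And>i. 1 \<le> i \<Longrightarrow> i < n \<Longrightarrow> p (braid_gen n i) = transpose i (Suc i)"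
proof (rule braid_lift[of "sym_group n" n "\<lambda>i. transpose i (Suc i)"])
  show "group (sym_group n)" by (rule sym_group_is_group)
  show "transpose i (Suc i) \<in> carrier (sym_group n)" if "1 \<le> i" "i < n" for i
    using that by (auto simp: sym_group_carrier intro: permutes_swap_id)
  show "transpose i (Suc i) \<otimes>\<^bsub>sym_group n\<^esub> transpose j (Suc j) = transpose j (Suc j) \<otimes>\<^bsub>sym_group n\<^esub> transpose i (Suc i)"
    if "i + 2 \<le> j" for i j
    using adjacent_transposition_far[OF that] by (simp only: sym_group_mult)
qed (simp_all only: sym_group_mult adjacent_transposition_braid that)

text \<open>
  The exponent sum and the permutation of a braid, as the homomorphisms determined by their values
  on the generators.
\<close>

locale braid_invariants =
  fixes n :: nat and expo :: "braid_word set \<Rightarrow> int" and perm :: "braid_word set \<Rightarrow> nat \<Rightarrow> nat"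
  assumes n5: "5 \<le> n"
    and expo_hom: "expo \<in> hom (braid_group n) integer_group"
    and expo_gen: "\<And>i. 1 \<le> i \<Longrightarrow> i < n \<Longrightarrow> expo (braid_gen n i) = 1"
    and perm_hom: "perm \<in> hom (braid_group n) (sym_group n)"
    and perm_gen: "\<And>i. 1 \<le> i \<Longrightarrow> i < n \<Longrightarrow> perm (braid_gen n i) = transpose i (Suc i)"
begin

abbreviation B :: "braid_word set monoid" where "B \<equiv> braid_group n"
abbreviation B' :: "braid_word set set" where "B' \<equiv> derived B (carrier B)"
abbreviation C :: "braid_word set monoid" where "C \<equiv> braid_commutator_group n"
abbreviation gen :: "nat \<Rightarrow> braid_word set" where "gen \<equiv> braid_gen n"

sublocale B: group B by (rule group_braid_group)

sublocale expo: group_hom B integer_group expo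
  using expo_hom by (intro group_hom.intro B.is_group group_hom_axioms.intro) simp_all

sublocale perm: group_hom B "sym_group n" perm
  using perm_hom by (intro group_hom.intro B.is_group sym_group_is_group group_hom_axioms.intro)

lemmas gen_closed = braid_gen_closed[of _ n]

lemma expo_inv: "x \<in> carrier B \<Longrightarrow> expo (inv\<^bsub>B\<^esub> x) = - expo x"
  and expo_one: "expo \<one>\<^bsub>B\<^esub> = 0"
  using expo.hom_inv[of x] expo.hom_one by simp_all

lemma perm_mult: "x \<in> carrier B \<Longrightarrow> y \<in> carrier B \<Longrightarrow> perm (x \<otimes>\<^bsub>B\<^esub> y) = perm x \<circ> perm y"
  using perm.hom_mult[of x y] by (simp add: sym_group_mult)

lemma perm_one: "perm \<one>\<^bsub>B\<^esub> = id"
  using perm.hom_one by (simp add: sym_group_one)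

lemma perm_permutes: "x \<in> carrier B \<Longrightarrow> perm x permutes {1..n}"
  using perm.hom_closed[of x] by (simp add: sym_group_carrier)

lemma perm_inv: "x \<in> carrier B \<Longrightarrow> perm (inv\<^bsub>B\<^esub> x) = inv_into UNIV (perm x)"
  using perm.hom_inv[of x] perm.hom_closed[of x] sym_group_inv_equality[of "perm x" n] by simp

lemma derived_eq: "B' = {x \<in> carrier B. expo x = 0}"
  using n5 expo_gen by (intro braid_derived_kernel expo_hom) auto

lemma perm_permutation: "x \<in> carrier B \<Longrightarrow> permutation (perm x)"
  using perm_permutes permutation_permutes by blast

lemma perm_parity: "x \<in> carrier B \<Longrightarrow> evenperm (perm x) \<longleftrightarrow> even (expo x)"
proof (induction rule: braid_induct)
  case one then show ?case by (simp add: perm_one[unfolded sym_group_one] expo_one sym_group_one)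
next
  case (gen x i)
  have "evenperm (perm x \<circ> transpose i (Suc i)) \<longleftrightarrow> \<not> evenperm (perm x)"
    using evenperm_comp[OF perm_permutation[OF gen(1)] permutation_swap_id[of i "Suc i"]]
    by (simp add: evenperm_swap)
  moreover have "perm (x \<otimes>\<^bsub>B\<^esub> gen i) = perm x \<circ> transpose i (Suc i)"
    using gen gen_closed[of i] perm_mult[OF gen(1), of "gen i"] by (simp add: perm_gen)
  moreover have "expo (x \<otimes>\<^bsub>B\<^esub> gen i) = expo x + 1"
    using gen gen_closed[of i] by (simp add: expo_gen)
  ultimately show ?case using gen.IH by (simp only: even_add odd_one simp_thms)
next
  case (inv x i)
  have "evenperm (perm x \<circ> transpose i (Suc i)) \<longleftrightarrow> \<not> evenperm (perm x)"
    using evenperm_comp[OF perm_permutation[OF inv(1)] permutation_swap_id[of i "Suc i"]]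
    by (simp add: evenperm_swap)
  moreover have "perm (x \<otimes>\<^bsub>B\<^esub> inv\<^bsub>B\<^esub> gen i) = perm x \<circ> transpose i (Suc i)"
    using inv gen_closed[of i] perm_mult[OF inv(1), of "inv\<^bsub>B\<^esub> gen i"] perm_inv[of "gen i"] by (simp add: perm_gen)
  moreover have "expo (x \<otimes>\<^bsub>B\<^esub> inv\<^bsub>B\<^esub> gen i) = expo x - 1"
    using inv gen_closed[of i] by (simp add: expo_gen)
  ultimately show ?case using inv.IH by (simp only: even_diff even_add odd_one simp_thms)
qed

lemma transposition_in_image:
  assumes "1 \<le> a" "a < b" "b \<le> n" shows "transpose a b \<in> perm ` carrier B"
  using assms(2,3)
proof (induction b)
  case (Suc b)
  show ?case
  proof (cases "b = a")
    case True
    then show ?thesis using Suc.prems assms(1) perm_gen[of a] gen_closed[of a]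
      by (intro image_eqI[of _ _ "gen a"]) auto
  next
    case False
    then obtain x where x: "x \<in> carrier B" "perm x = transpose a b" using Suc by auto
  have g: "gen b \<in> carrier B" "perm (gen b) = transpose b (Suc b)"
    using Suc.prems assms by (auto intro!: gen_closed perm_gen)
  have "transpose a (Suc b) = transpose b (Suc b) \<circ> transpose a b \<circ> transpose b (Suc b)"
    using Suc.prems False by (auto simp: fun_eq_iff transpose_def)
  also have "\<dots> = perm (gen b \<otimes>\<^bsub>B\<^esub> x \<otimes>\<^bsub>B\<^esub> gen b)"
    using x g by (simp add: sym_group_mult)
  finally show ?thesis using x g by blast
  qed
qed simp

lemma perm_onto: "perm ` carrier B = carrier (sym_group n)"
proof
  show "perm ` carrier B \<subseteq> carrier (sym_group n)" using perm.hom_closed by blast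
  show "carrier (sym_group n) \<subseteq> perm ` carrier B"
  proof
    fix q assume "q \<in> carrier (sym_group n)"
    then have "q permutes {1..n}" by (simp add: sym_group_carrier)
    then show "q \<in> perm ` carrier B" using finite_atLeastAtMost
    proof (induction rule: permutes_induct)
      case id
      then show ?case using perm_one by force
    next
      case (swap a b q)
      then obtain x where x: "x \<in> carrier B" "q = perm x" by blast
      have "transpose a b \<in> perm ` carrier B"
      proof (cases "a < b")
        case True
        then show ?thesis using swap.hyps(1,2) by (intro transposition_in_image) auto
      next
        case False
        then have "transpose b a \<in> perm ` carrier B" using swap.hyps(1-3) by (intro transposition_in_image) auto
        then show ?thesis by (simp only: transpose_commute[of a b])
      qed
      then obtain y where y: "y \<in> carrier B" "transpose a b = perm y" by blast
      show ?case unfolding x(2) y(2) perm_mult[OF y(1) x(1), symmetric] using x y by blast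
    qed
  qed
qed

text \<open>
  An even permutation comes from a braid of even exponent sum, which is brought to exponent sum zero
  by a power of $\<sigma>_1^2$, a pure braid.
\<close>

lemma perm_derived: "perm ` B' = carrier (alt_group n)"
proof
  show "perm ` B' \<subseteq> carrier (alt_group n)"
    using perm_parity perm_permutes by (auto simp: derived_eq alt_group_carrier)
  show "carrier (alt_group n) \<subseteq> perm ` B'"
  proof
    fix q assume "q \<in> carrier (alt_group n)"
    then have q: "q permutes {1..n}" "evenperm q" by (simp_all add: alt_group_carrier)
    then have "q \<in> perm ` carrier B" unfolding perm_onto by (simp add: sym_group_carrier)
    then obtain x where x: "x \<in> carrier B" "q = perm x" by blast
    then have "even (expo x)" using q(2) perm_parity[OF x(1)] by simp
    then obtain k where k: "expo x = 2 * k" by (rule evenE)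
    have g: "gen 1 \<in> carrier B" using n5 by (intro gen_closed) auto
    let ?g = "gen 1 \<otimes>\<^bsub>B\<^esub> gen 1"
    have pg: "perm ?g = id" "expo ?g = 2"
      using g n5 by (simp_all add: sym_group_mult perm_gen expo_gen)
    have "perm (?g [^]\<^bsub>B\<^esub> j) = id" for j :: int
      using perm.hom_int_pow[of ?g j] g group.int_pow_one[OF sym_group_is_group, of n j] pg(1)
      by (simp add: sym_group_one)
    moreover have "expo (?g [^]\<^bsub>B\<^esub> j) = 2 * j" for j :: int
      using expo.hom_int_pow[of ?g j] g pg(2) by (simp add: mult.commute)
    ultimately have "perm (x \<otimes>\<^bsub>B\<^esub> ?g [^]\<^bsub>B\<^esub> (- k)) = q" "expo (x \<otimes>\<^bsub>B\<^esub> ?g [^]\<^bsub>B\<^esub> (- k)) = 0"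
      using x g k by (simp_all add: sym_group_mult)
    then show "q \<in> perm ` B'" using x g by (intro image_eqI[of _ _ "x \<otimes>\<^bsub>B\<^esub> ?g [^]\<^bsub>B\<^esub> (- k)"]) (simp_all add: derived_eq)
  qed
qed

end

section \<open>The braid group acting on cosets\<close>

definition coset_perm :: "('a, 'm) monoid_scheme \<Rightarrow> 'a set \<Rightarrow> 'a \<Rightarrow> 'a set bijection" where
  "coset_perm G K g = Abs_bijection (coset_action G K g)"

context group begin

lemma Rep_coset_perm:
  assumes "subgroup K G" "g \<in> carrier G" shows "Rep_bijection (coset_perm G K g) = coset_action G K g"
proof -
  have "bij (coset_action G K g)" using coset_action_permutes[OF assms] by (rule permutes_bij)
  then show ?thesis unfolding coset_perm_def by (intro Abs_bijection_inverse) simp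
qed

lemma coset_perm_mult:
  assumes "subgroup K G" "g \<in> carrier G" "h \<in> carrier G"
  shows "coset_perm G K (g \<otimes> h) = coset_perm G K g * coset_perm G K h"
  using coset_action_mult[OF assms]
  by (simp add: Rep_bijection_inject[symmetric] times_bijection.rep_eq Rep_coset_perm[OF assms(1)] assms)

lemma coset_perm_one: "subgroup K G \<Longrightarrow> coset_perm G K \<one> = 1"
  by (simp add: Rep_bijection_inject[symmetric] one_bijection.rep_eq Rep_coset_perm coset_action_one)

lemma coset_perm_inv:
  assumes "subgroup K G" "g \<in> carrier G"
  shows "coset_perm G K (inv g) = inverse (coset_perm G K g)"
proof -
  have "coset_perm G K (inv g) * coset_perm G K g = 1"
    using assms coset_perm_mult[of K "inv g" g] coset_perm_one by simp
  also have "\<dots> = inverse (coset_perm G K g) * coset_perm G K g" by (simp add: left_inv)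
  finally show ?thesis by (simp add: mult_right_eq)
qed

lemma coset_perm_eq_one_iff:
  assumes "subgroup K G" "g \<in> carrier G"
  shows "coset_perm G K g = 1 \<longleftrightarrow> (\<forall>x\<in>carrier G. x \<otimes> g \<otimes> inv x \<in> K)"
proof
  assume "coset_perm G K g = 1"
  then have "coset_action G K g = id" using Rep_coset_perm[OF assms] by (simp add: one_bijection.rep_eq)
  then show "\<forall>x\<in>carrier G. x \<otimes> g \<otimes> inv x \<in> K" using coset_action_eq_id[OF assms] by blast
next
  assume "\<forall>x\<in>carrier G. x \<otimes> g \<otimes> inv x \<in> K"
  then have "coset_action G K g = id" by (intro coset_action_id assms) blast
  then show "coset_perm G K g = 1" by (simp add: Rep_bijection_inject[symmetric] one_bijection.rep_eq Rep_coset_perm[OF assms])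
qed

lemma coset_perm_eqD:
  assumes "subgroup K G" "x \<in> carrier G" "y \<in> carrier G" "coset_perm G K x = coset_perm G K y"
  shows "x \<otimes> inv y \<in> K"
proof -
  have "coset_perm G K (x \<otimes> inv y) = 1"
    using assms by (simp add: coset_perm_mult coset_perm_inv right_inv)
  then have "\<one> \<otimes> (x \<otimes> inv y) \<otimes> inv \<one> \<in> K"
    using assms coset_perm_eq_one_iff[OF assms(1), of "x \<otimes> inv y"] one_closed by blast
  then show ?thesis using assms by simp
qed

end

context braid_invariants begin

context
  fixes K assumes K: "subgroup K B"
begin

abbreviation s :: "nat \<Rightarrow> braid_word set set bijection" where "s i \<equiv> coset_perm B K (gen i)"

lemma coset_braided: "braided s n"
proof
  show "5 \<le> n" by (rule n5)
  show "s i * s (Suc i) * s i = s (Suc i) * s i * s (Suc i)" if "1 \<le> i" "Suc i < n" for i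
    using braid_gen_braid[OF that] that gen_closed[of i] gen_closed[of "Suc i"]
    by (simp add: B.coset_perm_mult[OF K, symmetric])
  show "commutes (s i) (s j)" if "1 \<le> i" "i + 2 \<le> j" "j < n" for i j
    using braid_gen_commute[OF that] that gen_closed[of i] gen_closed[of j]
    by (simp add: commutes_def B.coset_perm_mult[OF K, symmetric])
qed

lemma coset_perm_word: "x \<in> carrier B \<Longrightarrow> word s {1..<n} (coset_perm B K x) (expo x)"
proof (induction rule: braid_induct)
  case one then show ?case using expo_one by (simp add: K B.coset_perm_one word.one del: expo.hom_one)
next
  case (gen x i)
  then show ?case using word.gen[of s "{1..<n}" _ _ i] gen_closed[of i]
    by (simp add: B.coset_perm_mult[OF K] expo_gen)
next
  case (inv x i)
  then show ?case using word.inv[of s "{1..<n}" _ _ i] gen_closed[of i]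
    by (simp add: B.coset_perm_mult[OF K] B.coset_perm_inv[OF K] expo_gen)
qed

lemma word_lift: "word s {1..<n} y k \<Longrightarrow> \<exists>x\<in>carrier B. coset_perm B K x = y \<and> expo x = k"
proof (induction rule: word.induct)
  case one then show ?case using B.coset_perm_one[OF K] expo_one by (intro bexI[of _ "\<one>\<^bsub>B\<^esub>"]) auto
next
  case (gen y k i)
  then obtain x where "x \<in> carrier B" "coset_perm B K x = y" "expo x = k" by blast
  then show ?case using gen.hyps(2) gen_closed[of i]
    by (intro bexI[of _ "x \<otimes>\<^bsub>B\<^esub> gen i"]) (simp_all add: B.coset_perm_mult[OF K] expo_gen)
next
  case (inv y k i)
  then obtain x where "x \<in> carrier B" "coset_perm B K x = y" "expo x = k" by blast
  then show ?case using inv.hyps(2) gen_closed[of i]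
    by (intro bexI[of _ "x \<otimes>\<^bsub>B\<^esub> inv\<^bsub>B\<^esub> gen i"])
      (simp_all add: B.coset_perm_mult[OF K] B.coset_perm_inv[OF K] expo_gen)
qed

end

lemma commutator_group_eq: "C = B\<lparr>carrier := B'\<rparr>"
  by (simp add: braid_commutator_group_def)

lemma derived_subgroup: "subgroup B' B"
  using B.derived_self_is_normal normal_imp_subgroup by blast

lemma derived_closed: "x \<in> B' \<Longrightarrow> x \<in> carrier B"
  by (simp add: derived_eq)

lemma C_group: "group C"
  unfolding commutator_group_eq by (rule B.subgroup_imp_group[OF derived_subgroup])

lemma C_simps: "carrier C = B'" "x \<otimes>\<^bsub>C\<^esub> y = x \<otimes>\<^bsub>B\<^esub> y" "\<one>\<^bsub>C\<^esub> = \<one>\<^bsub>B\<^esub>"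
  "A #>\<^bsub>C\<^esub> x = A #>\<^bsub>B\<^esub> x"
  by (simp_all add: commutator_group_eq r_coset_def)

lemma C_inv: "x \<in> B' \<Longrightarrow> inv\<^bsub>C\<^esub> x = inv\<^bsub>B\<^esub> x"
  unfolding commutator_group_eq using B.m_inv_consistent[OF derived_subgroup] by simp

lemma conj_expo: "x \<in> carrier B \<Longrightarrow> y \<in> carrier B \<Longrightarrow> expo (x \<otimes>\<^bsub>B\<^esub> y \<otimes>\<^bsub>B\<^esub> inv\<^bsub>B\<^esub> x) = expo y"
  by simp

text \<open>
  Division by the power of $\<sigma>_i$ with the same exponent sum leaves an element of the
  commutator subgroup.
\<close>

lemma derived_times_gen:
  assumes "y \<in> carrier B" "1 \<le> i" "i < n"
  obtains y0 m where "y0 \<in> B'" "y = y0 \<otimes>\<^bsub>B\<^esub> gen i [^]\<^bsub>B\<^esub> (m :: int)"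
proof -
  have g: "gen i \<in> carrier B" using assms gen_closed by simp
  let ?y0 = "y \<otimes>\<^bsub>B\<^esub> gen i [^]\<^bsub>B\<^esub> (- expo y)"
  have "expo (gen i [^]\<^bsub>B\<^esub> k) = k" for k :: int
    using expo.hom_int_pow[OF g, of k] assms expo_gen by simp
  then have "?y0 \<in> B'" using assms g by (simp add: derived_eq)
  moreover have "y = ?y0 \<otimes>\<^bsub>B\<^esub> gen i [^]\<^bsub>B\<^esub> expo y"
    using assms(1) g B.int_pow_mult[OF g, of "- expo y" "expo y"] by (simp add: B.m_assoc)
  ultimately show thesis by (rule that)
qed

end

section \<open>Simple quotients with different generator squares\<close>

context braid_invariants begin

context
  fixes K assumes K: "K \<lhd> C"
begin

interpretation K: normal K C by (rule K)

lemma K_sub: "K \<subseteq> B'"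
  using K.subset by (simp add: C_simps)

lemma K_subgroup: "subgroup K B"
  using B.incl_subgroup[OF derived_subgroup] K.subgroup_axioms by (simp add: commutator_group_eq)

lemma K_conj: "x \<in> B' \<Longrightarrow> k \<in> K \<Longrightarrow> x \<otimes>\<^bsub>B\<^esub> k \<otimes>\<^bsub>B\<^esub> inv\<^bsub>B\<^esub> x \<in> K"
  using K.inv_op_closed2[of x k] by (simp add: C_simps C_inv)

lemma coset_eqI:
  assumes "x \<in> carrier B" "y \<in> carrier B" "coset_perm B K x = coset_perm B K y"
  shows "K #>\<^bsub>B\<^esub> x = K #>\<^bsub>B\<^esub> y"
proof -
  have "x \<otimes>\<^bsub>B\<^esub> inv\<^bsub>B\<^esub> y \<in> K" using B.coset_perm_eqD[OF K_subgroup assms] .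
  then have "x \<in> K #>\<^bsub>B\<^esub> y"
    using assms subgroup.rcos_module_rev[OF K_subgroup B.is_group] by simp
  then show ?thesis using B.repr_independence[OF _ assms(2) K_subgroup] by simp
qed

text \<open>
  To act trivially, $x$ needs all its conjugates in $K$. Write the conjugating braid as
  $y_0\<sigma>_i^m$ with $y_0 \<in> B_n'$. The action does not see conjugation by $\<sigma>_i^m$, so
  this conjugate lies in $K$, and $y_0$ normalises $K$.
\<close>

lemma coset_perm_detects:
  assumes "x \<in> K" "1 \<le> i" "i < n" "commutes (coset_perm B K x) (coset_perm B K (gen i))"
  shows "coset_perm B K x = 1"
proof -
  have x: "x \<in> carrier B" and g: "gen i \<in> carrier B"
    using assms K_sub derived_closed gen_closed by auto
  have "y \<otimes>\<^bsub>B\<^esub> x \<otimes>\<^bsub>B\<^esub> inv\<^bsub>B\<^esub> y \<in> K" if y: "y \<in> carrier B" for y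
  proof -
    obtain y0 m where y0: "y0 \<in> B'" "y = y0 \<otimes>\<^bsub>B\<^esub> gen i [^]\<^bsub>B\<^esub> (m :: int)"
      using derived_times_gen[OF y assms(2,3)] by blast
    let ?h = "gen i [^]\<^bsub>B\<^esub> m"
    have h: "?h \<in> carrier B" using g by simp
    have pow: "coset_perm B K (gen i [^]\<^bsub>B\<^esub> (k::nat)) = coset_perm B K (gen i) ^ k" for k
      using g by (induction k) (simp_all add: B.coset_perm_one[OF K_subgroup] B.coset_perm_mult[OF K_subgroup] power_commutes)
    have "commutes (coset_perm B K x) (coset_perm B K ?h)"
    proof (cases m)
      case (nonneg k)
      then show ?thesis using commutes_pow[OF assms(4)] pow by (simp add: int_pow_int)
    next
      case (neg k)
      then have "?h = inv\<^bsub>B\<^esub> (gen i [^]\<^bsub>B\<^esub> Suc k)" using g by (simp only: B.int_pow_neg_int)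
      then show ?thesis using commutes_inv[OF commutes_pow[OF assms(4)]] g
        by (simp only: pow B.coset_perm_inv[OF K_subgroup B.nat_pow_closed])
    qed
    then have "coset_perm B K (?h \<otimes>\<^bsub>B\<^esub> x \<otimes>\<^bsub>B\<^esub> inv\<^bsub>B\<^esub> ?h) = coset_perm B K x"
      using h x by (simp add: conj_by_commutes commutes_commute[of "coset_perm B K x"] B.coset_perm_mult[OF K_subgroup] B.coset_perm_inv[OF K_subgroup] flip: conj_by_def)
    then have "K #>\<^bsub>B\<^esub> (?h \<otimes>\<^bsub>B\<^esub> x \<otimes>\<^bsub>B\<^esub> inv\<^bsub>B\<^esub> ?h) = K #>\<^bsub>B\<^esub> x"
      using h x by (intro coset_eqI) simp_all
    also have "\<dots> = K" using assms(1) x by (intro B.coset_join2 K_subgroup)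
    finally have "?h \<otimes>\<^bsub>B\<^esub> x \<otimes>\<^bsub>B\<^esub> inv\<^bsub>B\<^esub> ?h \<in> K"
      using h x by (intro B.coset_join1[OF _ _ K_subgroup]) (simp_all add: subgroup.subset[OF K_subgroup])
    from K_conj[OF y0(1) this] show ?thesis
      using h x derived_closed[OF y0(1)] by (simp add: y0(2) B.inv_mult_group B.m_assoc)
  qed
  then show ?thesis using B.coset_perm_eq_one_iff[OF K_subgroup x] by blast
qed

text \<open>
  Cosets of $K$ depend only on the action, which yields a map $f$ from the permutation group to
  $B_n'/K$ that satisfies the assumptions of \<open>simple_quotient\<close>.
\<close>

lemma quotient_large:
  fixes s defines "s \<equiv> \<lambda>i. coset_perm B K (gen i)"
  assumes n: "n \<in> {5, 6, 7, 8}" and simple: "simple_group (C Mod K)" and fin: "finite (carrier (C Mod K))"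
    and sq: "s 1 ^ 2 \<noteq> s 2 ^ 2"
  shows "order (C Mod K) > fact n div 2"
proof -
  interpret braided s n unfolding s_def by (rule coset_braided[OF K_subgroup])
  interpret Q: simple_group "C Mod K" by (rule simple)
  define f where "f x = K #>\<^bsub>B\<^esub> (SOME g. g \<in> B' \<and> coset_perm B K g = x)" for x
  have f: "f (coset_perm B K g) = K #>\<^bsub>B\<^esub> g" if "g \<in> B'" for g
  proof -
    have "(SOME h. h \<in> B' \<and> coset_perm B K h = coset_perm B K g) \<in> B'
        \<and> coset_perm B K (SOME h. h \<in> B' \<and> coset_perm B K h = coset_perm B K g) = coset_perm B K g"
      by (rule someI_ex) (use that in blast)
    then show ?thesis unfolding f_def using that derived_closed by (intro coset_eqI) auto
  qed
  have lift: "\<exists>g\<in>B'. coset_perm B K g = x" if "word s {1..<n} x 0" for x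
    using word_lift[OF K_subgroup that[unfolded s_def]] by (auto simp: derived_eq)
  have image_word: "word s {1..<n} (coset_perm B K g) 0" if "g \<in> B'" for g
    using coset_perm_word[OF K_subgroup, of g] that unfolding s_def by (auto simp: derived_eq)
  have "simple_quotient s n (C Mod K) f"
  proof unfold_locales
    show "finite (carrier (C Mod K))" by (rule fin)
    show "\<not> central_power 2" using sq by (simp add: central_power_def)
  next
    fix x y assume "x \<in> {x. word s {1..<n} x 0}" "y \<in> {x. word s {1..<n} x 0}"
    then obtain g h where g: "g \<in> B'" "x = coset_perm B K g" and h: "h \<in> B'" "y = coset_perm B K h"
      using lift by blast
    have "x * y = coset_perm B K (g \<otimes>\<^bsub>B\<^esub> h)"
      using g h derived_closed by (simp add: B.coset_perm_mult[OF K_subgroup])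
    then have "f (x * y) = K #>\<^bsub>C\<^esub> (g \<otimes>\<^bsub>C\<^esub> h)"
      using f g(1) h(1) subgroup.m_closed[OF derived_subgroup] by (simp add: C_simps)
    also have "\<dots> = (K #>\<^bsub>C\<^esub> g) <#>\<^bsub>C\<^esub> (K #>\<^bsub>C\<^esub> h)"
      using g(1) h(1) by (intro K.rcos_sum[symmetric]) (simp_all add: C_simps)
    finally show "f (x * y) = f x \<otimes>\<^bsub>C Mod K\<^esub> f y"
      using f g h by (simp add: C_simps)
  next
    show "f ` {x. word s {1..<n} x 0} = carrier (C Mod K)"
    proof -
      have "{x. word s {1..<n} x 0} = coset_perm B K ` B'" using lift image_word by blast
      then have "f ` {x. word s {1..<n} x 0} = (\<lambda>g. K #>\<^bsub>B\<^esub> g) ` B'"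
        using f by (simp add: image_image)
      then show ?thesis by (simp add: carrier_FactGroup C_simps)
    qed
  next
    fix x i assume "x \<in> {x. word s {1..<n} x 0}" and i: "1 \<le> i" "i < n" "commutes x (s i)" "f x = \<one>\<^bsub>C Mod K\<^esub>"
    then obtain g where g: "g \<in> B'" "x = coset_perm B K g" using lift by blast
    have "K #>\<^bsub>B\<^esub> g = K" using i(4) f g by simp
    then have "g \<in> K" using g(1) derived_closed
      by (intro B.coset_join1[OF _ _ K_subgroup]) (auto simp: subgroup.subset[OF K_subgroup])
    then show "x = 1" using coset_perm_detects[of g i] i(1,2,3) g(2) by (simp add: s_def)
  qed
  then interpret simple_quotient s n "C Mod K" f "{x. word s {1..<n} x 0}" by simp_all
  show ?thesis using n by (rule order_large)
qed

end

end

section \<open>Simple quotients with equal generator squares\<close>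

context braided begin

lemma word1_power:
  assumes "word s {1} w k" "k + int m = int m'" shows "w * s 1 ^ m = s 1 ^ m'"
  using assms
proof (induction arbitrary: m m' rule: word.induct)
  case one then show ?case by simp
next
  case (gen w k i)
  then show ?case using gen.IH[of "Suc m" m'] by (simp add: mult.assoc)
next
  case (inv w k i)
  have "w * s 1 ^ m = s 1 ^ Suc m'" using inv.IH[of m "Suc m'"] inv.prems by simp
  moreover have "(w * inverse (s i) * s 1 ^ m) * s 1 = w * s 1 ^ m"
    using inv.hyps(2) by (simp add: mult.assoc power_commutes left_cancel)
  ultimately have "(w * inverse (s i) * s 1 ^ m) * s 1 = s 1 ^ m' * s 1"
    by (simp add: power_commutes)
  then show ?case by (simp only: mult_right_eq)
qed

text \<open>
  If $s_1^2$ is central, a power of $s_1$ is central for even exponent, and becomes so after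
  multiplication by $s_1$ for odd exponent.
\<close>

lemma even_word1_central:
  assumes "central_power 2" "word s {1} w k" "1 \<le> j" "j < n"
  shows "if even k then commutes (s j) w else commutes (s j) (w * s 1)"
proof -
  have c: "commutes (s j) (s 1 * s 1)"
    using central_power_commutes[OF assms(1), of 1 j] assms(3,4) n5 by (simp add: power2_eq_square commutes_commute[of "s j"])
  show ?thesis using assms(2)
  proof (induction rule: word.induct)
    case one then show ?case by simp
  next
    case (gen w k i)
    then show ?case using commutes_mult[OF _ c, of w] by (auto simp: mult.assoc)
  next
    case (inv w k i)
    have "w * s 1 * inverse (s 1 * s 1) = w * inverse (s 1)" "w * inverse (s 1) * s 1 = w"
      by (simp_all add: grp_simps)
    then show ?case using inv commutes_mult[OF _ commutes_inv[OF c], of "w * s 1"] by auto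
  qed
qed

end

context braid_invariants begin

text \<open>
  Modulo $L$ the generators are involutions, so $B_n/L$ has at most $n!$ elements. Since $L$
  consists of pure braids it maps onto the symmetric group, so this map is injective.
\<close>

lemma pure_braids_in_involution_kernel:
  assumes L: "L \<lhd> B" and sq: "\<And>i. 1 \<le> i \<Longrightarrow> i < n \<Longrightarrow> gen i \<otimes>\<^bsub>B\<^esub> gen i \<in> L"
    and pure: "\<And>x. x \<in> L \<Longrightarrow> perm x = id"
    and x: "x \<in> carrier B" "perm x = id"
  shows "x \<in> L"
proof -
  interpret L: normal L B by (rule L)
  have Ls: "subgroup L B" by (rule L.subgroup_axioms)
  define t where "t i = coset_perm B L (gen i)" for i
  have t: "t = (\<lambda>i. coset_perm B L (gen i))" by (simp add: t_def fun_eq_iff)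
  interpret T: braided t n unfolding t by (rule coset_braided[OF Ls])
  have one_iff: "coset_perm B L y = 1" if "y \<in> L" for y
    using B.coset_perm_eq_one_iff[OF Ls, of y] L.inv_op_closed2[OF _ that] L.subset that by blast
  have inv: "t i * t i = 1" if "1 \<le> i" "i < n" for i
    using one_iff[OF sq[OF that]] gen_closed[OF that] by (simp add: t_def B.coset_perm_mult[OF Ls])
  let ?W = "coset_perm B L ` carrier B"
  have W: "?W \<subseteq> {y. \<exists>k. word t {1..<n} y k}"
    using coset_perm_word[OF Ls] unfolding t by blast
  have fin: "finite ?W" "card ?W \<le> fact n"
    using T.coxeter_card[of n, OF inv] n5 finite_subset[OF W] card_mono[OF _ W] by fastforce+
  \<comment> \<open>By the assumption on $L$, the permutation of a braid is determined by its action on the cosets of $L$.\<close>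
  define h where "h w = perm (SOME y. y \<in> carrier B \<and> coset_perm B L y = w)" for w
  have h: "h (coset_perm B L y) = perm y" if y: "y \<in> carrier B" for y
  proof -
    define z where "z = (SOME z. z \<in> carrier B \<and> coset_perm B L z = coset_perm B L y)"
    have z: "z \<in> carrier B \<and> coset_perm B L z = coset_perm B L y"
      unfolding z_def by (rule someI_ex) (use y in blast)
    then have "z \<otimes>\<^bsub>B\<^esub> inv\<^bsub>B\<^esub> y \<in> L" using B.coset_perm_eqD[OF Ls _ y] by blast
    from pure[OF this] have "perm ((z \<otimes>\<^bsub>B\<^esub> inv\<^bsub>B\<^esub> y) \<otimes>\<^bsub>B\<^esub> y) = perm y"
      using z y perm_mult[of "z \<otimes>\<^bsub>B\<^esub> inv\<^bsub>B\<^esub> y" y] by (simp only: B.m_closed B.inv_closed id_comp)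
    then have "perm z = perm y" using z y by (simp only: B.m_assoc B.inv_closed B.l_inv B.r_one)
    then show ?thesis unfolding h_def z_def .
  qed
  have "h ` ?W = carrier (sym_group n)"
    using h perm_onto by (simp add: image_image)
  then have "card (h ` ?W) = fact n" by (simp add: sym_group_card_carrier)
  moreover have "card (h ` ?W) \<le> card ?W" by (rule card_image_le[OF fin(1)])
  ultimately have "inj_on h ?W" using fin by (intro eq_card_imp_inj_on) auto
  moreover have "h (coset_perm B L x) = h (coset_perm B L \<one>\<^bsub>B\<^esub>)"
    using x h perm_one by (simp only: B.one_closed)
  ultimately have "coset_perm B L x = coset_perm B L \<one>\<^bsub>B\<^esub>"
    using x(1) by (intro inj_onD[of h ?W]) auto
  then show "x \<in> L" using B.coset_perm_eqD[OF Ls x(1) B.one_closed] x(1) by simp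
qed

text \<open>
  A pure braid has even exponent sum. If it acts as the power of $s_1$ with this exponent, it acts
  centrally, and so such braids form a normal subgroup. It contains the squares of generators, hence
  all pure braids; with exponent sum zero they act trivially and lie in $K$.
\<close>

lemma kernel_of_square_coincidence:
  fixes s K defines "s \<equiv> \<lambda>i. coset_perm B K (gen i)"
  assumes K: "K \<lhd> C" and sq: "s 1 ^ 2 = s 2 ^ 2" and x: "x \<in> B'" "perm x = id"
  shows "x \<in> K"
proof -
  have Ks: "subgroup K B" by (rule K_subgroup[OF K])
  interpret braided s n unfolding s_def by (rule coset_braided[OF Ks])
  have eq: "central_power 2" using sq by (simp add: central_power_def)
  let ?P = "coset_perm B K"
  define L where "L = {y \<in> carrier B. perm y = id \<and> word s {1} (?P y) (expo y)}"
  have central: "commutes g (?P y)" if "y \<in> L" "word s {1..<n} g k" for y g k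
  proof -
    have "even (expo y)" using perm_parity[of y] that(1) by (simp add: L_def)
    then have "commutes (s j) (?P y)" if "1 \<le> j" "j < n" for j
      using even_word1_central[OF eq _ that, of "?P y" "expo y"] \<open>y \<in> L\<close> by (simp add: L_def)
    then show ?thesis using word_commutes[OF that(2), of "?P y"] by (simp add: commutes_commute[of "?P y"])
  qed
  have "L \<lhd> B"
  proof (rule B.normal_invI)
    show "subgroup L B"
    proof (rule B.subgroupI)
      show "L \<subseteq> carrier B" by (auto simp: L_def)
      have "\<one>\<^bsub>B\<^esub> \<in> L" using perm_one expo_one B.coset_perm_one[OF Ks] word.one[of s "{1}"] by (simp only: L_def mem_Collect_eq B.one_closed simp_thms)
      then show "L \<noteq> {}" by blast
      fix y assume y: "y \<in> L"
      then show "inv\<^bsub>B\<^esub> y \<in> L" using word_inv[of s "{1}" "?P y" "expo y"] perm_inv[of y] expo_inv[of y]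
        by (simp add: L_def B.coset_perm_inv[OF Ks] del: perm.hom_inv)
      fix z assume z: "z \<in> L"
      show "y \<otimes>\<^bsub>B\<^esub> z \<in> L" using y z word_mult[of s "{1}" "?P z" "expo z" "?P y" "expo y"]
        by (simp add: L_def B.coset_perm_mult[OF Ks] sym_group_mult)
    qed
    fix g y assume g: "g \<in> carrier B" and y: "y \<in> L"
    then have yc: "y \<in> carrier B" by (simp add: L_def)
    have "?P (g \<otimes>\<^bsub>B\<^esub> y \<otimes>\<^bsub>B\<^esub> inv\<^bsub>B\<^esub> g) = conj_by (?P g) (?P y)"
      using g yc by (simp add: B.coset_perm_mult[OF Ks] B.coset_perm_inv[OF Ks] conj_by_def)
    also have "\<dots> = ?P y"
      using central[OF y coset_perm_word[OF Ks g, folded s_def]] by (simp add: conj_by_commutes)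
    finally have "?P (g \<otimes>\<^bsub>B\<^esub> y \<otimes>\<^bsub>B\<^esub> inv\<^bsub>B\<^esub> g) = ?P y" .
    moreover have "perm (g \<otimes>\<^bsub>B\<^esub> y \<otimes>\<^bsub>B\<^esub> inv\<^bsub>B\<^esub> g) = id"
    proof -
      have "perm (g \<otimes>\<^bsub>B\<^esub> y \<otimes>\<^bsub>B\<^esub> inv\<^bsub>B\<^esub> g) = perm g \<circ> perm y \<circ> inv_into UNIV (perm g)"
        using g yc perm_mult perm_inv by (simp only: B.m_closed B.inv_closed)
      then show ?thesis using y permutes_inv_o(1)[OF perm_permutes[OF g]] by (simp add: L_def)
    qed
    ultimately show "g \<otimes>\<^bsub>B\<^esub> y \<otimes>\<^bsub>B\<^esub> inv\<^bsub>B\<^esub> g \<in> L"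
      using y g conj_expo[OF g yc] by (simp only: L_def mem_Collect_eq B.m_closed B.inv_closed)
  qed
  moreover have "gen i \<otimes>\<^bsub>B\<^esub> gen i \<in> L" if i: "1 \<le> i" "i < n" for i
  proof -
    have g: "gen i \<in> carrier B" by (rule gen_closed[OF i])
    have "s i ^ 2 = s 1 ^ 2" using central_power_eq[OF eq, of i] i by simp
    then have "?P (gen i \<otimes>\<^bsub>B\<^esub> gen i) = s 1 * s 1"
      using g by (simp add: B.coset_perm_mult[OF Ks] power2_eq_square s_def)
    moreover have "word s {1} (s 1 * s 1) 2"
      using word_mult[OF word_gen(1) word_gen(1), of 1 "{1}" 1 s] by simp
    ultimately show ?thesis using g i by (simp add: L_def sym_group_mult perm_gen expo_gen)
  qed
  moreover have "perm y = id" if "y \<in> L" for y using that by (simp add: L_def)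
  ultimately have "x \<in> L"
    using derived_closed[OF x(1)] x(2) by (rule pure_braids_in_involution_kernel)
  moreover have "expo x = 0" using x(1) by (simp add: derived_eq)
  ultimately have "word s {1} (?P x) 0" by (simp add: L_def)
  from word1_power[OF this, of 0 0] have "?P x = ?P \<one>\<^bsub>B\<^esub>" by (simp add: B.coset_perm_one[OF Ks])
  then show "x \<in> K" using B.coset_perm_eqD[OF Ks derived_closed[OF x(1)] B.one_closed] derived_closed[OF x(1)] by simp
qed

text \<open>
  The image of $K$ in $A_n$ is normal. It is not all of $A_n$, since $K$ contains the kernel of
  $B_n' \<rightarrow> A_n$ and is proper. So it is trivial and $K$ is this kernel.
\<close>

lemma quotient_alternating:
  assumes K: "K \<lhd> C" "K \<noteq> carrier C" and pure: "\<And>x. x \<in> B' \<Longrightarrow> perm x = id \<Longrightarrow> x \<in> K"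
  shows "C Mod K \<cong> alt_group n"
proof -
  interpret K: normal K C by (rule K)
  have Ks: "subgroup K B" by (rule K_subgroup[OF K(1)])
  have K_sub: "K \<subseteq> B'" using K.subset by (simp add: C_simps)
  have hom: "perm \<in> hom C (alt_group n)"
    using perm_derived perm_mult derived_closed by (intro homI) (auto simp: C_simps alt_group_mult)
  interpret p: group_hom C "alt_group n" perm
    using hom by (intro group_hom.intro C_group alt_group_is_group group_hom_axioms.intro)
  have onto: "perm ` carrier C = carrier (alt_group n)" using perm_derived by (simp add: C_simps)
  have "perm ` K \<lhd> alt_group n"
    using K.surj_hom_normal_subgroup[OF p.group_hom_axioms onto] .
  moreover have "perm ` K \<noteq> carrier (alt_group n)"
  proof
    assume *: "perm ` K = carrier (alt_group n)"
    have "B' \<subseteq> K"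
    proof
      fix x assume x: "x \<in> B'"
      then have "perm x \<in> perm ` K" using * perm_derived by blast
      then obtain k where k: "k \<in> K" "perm x = perm k" by blast
      have kc: "k \<in> B'" "inv\<^bsub>B\<^esub> k \<in> B'" "k \<in> carrier B" "x \<in> carrier B"
        using k K_sub derived_closed x subgroup.m_inv_closed[OF derived_subgroup] by auto
      have "perm (x \<otimes>\<^bsub>B\<^esub> inv\<^bsub>B\<^esub> k) = perm k \<circ> inv_into UNIV (perm k)"
        using perm_mult perm_inv kc k(2) by (simp only: B.inv_closed)
      also have "\<dots> = id" by (rule permutes_inv_o(1)[OF perm_permutes[OF kc(3)]])
      finally have "x \<otimes>\<^bsub>B\<^esub> inv\<^bsub>B\<^esub> k \<in> K"
        using pure subgroup.m_closed[OF derived_subgroup x kc(2)] by blast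
      from subgroup.m_closed[OF Ks this k(1)] show "x \<in> K" using kc by (simp add: B.m_assoc)
    qed
    then show False using K(2) K_sub by (simp add: C_simps)
  qed
  ultimately have "perm ` K = {id}" using alt_group_normal_subgroup[OF n5] by blast
  then have "K = kernel C (alt_group n) perm"
    using pure K_sub by (auto simp: kernel_def alt_group_one C_simps)
  then show ?thesis using p.FactGroup_iso[OF onto] by simp
qed

lemma maximal_quotient:
  assumes "n \<in> {5, 6, 7, 8}" "K \<lhd> C" "simple_group (C Mod K)" "finite (carrier (C Mod K))"
  shows "C Mod K \<cong> alt_group n \<or> order (C Mod K) > fact n div 2"
proof (cases "coset_perm B K (gen 1) ^ 2 = coset_perm B K (gen 2) ^ 2")
  case True
  have "K \<noteq> carrier C"
  proof
    assume K: "K = carrier C"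
    have "carrier (C Mod K) = {K}"
      using group.coset_join2[OF C_group _ normal_imp_subgroup[OF assms(2)]] subgroup.one_closed[OF normal_imp_subgroup[OF assms(2)]]
      unfolding carrier_FactGroup K by auto
    then show False using simple_group.order_gt_one[OF assms(3)] by (simp add: order_def)
  qed
  then show ?thesis
    using quotient_alternating[OF assms(2)] kernel_of_square_coincidence[OF assms(2) True] by blast
next
  case False
  then show ?thesis using quotient_large[OF assms(2,1,3,4)] by blast
qed

end

section \<open>Reduction to simple quotients\<close>

context group begin

lemma normal_vimage:
  assumes "group_hom G H h" "M \<lhd> H"
  shows "{x \<in> carrier G. h x \<in> M} \<lhd> G"
proof -
  interpret h: group_hom G H h by (rule assms)
  interpret M: normal M H by (rule assms)
  show ?thesis
  proof (rule normal_invI)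
    show "subgroup {x \<in> carrier G. h x \<in> M} G"
      by (rule subgroupI) (auto intro!: exI[of _ \<one>])
    show "x \<otimes> y \<otimes> inv x \<in> {x \<in> carrier G. h x \<in> M}"
      if "x \<in> carrier G" "y \<in> {x \<in> carrier G. h x \<in> M}" for x y
      using that M.inv_op_closed2[of "h x" "h y"] by simp
  qed
qed

text \<open>
  For a maximal proper normal subgroup $N$, the preimage of a normal subgroup of the quotient lies
  between $N$ and the whole group.
\<close>

lemma ex_simple_quotient:
  assumes fin: "finite (carrier G)" and "carrier G \<noteq> {\<one>}"
  obtains N where "N \<lhd> G" "simple_group (G Mod N)"
proof -
  let ?S = "{N. N \<lhd> G \<and> N \<noteq> carrier G}"
  have "?S \<subseteq> Pow (carrier G)" using subgroup.subset normal_imp_subgroup by blast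
  then have "finite ?S" using fin finite_subset finite_Pow_iff by blast
  moreover have "{\<one>} \<in> ?S" using assms(2) one_is_normal by auto
  ultimately obtain N where N: "N \<in> ?S" and max: "\<And>M. M \<in> ?S \<Longrightarrow> N \<subseteq> M \<Longrightarrow> M = N"
    using finite_has_maximal2[of ?S "{\<one>}"] by auto
  interpret N: normal N G using N by simp
  interpret Q: group "G Mod N" by (rule N.factorgroup_is_group)
  have proj: "group_hom G (G Mod N) (\<lambda>x. N #> x)"
    using N.r_coset_hom_Mod by (intro group_hom.intro group_hom_axioms.intro is_group Q.is_group)
  have coset_N: "N #> x = N \<longleftrightarrow> x \<in> N" if "x \<in> carrier G" for x
    using that coset_join1[OF _ that N.subgroup_axioms] coset_join2[OF that N.subgroup_axioms] by blast
  have "simple_group (G Mod N)"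
  proof
    obtain x where x: "x \<in> carrier G" "x \<notin> N" using N N.subset by blast
    have "finite (carrier (G Mod N))" using fin by (simp add: carrier_FactGroup)
    moreover have "{N, N #> x} \<subseteq> carrier (G Mod N)"
      using x(1) Q.one_closed by (simp add: carrier_FactGroup)
    ultimately have "card {N, N #> x} \<le> order (G Mod N)" unfolding order_def by (rule card_mono)
    then show "1 < order (G Mod N)" using coset_N[OF x(1)] x(2) by (auto simp: card_insert_if split: if_splits)
  next
    fix M assume M: "M \<lhd> G Mod N"
    interpret M: normal M "G Mod N" by (rule M)
    let ?M = "{x \<in> carrier G. N #> x \<in> M}"
    have M_eq: "M = (\<lambda>x. N #> x) ` ?M"
      using M.subset by (auto simp: carrier_FactGroup)
    have normal: "?M \<lhd> G" by (rule normal_vimage[OF proj M])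
    have sub: "N \<subseteq> ?M"
    proof
      fix x assume "x \<in> N"
      then show "x \<in> ?M" using coset_N[of x] N.subset M.one_closed by auto
    qed
    show "M = carrier (G Mod N) \<or> M = {\<one>\<^bsub>G Mod N\<^esub>}"
    proof (cases "?M = carrier G")
      case True
      then show ?thesis using M_eq by (simp add: carrier_FactGroup)
    next
      case False
      then have "?M = N" using normal sub max by blast
      then have "M = (\<lambda>x. N #> x) ` N" using M_eq by simp
      also have "\<dots> = (\<lambda>x. N) ` N" using coset_N N.subset by (intro image_cong) auto
      also have "\<dots> = {N}" using N.one_closed by blast
      finally show ?thesis by simp
    qed
  qed
  then show thesis using that N by blast
qed

end

theorem theorem1:
  fixes n :: nat
    and H :: "('h, 'm) monoid_scheme"
    and \<phi> :: "braid_word set \<Rightarrow> 'h"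
  assumes "n \<in> {5, 6, 7, 8}"
    and "group H"
    and "\<phi> \<in> epi (braid_commutator_group n) H"
    and "\<not> trivial_group H"
  shows "H \<cong> alt_group n \<or> infinite (carrier H) \<or> order H > fact n div 2"
proof -
  interpret H: group H by (rule assms(2))
  obtain e where e: "e \<in> hom (braid_group n) integer_group" "\<And>i. 1 \<le> i \<Longrightarrow> i < n \<Longrightarrow> e (braid_gen n i) = 1"
    by (rule braid_exponent_sum) blast
  obtain p where p: "p \<in> hom (braid_group n) (sym_group n)"
    "\<And>i. 1 \<le> i \<Longrightarrow> i < n \<Longrightarrow> p (braid_gen n i) = transpose i (Suc i)"
    by (rule braid_permutation) blast
  interpret braid_invariants n e p
    using assms(1) e p by unfold_locales auto
  have "H \<cong> alt_group n" if fin: "finite (carrier H)" and small: "order H \<le> fact n div 2"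
  proof -
    have "carrier H \<noteq> {\<one>\<^bsub>H\<^esub>}" using assms(2,4) by (simp add: trivial_group_def)
    then obtain N where N: "N \<lhd> H" "simple_group (H Mod N)" using H.ex_simple_quotient[OF fin] by blast
    interpret N: normal N H by (rule N)
    interpret Q: simple_group "H Mod N" by (rule N)
    have phi: "\<phi> \<in> hom C H" "\<phi> ` carrier C = carrier H" using assms(3) by (simp_all add: epi_def)
    let ?psi = "\<lambda>x. N #>\<^bsub>H\<^esub> \<phi> x"
    have "?psi \<in> hom C (H Mod N)"
      using hom_compose[OF phi(1) N.r_coset_hom_Mod] by (simp add: comp_def)
    then interpret psi: group_hom C "H Mod N" ?psi
      by (intro group_hom.intro C_group Q.is_group group_hom_axioms.intro)
    have "?psi ` carrier C = carrier (H Mod N)"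
      using phi(2) by (simp add: carrier_FactGroup image_image flip: phi(2))
    from psi.FactGroup_iso[OF this] obtain K where K: "K \<lhd> C" "C Mod K \<cong> H Mod N"
      using psi.normal_kernel by blast
    have finQ: "finite (carrier (H Mod N))" using fin by (simp add: carrier_FactGroup)
    have "H Mod N \<cong> C Mod K" using K(2) normal.factorgroup_is_group[OF K(1)] group.iso_sym by blast
    then have "simple_group (C Mod K)"
      using Q.iso_simple[OF normal.factorgroup_is_group[OF K(1)]] by (auto simp: is_iso_def)
    moreover have "finite (carrier (C Mod K))" using finQ iso_finite[OF K(2)] by simp
    ultimately have "C Mod K \<cong> alt_group n \<or> order (C Mod K) > fact n div 2"
      by (rule maximal_quotient[OF assms(1) K(1)])
    moreover have order_Q: "order (C Mod K) = order (H Mod N)"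
      using iso_same_card[OF K(2)] by (simp add: order_def)
    moreover have lagrange: "order (H Mod N) * card N = order H"
      using H.lagrange[OF N.subgroup_axioms] by (simp add: order_def FactGroup_def)
    moreover have "N \<noteq> {}" using N.one_closed by blast
    moreover from this have "card N > 0" using finite_subset[OF N.subset fin] by (simp add: card_gt_0_iff)
    moreover have "order (H Mod N) \<le> order (H Mod N) * card N" using \<open>card N > 0\<close> by simp
    ultimately have alt: "C Mod K \<cong> alt_group n" using small by linarith
    \<comment> \<open>The quotient already has the largest order allowed for $H$, so $N$ is trivial.\<close>
    then have "order (H Mod N) = fact n div 2"
      using order_Q iso_same_card[OF alt] alt_group_card_carrier[of n] n5 by (simp add: order_def)
    then have "order (H Mod N) * card N \<le> order (H Mod N) * 1" using lagrange small by simp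
    then have "card N = 1" using \<open>card N > 0\<close> Q.order_gt_one by (simp only: mult_le_cancel1) simp
    then have "N = {\<one>\<^bsub>H\<^esub>}" using N.one_closed by (metis card_1_singletonE singletonD)
    then have "H Mod N \<cong> H" using H.trivial_factor_iso by (auto simp: is_iso_def)
    then have "H \<cong> H Mod N" using Q.iso_sym by blast
    also have "H Mod N \<cong> C Mod K" by fact
    also have "C Mod K \<cong> alt_group n" by (rule alt)
    finally show ?thesis .
  qed
  then show ?thesis by fastforce
qed

end
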